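(* The diagram with rows $$0\to H_0^2(\Omega)\xrightarrow{\nabla}H_0^1(\Omega;\mathbb{R}^3)\xrightarrow{\operatorname{curl}}H_0(\operatorname{div},\Omega)\xrightarrow{\operatorname{div}}L_0^2(\Omega)\to0,$$ $$0\to W_h\xrightarrow{\nabla}\Phi_h\xrightarrow{\operatorname{curl}}V_h^{\operatorname{div}}\xrightarrow{\operatorname{div}}\mathcal{Q}_h\to0$$ and vertical maps $I_h^W,\ I_h^{\Phi},\ I_h^{\mathrm{RT}},\ Q_h$ (from the top row to the bottom row, in this order) commutes; that is, $$\nabla(I_h^Wv)=I_h^{\Phi}(\nabla v)\ \ \forall v\in H_0^2(\Omega),\qquad \operatorname{curl}(I_h^{\Phi}\boldsymbol{v})=I_h^{\mathrm{RT}}(\operatorname{curl}\boldsymbol{v})\ \ \forall\boldsymbol{v}\in H_0^1(\Omega;\mathbb{R}^3),$$ $$\operatorname{div}(I_h^{\mathrm{RT}}\boldsymbol{v})=Q_h(\operatorname{div}\boldsymbol{v})\ \ \forall\boldsymbol{v}\in H_0(\operatorname{div},\Omega).$$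
   Context: $\Omega\subset\mathbb{R}^3$ is a bounded, topologically trivial polyhedral domain with tetrahedral mesh $\mathcal{T}_h$. $\mathbb{P}_k(D)$: polynomials of degree at most $k$. $L_0^2(\Omega)$: zero-mean $L^2$ functions. $H_0(\operatorname{div},\Omega)$ (resp. $H_0(\operatorname{curl},\Omega)$): fields in $L^2$ with $\operatorname{div}$ (resp. $\operatorname{curl}$) in $L^2$ and vanishing normal (resp. tangential) trace on $\partial\Omega$. Each edge $e$ has a fixed unit tangent $\boldsymbol{t}$, each face $F$ a fixed unit normal $\boldsymbol{n}$. $b_T$ is the product of the four barycentric coordinates of $T$. Spaces. $W_h$: all $v_h\in L^2(\Omega)$ with $v_h|_T\in\mathbb{P}_2(T)\oplus b_T\mathbb{P}_1(T)$ whose degrees of freedom $v(\texttt{v})$ (vertices), $\int_ev\,\mathrm{d}s$ (edges), $\int_F\partial_nv\,\mathrm{d}S$ (faces) are single-valued, and vanish on $\partial\Omega$. $\Phi_h$: all $\boldsymbol{v}_h\in L^2(\Omega;\mathbb{R}^3)$ with $\boldsymbol{v}_h|_T\in\mathbb{P}_1(T;\mathbb{R}^3)\oplus\nabla(b_T\mathbb{P}_1(T))$ whose degrees of freedom $\int_e(\boldsymbol{v}\cdot\boldsymbol{t})q\,\mathrm{d}s$ ($q\in\mathbb{P}_1(e)$) and $\int_F\boldsymbol{v}\cdot\boldsymbol{n}\,\mathrm{d}S$ are single-valued, and vanish on $\partial\Omega$. $V_h^{\operatorname{div}}=\{\boldsymbol{v}_h\in H_0(\operatorname{div},\Omega):\boldsymbol{v}_h|_T\in\mathbb{P}_0(T;\mathbb{R}^3)\oplus\boldsymbol{x}\mathbb{P}_0(T)\}$,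 $\mathcal{Q}_h=\{v_h\in L_0^2(\Omega):v_h|_T\in\mathbb{P}_0(T)\}$, $V_h^{\operatorname{grad}}=\{v_h\in H_0^1(\Omega):v_h|_T\in\mathbb{P}_2(T)\}$, $V_h^{\mathrm{ND}}=\{\boldsymbol{v}_h\in H_0(\operatorname{curl},\Omega):\boldsymbol{v}_h|_T\in\mathbb{P}_1(T;\mathbb{R}^3)\}$ (for all $T\in\mathcal{T}_h$). Known operators. $\Pi_h^{\operatorname{grad}}:H_0^1(\Omega)\to V_h^{\operatorname{grad}}$, $\Pi_h^{\mathrm{ND}}:H_0(\operatorname{curl},\Omega)\to V_h^{\mathrm{ND}}$, $I_h^{\mathrm{RT}}:H_0(\operatorname{div},\Omega)\to V_h^{\operatorname{div}}$, $Q_h:L_0^2(\Omega)\to\mathcal{Q}_h$ are the $L^2$-bounded projection operators of Arnold–Guzmán and Christiansen–Winther, which are known to satisfy $\nabla\Pi_h^{\operatorname{grad}}=\Pi_h^{\mathrm{ND}}\nabla$ on $H_0^1(\Omega)$, $\operatorname{curl}\Pi_h^{\mathrm{ND}}=I_h^{\mathrm{RT}}\operatorname{curl}$ on $H_0(\operatorname{curl},\Omega)$, and $\operatorname{div}I_h^{\mathrm{RT}}=Q_h\operatorname{div}$ on $H_0(\operatorname{div},\Omega)$. New operators. $I_h^{\Phi}:H_0^1(\Omega;\mathbb{R}^3)\to\Phi_h$: $\int_e(I_h^{\Phi}\boldsymbol{v})\cdot\boldsymbol{t}\,q\,\mathrm{d}s=\int_e(\Pi_h^{\mathrm{ND}}\boldsymbol{v})\cdot\boldsymbol{t}\,q\,\mathrm{d}s$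 for $q\in\mathbb{P}_1(e)$ and interior edges $e$, and $\int_F(I_h^{\Phi}\boldsymbol{v})\cdot\boldsymbol{n}\,\mathrm{d}S=\int_F\boldsymbol{v}\cdot\boldsymbol{n}\,\mathrm{d}S$ for interior faces $F$. $I_h^W:H_0^2(\Omega)\to W_h$: $(I_h^Wv)(\texttt{v})=(\Pi_h^{\operatorname{grad}}v)(\texttt{v})$ at interior vertices, $\int_eI_h^Wv\,\mathrm{d}s=\int_e\Pi_h^{\operatorname{grad}}v\,\mathrm{d}s$ on interior edges, $\int_F\partial_n(I_h^Wv)\,\mathrm{d}S=\int_F\partial_nv\,\mathrm{d}S$ on interior faces. *)

theory Defs
  imports "HOL-Analysis.Analysis"
begin

text \<open>
  Elements of \<open>L\<^sup>2\<close> are represented by functions on the whole of \<open>real^3\<close>; only their values almost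
  everywhere on \<open>\<Omega>\<close> matter, and equality of such elements is \<open>ae_eq \<Omega>\<close>.
\<close>


section \<open>Classical derivatives and test functions\<close>

definition pd :: "3 \<Rightarrow> (real^3 \<Rightarrow> real) \<Rightarrow> real^3 \<Rightarrow> real" where
  "pd i f x = frechet_derivative f (at x) (axis i 1)"

definition grad :: "(real^3 \<Rightarrow> real) \<Rightarrow> real^3 \<Rightarrow> real^3" where
  "grad f x = (\<chi> i. pd i f x)"

definition component :: "3 \<Rightarrow> (real^3 \<Rightarrow> real^3) \<Rightarrow> real^3 \<Rightarrow> real" where
  "component i v x = v x $ i"

definition curl :: "(real^3 \<Rightarrow> real^3) \<Rightarrow> real^3 \<Rightarrow> real^3" where
  "curl v x = vector [pd 2 (component 3 v) x - pd 3 (component 2 v) x,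
                      pd 3 (component 1 v) x - pd 1 (component 3 v) x,
                      pd 1 (component 2 v) x - pd 2 (component 1 v) x]"

primrec Ck :: "nat \<Rightarrow> (real^3 \<Rightarrow> real) \<Rightarrow> bool" where
  "Ck 0 f \<longleftrightarrow> continuous_on UNIV f"
| "Ck (Suc k) f \<longleftrightarrow> f differentiable_on UNIV \<and> (\<forall>i. Ck k (pd i f))"

definition test :: "(real^3) set \<Rightarrow> (real^3 \<Rightarrow> real) set" where
  "test S = {\<phi>. (\<forall>k. Ck k \<phi>) \<and> compact (closure {x. \<phi> x \<noteq> 0}) \<and> closure {x. \<phi> x \<noteq> 0} \<subseteq> S}"

definition vtest :: "(real^3) set \<Rightarrow> (real^3 \<Rightarrow> real^3) set" where
  "vtest S = {\<psi>. \<forall>i. component i \<psi> \<in> test S}"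


section \<open>Square-integrable functions and weak derivatives\<close>

definition sq_int :: "'a measure \<Rightarrow> ('a \<Rightarrow> 'b::euclidean_space) set" where
  "sq_int M = {f \<in> borel_measurable M. integrable M (\<lambda>x. (norm (f x))\<^sup>2)}"

definition l2norm :: "'a measure \<Rightarrow> ('a \<Rightarrow> 'b::euclidean_space) \<Rightarrow> real" where
  "l2norm M f = sqrt (\<integral>x. (norm (f x))\<^sup>2 \<partial>M)"

abbreviation L2 :: "(real^3) set \<Rightarrow> (real^3 \<Rightarrow> 'b::euclidean_space) set" where
  "L2 \<Omega> \<equiv> sq_int (lebesgue_on \<Omega>)"

definition ae_eq :: "(real^3) set \<Rightarrow> (real^3 \<Rightarrow> 'b::euclidean_space) \<Rightarrow> (real^3 \<Rightarrow> 'b) \<Rightarrow> bool" where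
  "ae_eq \<Omega> f g \<longleftrightarrow> (AE x in lebesgue_on \<Omega>. f x = g x)"

definition has_weak_grad :: "(real^3) set \<Rightarrow> (real^3 \<Rightarrow> real) \<Rightarrow> (real^3 \<Rightarrow> real^3) \<Rightarrow> bool" where
  "has_weak_grad \<Omega> u g \<longleftrightarrow> u \<in> L2 \<Omega> \<and> g \<in> L2 \<Omega> \<and>
     (\<forall>\<phi>\<in>test \<Omega>. (\<integral>x. u x *\<^sub>R grad \<phi> x \<partial>lebesgue_on \<Omega>) = - (\<integral>x. \<phi> x *\<^sub>R g x \<partial>lebesgue_on \<Omega>))"

definition has_weak_curl :: "(real^3) set \<Rightarrow> (real^3 \<Rightarrow> real^3) \<Rightarrow> (real^3 \<Rightarrow> real^3) \<Rightarrow> bool" where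
  "has_weak_curl \<Omega> v w \<longleftrightarrow> v \<in> L2 \<Omega> \<and> w \<in> L2 \<Omega> \<and>
     (\<forall>\<psi>\<in>vtest \<Omega>. (\<integral>x. v x \<bullet> curl \<psi> x \<partial>lebesgue_on \<Omega>) = (\<integral>x. w x \<bullet> \<psi> x \<partial>lebesgue_on \<Omega>))"

definition has_weak_div :: "(real^3) set \<Rightarrow> (real^3 \<Rightarrow> real^3) \<Rightarrow> (real^3 \<Rightarrow> real) \<Rightarrow> bool" where
  "has_weak_div \<Omega> v d \<longleftrightarrow> v \<in> L2 \<Omega> \<and> d \<in> L2 \<Omega> \<and>
     (\<forall>\<phi>\<in>test \<Omega>. (\<integral>x. v x \<bullet> grad \<phi> x \<partial>lebesgue_on \<Omega>) = - (\<integral>x. d x * \<phi> x \<partial>lebesgue_on \<Omega>))"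

text \<open>Representatives of the weak derivatives, which are unique up to \<open>ae_eq \<Omega>\<close>.\<close>

definition wgrad :: "(real^3) set \<Rightarrow> (real^3 \<Rightarrow> real) \<Rightarrow> real^3 \<Rightarrow> real^3" where
  "wgrad \<Omega> u = (SOME g. has_weak_grad \<Omega> u g)"

definition wcurl :: "(real^3) set \<Rightarrow> (real^3 \<Rightarrow> real^3) \<Rightarrow> real^3 \<Rightarrow> real^3" where
  "wcurl \<Omega> v = (SOME w. has_weak_curl \<Omega> v w)"

definition wdiv :: "(real^3) set \<Rightarrow> (real^3 \<Rightarrow> real^3) \<Rightarrow> real^3 \<Rightarrow> real" where
  "wdiv \<Omega> v = (SOME d. has_weak_div \<Omega> v d)"


section \<open>The spaces of the continuous complex\<close>

text \<open>\<open>H1_conv \<Omega> \<phi> u\<close>: the smooth functions \<open>\<phi> n\<close> converge to \<open>u\<close> in the norm of \<open>H\<^sup>1(\<Omega>)\<close>.\<close>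

definition H1_conv :: "(real^3) set \<Rightarrow> (nat \<Rightarrow> real^3 \<Rightarrow> real) \<Rightarrow> (real^3 \<Rightarrow> real) \<Rightarrow> bool" where
  "H1_conv \<Omega> \<phi> u \<longleftrightarrow> (\<exists>g. has_weak_grad \<Omega> u g \<and>
     (\<lambda>n. l2norm (lebesgue_on \<Omega>) (\<lambda>x. \<phi> n x - u x)) \<longlonglongrightarrow> 0 \<and>
     (\<lambda>n. l2norm (lebesgue_on \<Omega>) (\<lambda>x. grad (\<phi> n) x - g x)) \<longlonglongrightarrow> 0)"

text \<open>\<open>H01\<close> and \<open>H02\<close> are the closures of \<open>test \<Omega>\<close> in \<open>H\<^sup>1(\<Omega>)\<close> and \<open>H\<^sup>2(\<Omega>)\<close>.\<close>

definition H01 :: "(real^3) set \<Rightarrow> (real^3 \<Rightarrow> real) set" where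
  "H01 \<Omega> = {u. \<exists>\<phi>. (\<forall>n. \<phi> n \<in> test \<Omega>) \<and> H1_conv \<Omega> \<phi> u}"

definition H02 :: "(real^3) set \<Rightarrow> (real^3 \<Rightarrow> real) set" where
  "H02 \<Omega> = {u. \<exists>\<phi> g. (\<forall>n. \<phi> n \<in> test \<Omega>) \<and> has_weak_grad \<Omega> u g \<and>
     (\<lambda>n. l2norm (lebesgue_on \<Omega>) (\<lambda>x. \<phi> n x - u x)) \<longlonglongrightarrow> 0 \<and>
     (\<forall>i. H1_conv \<Omega> (\<lambda>n. pd i (\<phi> n)) (component i g))}"

definition H01_vec :: "(real^3) set \<Rightarrow> (real^3 \<Rightarrow> real^3) set" where
  "H01_vec \<Omega> = {v. \<forall>i. component i v \<in> H01 \<Omega>}"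

text \<open>
  The tangential and normal traces of a field are the functionals given by Green's formula,
  applied to functions that are smooth up to the boundary (here: restrictions of elements of
  \<open>vtest UNIV\<close> and \<open>test UNIV\<close>).
\<close>

definition H0curl :: "(real^3) set \<Rightarrow> (real^3 \<Rightarrow> real^3) set" where
  "H0curl \<Omega> = {v. \<exists>w. has_weak_curl \<Omega> v w \<and>
     (\<forall>\<psi>\<in>vtest UNIV. (\<integral>x. v x \<bullet> curl \<psi> x \<partial>lebesgue_on \<Omega>) - (\<integral>x. w x \<bullet> \<psi> x \<partial>lebesgue_on \<Omega>) = 0)}"

definition H0div :: "(real^3) set \<Rightarrow> (real^3 \<Rightarrow> real^3) set" where
  "H0div \<Omega> = {v. \<exists>d. has_weak_div \<Omega> v d \<and>
     (\<forall>\<phi>\<in>test UNIV. (\<integral>x. v x \<bullet> grad \<phi> x \<partial>lebesgue_on \<Omega>) + (\<integral>x. d x * \<phi> x \<partial>lebesgue_on \<Omega>) = 0)}"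

definition L20 :: "(real^3) set \<Rightarrow> (real^3 \<Rightarrow> real) set" where
  "L20 \<Omega> = {u \<in> L2 \<Omega>. (\<integral>x. u x \<partial>lebesgue_on \<Omega>) = 0}"


section \<open>Polyhedral domains and tetrahedral meshes\<close>

text \<open>The condition \<open>\<Omega> = interior (closure \<Omega>)\<close> excludes cracks and removed lower-dimensional sets.\<close>

definition polyhedral_domain :: "(real^3) set \<Rightarrow> bool" where
  "polyhedral_domain \<Omega> \<longleftrightarrow> \<Omega> \<noteq> {} \<and> open \<Omega> \<and> connected \<Omega> \<and> \<Omega> = interior (closure \<Omega>) \<and>
     (\<exists>P. finite P \<and> (\<forall>p\<in>P. polytope p) \<and> closure \<Omega> = \<Union>P)"

definition tet_mesh :: "(real^3) set \<Rightarrow> (real^3) set set \<Rightarrow> bool" where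
  "tet_mesh \<Omega> \<T> \<longleftrightarrow> triangulation \<T> \<and> (\<forall>T\<in>\<T>. 3 simplex T) \<and> closure \<Omega> = \<Union>\<T>"

text \<open>\<open>subsimplices \<T> k\<close>: the vertices (as singletons), edges and faces of the mesh for \<open>k = 0, 1, 2\<close>.\<close>

definition subsimplices :: "(real^3) set set \<Rightarrow> int \<Rightarrow> (real^3) set set" where
  "subsimplices \<T> k = {S. k simplex S \<and> (\<exists>T\<in>\<T>. S face_of T)}"

definition oriented :: "(real^3) set set \<Rightarrow> ((real^3) set \<Rightarrow> real^3) \<Rightarrow> ((real^3) set \<Rightarrow> real^3) \<Rightarrow> bool" where
  "oriented \<T> tng nrm \<longleftrightarrow>
     (\<forall>e\<in>subsimplices \<T> 1. norm (tng e) = 1 \<and> (\<forall>x\<in>e. \<forall>y\<in>e. x - y \<in> span {tng e})) \<and>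
     (\<forall>F\<in>subsimplices \<T> 2. norm (nrm F) = 1 \<and> (\<forall>x\<in>F. \<forall>y\<in>F. (x - y) \<bullet> nrm F = 0))"

text \<open>
  Arc length on an edge and surface measure on a face, through an affine parametrisation by the
  reference simplex; the measures do not depend on the chosen ordering of the vertices.
\<close>

definition edge_measure :: "(real^3) set \<Rightarrow> (real^3) measure" where
  "edge_measure e = (let (a, b) = (SOME (a, b). e = convex hull {a, b}) in
     scale_measure (ennreal (dist a b))
       (distr (restrict_space lborel {0..1::real}) borel (\<lambda>s. a + s *\<^sub>R (b - a))))"

definition face_measure :: "(real^3) set \<Rightarrow> (real^3) measure" where
  "face_measure F = (let (a, b, c) = (SOME (a, b, c). F = convex hull {a, b, c}) in
     scale_measure (ennreal (norm (cross3 (b - a) (c - a))))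
       (distr (restrict_space lborel {(s, t). 0 \<le> s \<and> 0 \<le> t \<and> s + t \<le> (1::real)}) borel
         (\<lambda>(s, t). a + s *\<^sub>R (b - a) + t *\<^sub>R (c - a))))"

text \<open>
  The trace in \<open>L\<^sup>2(F)\<close> of an \<open>H\<^sup>1\<close> function, as the limit of the restrictions to \<open>F\<close> of smooth
  approximations; it is unique up to a null set of \<open>face_measure F\<close>.
\<close>

definition face_trace :: "(real^3) set \<Rightarrow> (real^3) set \<Rightarrow> (real^3 \<Rightarrow> real) \<Rightarrow> real^3 \<Rightarrow> real" where
  "face_trace \<Omega> F u = (SOME \<tau>. \<tau> \<in> sq_int (face_measure F) \<and>
     (\<exists>\<phi>. (\<forall>n. \<phi> n \<in> test UNIV) \<and> H1_conv \<Omega> \<phi> u \<and>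
       (\<lambda>n. l2norm (face_measure F) (\<lambda>x. \<phi> n x - \<tau> x)) \<longlonglongrightarrow> 0))"

definition face_vtrace :: "(real^3) set \<Rightarrow> (real^3) set \<Rightarrow> (real^3 \<Rightarrow> real^3) \<Rightarrow> real^3 \<Rightarrow> real^3" where
  "face_vtrace \<Omega> F v x = (\<chi> i. face_trace \<Omega> F (component i v) x)"


section \<open>Local polynomial spaces\<close>

definition polys :: "nat \<Rightarrow> (real^3 \<Rightarrow> real) set" where
  "polys k = {p. \<exists>c. p = (\<lambda>x. \<Sum>\<alpha> | (\<Sum>i\<in>UNIV. \<alpha> i) \<le> k. c \<alpha> * (\<Prod>i\<in>UNIV. x $ i ^ \<alpha> i))}"

definition vpolys :: "nat \<Rightarrow> (real^3 \<Rightarrow> real^3) set" where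
  "vpolys k = {p. \<forall>i. component i p \<in> polys k}"

definition bary :: "(real^3) set \<Rightarrow> real^3 \<Rightarrow> real^3 \<Rightarrow> real" where
  "bary T a = (THE l. l \<in> polys 1 \<and> l a = 1 \<and> (\<forall>b. b extreme_point_of T \<and> b \<noteq> a \<longrightarrow> l b = 0))"

definition bubble :: "(real^3) set \<Rightarrow> real^3 \<Rightarrow> real" where
  "bubble T x = (\<Prod>a | a extreme_point_of T. bary T a x)"

definition W_loc :: "(real^3) set \<Rightarrow> (real^3 \<Rightarrow> real) set" where
  "W_loc T = {\<lambda>x. p x + bubble T x * q x | p q. p \<in> polys 2 \<and> q \<in> polys 1}"

definition Phi_loc :: "(real^3) set \<Rightarrow> (real^3 \<Rightarrow> real^3) set" where
  "Phi_loc T = {\<lambda>x. p x + grad (\<lambda>y. bubble T y * q y) x | p q. p \<in> vpolys 1 \<and> q \<in> polys 1}"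

definition RT_loc :: "(real^3 \<Rightarrow> real^3) set" where
  "RT_loc = {\<lambda>x. p x + r x *\<^sub>R x | p r. p \<in> vpolys 0 \<and> r \<in> polys 0}"

definition piecewise :: "(real^3) set set \<Rightarrow> ((real^3) set \<Rightarrow> (real^3 \<Rightarrow> 'b::euclidean_space) set) \<Rightarrow>
    (real^3 \<Rightarrow> 'b) \<Rightarrow> bool" where
  "piecewise \<T> S v \<longleftrightarrow> (\<forall>T\<in>\<T>. \<exists>p\<in>S T. AE x in lebesgue_on T. v x = p x)"

text \<open>
  The polynomial that represents \<open>v\<close> on \<open>T\<close>. Degrees of freedom are point values and integrals over
  null sets, so they are evaluated on this polynomial rather than on \<open>v\<close>.
\<close>

definition restr :: "(real^3) set \<Rightarrow> (real^3 \<Rightarrow> real) \<Rightarrow> real^3 \<Rightarrow> real" where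
  "restr T v = (THE p. p \<in> (\<Union>k. polys k) \<and> (AE x in lebesgue_on T. v x = p x))"

definition vrestr :: "(real^3) set \<Rightarrow> (real^3 \<Rightarrow> real^3) \<Rightarrow> real^3 \<Rightarrow> real^3" where
  "vrestr T v x = (\<chi> i. restr T (component i v) x)"


section \<open>The finite element spaces\<close>

text \<open>
  \<open>N T S\<close> is a degree of freedom attached to the subsimplex \<open>S\<close>, computed from the element \<open>T\<close>.
\<close>

definition single_valued :: "(real^3) set set \<Rightarrow> int \<Rightarrow> ((real^3) set \<Rightarrow> (real^3) set \<Rightarrow> real) \<Rightarrow> bool" where
  "single_valued \<T> k N \<longleftrightarrow> (\<forall>S\<in>subsimplices \<T> k. \<forall>T\<in>\<T>. \<forall>T'\<in>\<T>.
     S face_of T \<and> S face_of T' \<longrightarrow> N T S = N T' S)"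

definition vanishing :: "(real^3) set \<Rightarrow> (real^3) set set \<Rightarrow> int \<Rightarrow>
    ((real^3) set \<Rightarrow> (real^3) set \<Rightarrow> real) \<Rightarrow> bool" where
  "vanishing \<Omega> \<T> k N \<longleftrightarrow> (\<forall>S\<in>subsimplices \<T> k. \<forall>T\<in>\<T>.
     S face_of T \<and> S \<subseteq> frontier \<Omega> \<longrightarrow> N T S = 0)"

definition agree_interior :: "(real^3) set \<Rightarrow> (real^3) set set \<Rightarrow> int \<Rightarrow>
    ((real^3) set \<Rightarrow> (real^3) set \<Rightarrow> real) \<Rightarrow> ((real^3) set \<Rightarrow> (real^3) set \<Rightarrow> real) \<Rightarrow> bool" where
  "agree_interior \<Omega> \<T> k N M \<longleftrightarrow> (\<forall>S\<in>subsimplices \<T> k. \<forall>T\<in>\<T>.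
     S face_of T \<and> \<not> S \<subseteq> frontier \<Omega> \<longrightarrow> N T S = M T S)"

definition dof_vertex :: "(real^3 \<Rightarrow> real) \<Rightarrow> (real^3) set \<Rightarrow> (real^3) set \<Rightarrow> real" where
  "dof_vertex v T S = restr T v (the_elem S)"

definition dof_edge :: "(real^3 \<Rightarrow> real) \<Rightarrow> (real^3) set \<Rightarrow> (real^3) set \<Rightarrow> real" where
  "dof_edge v T e = (\<integral>x. restr T v x \<partial>edge_measure e)"

definition dof_normal_deriv :: "((real^3) set \<Rightarrow> real^3) \<Rightarrow> (real^3 \<Rightarrow> real) \<Rightarrow>
    (real^3) set \<Rightarrow> (real^3) set \<Rightarrow> real" where
  "dof_normal_deriv nrm v T F = (\<integral>x. grad (restr T v) x \<bullet> nrm F \<partial>face_measure F)"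

definition dof_tangential :: "((real^3) set \<Rightarrow> real^3) \<Rightarrow> (real^3 \<Rightarrow> real) \<Rightarrow> (real^3 \<Rightarrow> real^3) \<Rightarrow>
    (real^3) set \<Rightarrow> (real^3) set \<Rightarrow> real" where
  "dof_tangential tng q v T e = (\<integral>x. (vrestr T v x \<bullet> tng e) * q x \<partial>edge_measure e)"

definition dof_normal :: "((real^3) set \<Rightarrow> real^3) \<Rightarrow> (real^3 \<Rightarrow> real^3) \<Rightarrow>
    (real^3) set \<Rightarrow> (real^3) set \<Rightarrow> real" where
  "dof_normal nrm v T F = (\<integral>x. vrestr T v x \<bullet> nrm F \<partial>face_measure F)"

definition W_h :: "(real^3) set \<Rightarrow> (real^3) set set \<Rightarrow> ((real^3) set \<Rightarrow> real^3) \<Rightarrow> (real^3 \<Rightarrow> real) set" where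
  "W_h \<Omega> \<T> nrm = {v \<in> L2 \<Omega>. piecewise \<T> W_loc v \<and>
     single_valued \<T> 0 (dof_vertex v) \<and> vanishing \<Omega> \<T> 0 (dof_vertex v) \<and>
     single_valued \<T> 1 (dof_edge v) \<and> vanishing \<Omega> \<T> 1 (dof_edge v) \<and>
     single_valued \<T> 2 (dof_normal_deriv nrm v) \<and> vanishing \<Omega> \<T> 2 (dof_normal_deriv nrm v)}"

definition Phi_h :: "(real^3) set \<Rightarrow> (real^3) set set \<Rightarrow> ((real^3) set \<Rightarrow> real^3) \<Rightarrow>
    ((real^3) set \<Rightarrow> real^3) \<Rightarrow> (real^3 \<Rightarrow> real^3) set" where
  "Phi_h \<Omega> \<T> tng nrm = {v \<in> L2 \<Omega>. piecewise \<T> Phi_loc v \<and>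
     (\<forall>q\<in>polys 1. single_valued \<T> 1 (dof_tangential tng q v) \<and>
                  vanishing \<Omega> \<T> 1 (dof_tangential tng q v)) \<and>
     single_valued \<T> 2 (dof_normal nrm v) \<and> vanishing \<Omega> \<T> 2 (dof_normal nrm v)}"

definition Vh_div :: "(real^3) set \<Rightarrow> (real^3) set set \<Rightarrow> (real^3 \<Rightarrow> real^3) set" where
  "Vh_div \<Omega> \<T> = {v \<in> H0div \<Omega>. piecewise \<T> (\<lambda>T. RT_loc) v}"

definition Q_space :: "(real^3) set \<Rightarrow> (real^3) set set \<Rightarrow> (real^3 \<Rightarrow> real) set" where
  "Q_space \<Omega> \<T> = {v \<in> L20 \<Omega>. piecewise \<T> (\<lambda>T. polys 0) v}"

definition Vh_grad :: "(real^3) set \<Rightarrow> (real^3) set set \<Rightarrow> (real^3 \<Rightarrow> real) set" where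
  "Vh_grad \<Omega> \<T> = {v \<in> H01 \<Omega>. piecewise \<T> (\<lambda>T. polys 2) v}"

definition Vh_ND :: "(real^3) set \<Rightarrow> (real^3) set set \<Rightarrow> (real^3 \<Rightarrow> real^3) set" where
  "Vh_ND \<Omega> \<T> = {v \<in> H0curl \<Omega>. piecewise \<T> (\<lambda>T. vpolys 1) v}"


section \<open>The operators\<close>

definition l2_projection :: "(real^3) set \<Rightarrow> (real^3 \<Rightarrow> 'b::euclidean_space) set \<Rightarrow>
    (real^3 \<Rightarrow> 'b) set \<Rightarrow> ((real^3 \<Rightarrow> 'b) \<Rightarrow> real^3 \<Rightarrow> 'b) \<Rightarrow> bool" where
  "l2_projection \<Omega> X X\<^sub>h P \<longleftrightarrow>
     (\<forall>u\<in>X. P u \<in> X\<^sub>h) \<and>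
     (\<forall>u\<in>X. \<forall>v\<in>X. \<forall>a b. ae_eq \<Omega> (P (\<lambda>x. a *\<^sub>R u x + b *\<^sub>R v x)) (\<lambda>x. a *\<^sub>R P u x + b *\<^sub>R P v x)) \<and>
     (\<forall>u\<in>X\<^sub>h. ae_eq \<Omega> (P u) u) \<and>
     (\<exists>C. \<forall>u\<in>X. l2norm (lebesgue_on \<Omega>) (P u) \<le> C * l2norm (lebesgue_on \<Omega>) u)"

text \<open>
  In the next two definitions the edge and vertex degrees of freedom of \<open>\<Pi>\<^sub>N\<^sub>D v\<close> and \<open>\<Pi>\<^sub>g v\<close> are, like
  those of the interpolants, single-valued, so both sides may be computed from the same element.
\<close>

definition is_I_Phi :: "(real^3) set \<Rightarrow> (real^3) set set \<Rightarrow> ((real^3) set \<Rightarrow> real^3) \<Rightarrow>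
    ((real^3) set \<Rightarrow> real^3) \<Rightarrow> ((real^3 \<Rightarrow> real^3) \<Rightarrow> real^3 \<Rightarrow> real^3) \<Rightarrow>
    ((real^3 \<Rightarrow> real^3) \<Rightarrow> real^3 \<Rightarrow> real^3) \<Rightarrow> bool" where
  "is_I_Phi \<Omega> \<T> tng nrm \<Pi>\<^sub>N\<^sub>D I \<longleftrightarrow> (\<forall>v\<in>H01_vec \<Omega>. I v \<in> Phi_h \<Omega> \<T> tng nrm \<and>
     (\<forall>q\<in>polys 1. agree_interior \<Omega> \<T> 1 (dof_tangential tng q (I v)) (dof_tangential tng q (\<Pi>\<^sub>N\<^sub>D v))) \<and>
     agree_interior \<Omega> \<T> 2 (dof_normal nrm (I v))
       (\<lambda>T F. \<integral>x. face_vtrace \<Omega> F v x \<bullet> nrm F \<partial>face_measure F))"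

definition is_I_W :: "(real^3) set \<Rightarrow> (real^3) set set \<Rightarrow> ((real^3) set \<Rightarrow> real^3) \<Rightarrow>
    ((real^3 \<Rightarrow> real) \<Rightarrow> real^3 \<Rightarrow> real) \<Rightarrow> ((real^3 \<Rightarrow> real) \<Rightarrow> real^3 \<Rightarrow> real) \<Rightarrow> bool" where
  "is_I_W \<Omega> \<T> nrm \<Pi>\<^sub>g I \<longleftrightarrow> (\<forall>v\<in>H02 \<Omega>. I v \<in> W_h \<Omega> \<T> nrm \<and>
     agree_interior \<Omega> \<T> 0 (dof_vertex (I v)) (dof_vertex (\<Pi>\<^sub>g v)) \<and>
     agree_interior \<Omega> \<T> 1 (dof_edge (I v)) (dof_edge (\<Pi>\<^sub>g v)) \<and>
     agree_interior \<Omega> \<T> 2 (dof_normal_deriv nrm (I v))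
       (\<lambda>T F. \<integral>x. face_vtrace \<Omega> F (wgrad \<Omega> v) x \<bullet> nrm F \<partial>face_measure F))"

end

theory Submission
  imports Defs
begin

text \<open>
  On an element, \<open>I\<^sub>\<Phi> v\<close> is an affine field plus \<open>grad (b q)\<close> with the bubble \<open>b\<close>, and \<open>I\<^sub>W v\<close> is a
  quadratic polynomial plus \<open>b q\<close>. Since \<open>b q\<close> does not contribute to vertex and edge degrees of
  freedom, unisolvence identifies the affine part with \<open>\<Pi>\<^sub>N\<^sub>D v\<close> and the quadratic part with \<open>\<Pi>\<^sub>g v\<close>.
  The bubbles glue to a function whose weak gradient is computed elementwise, so
  \<open>I\<^sub>\<Phi> v = \<Pi>\<^sub>N\<^sub>D v + grad B\<close>, where \<open>grad B\<close> has no curl; this gives the second identity. For the first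
  one it remains to see that the two bubble functions coincide, which follows from the face degrees
  of freedom, because the face averages of the normal derivative of \<open>b q\<close> determine \<open>q\<close>.

  The delicate point is that the degrees of freedom of \<open>\<Pi>\<^sub>g v\<close> and \<open>\<Pi>\<^sub>N\<^sub>D v\<close> on the boundary vanish
  also for elements that touch the boundary only in a vertex or an edge. This is proved by
  magnification at a boundary point: the extension by zero has a bounded weak derivative on the whole
  space, so the limit is a function that is constant on cones and has weak derivative zero. Such a
  function is constant, hence zero, because the exterior cone has nonempty interior.
\<close>

section \<open>Polynomials\<close>

text \<open>Unisolvence needs all degrees of freedom of an element, but the interpolants are tied to
  \<open>\<Pi>\<^sub>g\<close> and \<open>\<Pi>\<^sub>N\<^sub>D\<close> only on interior
  subsimplices. On the boundary the values of the projections must come from \<open>H01\<close> and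
  \<open>H0curl\<close>, whose boundary conditions are given by closure and by Green's formula, on a
  polyhedral domain that need not be Lipschitz. What both conditions yield is an integral identity
  against test functions on the whole space, and the magnification uses nothing else. In
  \<open>H0curl\<close> only tangential components are controlled; hence the magnification point is
  taken inside an edge, and invariance along the edge is exploited. The traces behind
  \<open>face_vtrace\<close> are never evaluated: for \<open>wgrad \<Omega> v\<close> both
  interpolants refer to the same face integral, which cancels. The bubble coefficient is then
  recovered because on a face the gradient of \<open>b q\<close> is normal, and its normal component
  integrates to a nonzero multiple of the sum of \<open>q\<close> over the three vertices of the
  face; the 4 by 4 matrix with zero diagonal and ones elsewhere is invertible.\<close>

lemma prod_3: "(\<Prod>i\<in>(UNIV::3 set). f i) = f 1 * f 2 * f 3"
  unfolding UNIV_3 by (simp add: ac_simps)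

lemma nat_sum_3_le_1:
  assumes "a + b + c \<le> (1::nat)"
  obtains "a = 0" "b = 0" "c = 0" | "a = 1" "b = 0" "c = 0" | "a = 0" "b = 1" "c = 0"
    | "a = 0" "b = 0" "c = 1"
proof -
  have "(a = 0 \<and> b = 0 \<and> c = 0) \<or> (a = 1 \<and> b = 0 \<and> c = 0) \<or> (a = 0 \<and> b = 1 \<and> c = 0) \<or>
      (a = 0 \<and> b = 0 \<and> c = 1)"
    using assms by presburger
  with that show thesis by blast
qed

lemma nat_sum_3_eq_2:
  assumes "a + b + c = (2::nat)"
  obtains "a = 2" "b = 0" "c = 0" | "a = 0" "b = 2" "c = 0" | "a = 0" "b = 0" "c = 2"
    | "a = 1" "b = 1" "c = 0" | "a = 1" "b = 0" "c = 1" | "a = 0" "b = 1" "c = 1"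
proof -
  have "(a = 2 \<and> b = 0 \<and> c = 0) \<or> (a = 0 \<and> b = 2 \<and> c = 0) \<or> (a = 0 \<and> b = 0 \<and> c = 2) \<or>
      (a = 1 \<and> b = 1 \<and> c = 0) \<or> (a = 1 \<and> b = 0 \<and> c = 1) \<or> (a = 0 \<and> b = 1 \<and> c = 1)"
    using assms by presburger
  with that show thesis by blast
qed

lemma finite_multiindices: "finite {\<alpha>::3\<Rightarrow>nat. (\<Sum>i\<in>UNIV. \<alpha> i) \<le> k}"
proof (rule finite_subset)
  show "{\<alpha>::3\<Rightarrow>nat. (\<Sum>i\<in>UNIV. \<alpha> i) \<le> k} \<subseteq> Pi\<^sub>E UNIV (\<lambda>_. {..k})"
  proof (clarsimp simp: PiE_iff extensional_def)
    fix \<alpha> :: "3 \<Rightarrow> nat" and i assume "sum \<alpha> UNIV \<le> k"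
    moreover have "\<alpha> i \<le> sum \<alpha> UNIV" by (rule member_le_sum) auto
    ultimately show "\<alpha> i \<le> k" by simp
  qed
  show "finite (Pi\<^sub>E (UNIV::3 set) (\<lambda>_. {..k}))"
    by (intro finite_PiE) auto
qed

lemma polys_add: "p \<in> polys k \<Longrightarrow> q \<in> polys k \<Longrightarrow> (\<lambda>x. p x + q x) \<in> polys k"
  unfolding polys_def
  by (force simp: sum.distrib[symmetric] distrib_right[symmetric])

lemma polys_cmult: "p \<in> polys k \<Longrightarrow> (\<lambda>x. a * p x) \<in> polys k"
  unfolding polys_def
  by (force simp: sum_distrib_left mult.assoc[symmetric])

lemma polys_zero: "(\<lambda>x. 0) \<in> polys k"
  unfolding polys_def by (auto intro!: exI[of _ "\<lambda>_. 0"])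

lemma polys_sum: "(\<And>i. i \<in> I \<Longrightarrow> p i \<in> polys k) \<Longrightarrow> (\<lambda>x. \<Sum>i\<in>I. p i x) \<in> polys k"
  by (induction I rule: infinite_finite_induct) (auto intro: polys_add polys_zero)

lemma monomial_polys:
  "(\<Sum>i\<in>UNIV. \<alpha> i) \<le> k \<Longrightarrow> (\<lambda>x. \<Prod>i\<in>UNIV. x $ i ^ \<alpha> i) \<in> polys k"
  unfolding polys_def mem_Collect_eq
  by (rule exI[of _ "\<lambda>\<beta>. if \<beta> = \<alpha> then 1 else 0"])
     (auto simp: if_distrib[of "\<lambda>c. c * _"] sum.delta finite_multiindices cong: if_cong)

text \<open>The monomials span, so a property closed under linear combinations can be checked on
  them; \<open>zero\<close> covers the empty sum.\<close>

lemma polys_induct [consumes 1, case_names monomial cmult add zero]: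
  assumes "p \<in> polys k"
    and monomial: "\<And>\<alpha>. (\<Sum>i\<in>UNIV. \<alpha> i) \<le> k \<Longrightarrow> P (\<lambda>x. \<Prod>i\<in>UNIV. x $ i ^ \<alpha> i)"
    and cmult: "\<And>a f. P f \<Longrightarrow> P (\<lambda>x. a * f x)"
    and add: "\<And>f g. P f \<Longrightarrow> P g \<Longrightarrow> P (\<lambda>x. f x + g x)"
    and zero: "P (\<lambda>x. 0)"
  shows "P p"
proof -
  obtain c where p: "p = (\<lambda>x. \<Sum>\<alpha> | (\<Sum>i\<in>UNIV. \<alpha> i) \<le> k. c \<alpha> * (\<Prod>i\<in>UNIV. x $ i ^ \<alpha> i))"
    using assms(1) unfolding polys_def by auto
  have "P (\<lambda>x. \<Sum>\<alpha>\<in>S. c \<alpha> * (\<Prod>i\<in>UNIV. x $ i ^ \<alpha> i))"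
    if "finite S" "S \<subseteq> {\<alpha>. (\<Sum>i\<in>UNIV. \<alpha> i) \<le> k}" for S
    using that by (induction S rule: finite_induct) (auto intro!: zero add cmult monomial)
  then show ?thesis
    unfolding p using finite_multiindices by blast
qed

lemma polys_mono:
  assumes "p \<in> polys k" "k \<le> l"
  shows "p \<in> polys l"
  using assms(1)
  by (induction rule: polys_induct)
     (use assms(2) in \<open>auto intro: polys_add polys_cmult polys_zero monomial_polys\<close>)

lemma polys_const: "(\<lambda>x. c) \<in> polys k"
  using polys_cmult[OF monomial_polys[of "\<lambda>_. 0" k], of c] by simp

lemma polys_coord: "(\<lambda>x. x $ i) \<in> polys 1"
proof -
  have "(\<lambda>x::real^3. \<Prod>j\<in>UNIV. x $ j ^ (if j = i then 1 else 0)) \<in> polys 1"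
    by (rule monomial_polys) simp
  moreover have "(\<Prod>j\<in>UNIV. x $ j ^ (if j = i then 1 else 0)) = x $ i" for x :: "real^3"
    by (simp add: if_distrib[of "\<lambda>n. _ ^ n"] prod.delta cong: if_cong)
  ultimately show ?thesis by simp
qed

lemma polys_affine: "(\<lambda>x. c + w \<bullet> x) \<in> polys 1"
  unfolding inner_vec_def inner_real_def
  by (intro polys_add polys_const polys_sum polys_cmult polys_coord)

lemma polys_1_cases:
  assumes "p \<in> polys 1"
  obtains c w where "p = (\<lambda>x. c + w \<bullet> x)"
proof -
  have "\<exists>c w. p = (\<lambda>x. c + w \<bullet> x)"
    using assms
  proof (induction rule: polys_induct)
    case (monomial \<alpha>)
    then have "\<alpha> 1 + \<alpha> 2 + \<alpha> 3 \<le> 1" by (simp add: sum_3)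
    then consider "\<alpha> 1 = 0" "\<alpha> 2 = 0" "\<alpha> 3 = 0" | "\<alpha> 1 = 1" "\<alpha> 2 = 0" "\<alpha> 3 = 0"
      | "\<alpha> 1 = 0" "\<alpha> 2 = 1" "\<alpha> 3 = 0" | "\<alpha> 1 = 0" "\<alpha> 2 = 0" "\<alpha> 3 = 1"
      by (rule nat_sum_3_le_1)
    then show ?case
    proof cases
      case 1
      then show ?thesis
        by (intro exI[of _ 1] exI[of _ 0]) (simp add: prod_3)
    next
      case 2
      then show ?thesis
        by (intro exI[of _ 0] exI[of _ "axis 1 1"]) (simp add: prod_3 inner_axis')
    next
      case 3
      then show ?thesis
        by (intro exI[of _ 0] exI[of _ "axis 2 1"]) (simp add: prod_3 inner_axis')
    next
      case 4
      then show ?thesis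
        by (intro exI[of _ 0] exI[of _ "axis 3 1"]) (simp add: prod_3 inner_axis')
    qed
  next
    case (cmult a f)
    then obtain c w where "f = (\<lambda>x. c + w \<bullet> x)" by blast
    then show ?case
      by (intro exI[of _ "a * c"] exI[of _ "a *\<^sub>R w"]) (auto simp: algebra_simps)
  next
    case (add f g)
    then obtain c w d u where "f = (\<lambda>x. c + w \<bullet> x)" "g = (\<lambda>x. d + u \<bullet> x)" by blast
    then show ?case
      by (intro exI[of _ "c + d"] exI[of _ "w + u"]) (auto simp: algebra_simps)
  qed (auto intro!: exI[of _ 0])
  then show ?thesis using that by blast
qed

text \<open>The monomial \<open>x $ i * x $ j\<close> is the form of
  \<open>\<lambda>x. x $ j *\<^sub>R axis i 1\<close>. Such an \<open>A\<close> need not be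
  symmetric, so gradients computed later contain \<open>A\<close> together with its adjoint.\<close>

lemma polys_2_cases:
  assumes "p \<in> polys 2"
  obtains c w A where "linear A" "p = (\<lambda>x. c + w \<bullet> x + x \<bullet> A x)"
proof -
  have aff: "\<exists>c w A. linear A \<and> p = (\<lambda>x. c + w \<bullet> x + x \<bullet> A x)" if "p \<in> polys 1" for p
    using polys_1_cases[OF that]
    by (metis (no_types, lifting) add.right_neutral inner_zero_right module_hom_zero)
  have sq: "\<exists>c w A. linear A \<and> (\<lambda>x::real^3. x $ i * x $ j) = (\<lambda>x. c + w \<bullet> x + x \<bullet> A x)" for i j
    by (intro exI[of _ 0] exI[of _ "0::real^3"] exI[of _ "\<lambda>x. x $ j *\<^sub>R axis i 1"])
       (auto simp: inner_axis algebra_simps intro!: linearI)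
  have "\<exists>c w A. linear A \<and> p = (\<lambda>x. c + w \<bullet> x + x \<bullet> A x)"
    using assms
  proof (induction rule: polys_induct)
    case (monomial \<alpha>)
    show ?case
    proof (cases "(\<Sum>i\<in>UNIV. \<alpha> i) \<le> 1")
      case True
      then show ?thesis by (intro aff monomial_polys)
    next
      case False
      with monomial have "\<alpha> 1 + \<alpha> 2 + \<alpha> 3 = 2" by (simp add: sum_3)
      then consider "\<alpha> 1 = 2" "\<alpha> 2 = 0" "\<alpha> 3 = 0" | "\<alpha> 1 = 0" "\<alpha> 2 = 2" "\<alpha> 3 = 0"
        | "\<alpha> 1 = 0" "\<alpha> 2 = 0" "\<alpha> 3 = 2" | "\<alpha> 1 = 1" "\<alpha> 2 = 1" "\<alpha> 3 = 0"
        | "\<alpha> 1 = 1" "\<alpha> 2 = 0" "\<alpha> 3 = 1" | "\<alpha> 1 = 0" "\<alpha> 2 = 1" "\<alpha> 3 = 1"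
        by (rule nat_sum_3_eq_2)
      then show ?thesis
      proof cases
        case 1 then have "(\<lambda>x::real^3. \<Prod>i\<in>UNIV. x $ i ^ \<alpha> i) = (\<lambda>x. x $ 1 * x $ 1)"
          by (simp add: prod_3 power2_eq_square)
        then show ?thesis by (simp only: sq)
      next
        case 2 then have "(\<lambda>x::real^3. \<Prod>i\<in>UNIV. x $ i ^ \<alpha> i) = (\<lambda>x. x $ 2 * x $ 2)"
          by (simp add: prod_3 power2_eq_square)
        then show ?thesis by (simp only: sq)
      next
        case 3 then have "(\<lambda>x::real^3. \<Prod>i\<in>UNIV. x $ i ^ \<alpha> i) = (\<lambda>x. x $ 3 * x $ 3)"
          by (simp add: prod_3 power2_eq_square)
        then show ?thesis by (simp only: sq)
      next
        case 4 then have "(\<lambda>x::real^3. \<Prod>i\<in>UNIV. x $ i ^ \<alpha> i) = (\<lambda>x. x $ 1 * x $ 2)"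
          by (simp add: prod_3)
        then show ?thesis by (simp only: sq)
      next
        case 5 then have "(\<lambda>x::real^3. \<Prod>i\<in>UNIV. x $ i ^ \<alpha> i) = (\<lambda>x. x $ 1 * x $ 3)"
          by (simp add: prod_3)
        then show ?thesis by (simp only: sq)
      next
        case 6 then have "(\<lambda>x::real^3. \<Prod>i\<in>UNIV. x $ i ^ \<alpha> i) = (\<lambda>x. x $ 2 * x $ 3)"
          by (simp add: prod_3)
        then show ?thesis by (simp only: sq)
      qed
    qed
  next
    case (cmult a f)
    then obtain c w A where "linear A" "f = (\<lambda>x. c + w \<bullet> x + x \<bullet> A x)" by blast
    then show ?case
      by (intro exI[of _ "a * c"] exI[of _ "a *\<^sub>R w"] exI[of _ "\<lambda>x. a *\<^sub>R A x"])
         (auto simp: algebra_simps intro: linear_compose_scale_right)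
  next
    case (add f g)
    then obtain c w A d u B where "linear A" "f = (\<lambda>x. c + w \<bullet> x + x \<bullet> A x)"
        "linear B" "g = (\<lambda>x. d + u \<bullet> x + x \<bullet> B x)" by blast
    then show ?case
      by (intro exI[of _ "c + d"] exI[of _ "w + u"] exI[of _ "\<lambda>x. A x + B x"])
         (auto simp: algebra_simps intro: linear_compose_add)
  next
    case zero
    show ?case by (intro aff polys_zero)
  qed
  then show ?thesis using that by blast
qed

lemma polys_mult:
  assumes "p \<in> (\<Union>k. polys k)" "q \<in> (\<Union>k. polys k)"
  shows "(\<lambda>x. p x * q x) \<in> (\<Union>k. polys k)"
proof -
  obtain k l where p: "p \<in> polys k" and q: "q \<in> polys l" using assms by auto
  have mono: "(\<lambda>x. (\<Prod>i\<in>UNIV. x $ i ^ \<alpha> i) * q x) \<in> polys (k + l)"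
    if \<alpha>: "(\<Sum>i\<in>UNIV. \<alpha> i) \<le> k" for \<alpha>
    using q
  proof (induction rule: polys_induct)
    case (monomial \<beta>)
    have "(\<lambda>x::real^3. \<Prod>i\<in>UNIV. x $ i ^ (\<alpha> i + \<beta> i)) \<in> polys (k + l)"
      by (rule monomial_polys) (use \<alpha> monomial in \<open>simp add: sum.distrib\<close>)
    then show ?case by (simp add: power_add prod.distrib)
  next
    case (cmult a f)
    then show ?case using polys_cmult[OF cmult, of a] by (simp add: algebra_simps)
  next
    case (add f g)
    then show ?case using polys_add[OF add] by (simp add: algebra_simps)
  qed (simp add: polys_zero)
  have "(\<lambda>x. p x * q x) \<in> polys (k + l)"
    using p
  proof (induction rule: polys_induct)
    case (cmult a f)
    then show ?case using polys_cmult[OF cmult, of a] by (simp add: algebra_simps)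
  next
    case (add f g)
    then show ?case using polys_add[OF add] by (simp add: algebra_simps)
  qed (simp_all add: polys_zero mono)
  then show ?thesis by blast
qed

lemma real_polynomial_function_coord: "real_polynomial_function (\<lambda>x::real^3. x $ i)"
  by (intro real_polynomial_function.intros(1) bounded_linear_vec_nth)

text \<open>Links the coefficient description to the inductive one, which is closed under products
  and derivatives without tracking degrees. The union is also the range of the description in
  \<open>restr\<close>.\<close>

lemma Union_polys: "(\<Union>k. polys k) = Collect real_polynomial_function"
proof (intro equalityI subsetI)
  fix p assume "p \<in> (\<Union>k. polys k)"
  then show "p \<in> Collect real_polynomial_function"
    unfolding polys_def
    by (auto intro!: real_polynomial_function_sum real_polynomial_function.intros(4)
        real_polynomial_function.intros(2) real_polynomial_function_prod
        real_polynomial_function_power real_polynomial_function_coord finite_multiindices)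
next
  fix p :: "real^3 \<Rightarrow> real" assume "p \<in> Collect real_polynomial_function"
  then have "real_polynomial_function p" by simp
  then show "p \<in> (\<Union>k. polys k)"
  proof induction
    case (linear f)
    have eq: "f x = (\<Sum>b\<in>Basis. f b *\<^sub>R b) \<bullet> x" for x
    proof -
      have "f x = (\<Sum>b\<in>Basis. (x \<bullet> b) * f b)"
        using Linear_Algebra.linear_componentwise[OF bounded_linear.linear[OF linear], of x 1] by simp
      also have "\<dots> = (\<Sum>b\<in>Basis. f b *\<^sub>R b) \<bullet> x"
        unfolding inner_sum_left
      proof (rule sum.cong)
        fix b :: "real^3"
        have "x \<bullet> b = b \<bullet> x" by (rule inner_commute)
        then show "(x \<bullet> b) * f b = (f b *\<^sub>R b) \<bullet> x" by simp
      qed simp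
      finally show ?thesis .
    qed
    have "(\<lambda>x. 0 + (\<Sum>b\<in>Basis. f b *\<^sub>R b) \<bullet> x) = f"
      by (intro ext) (simp only: add_0 eq[symmetric])
    then have "f \<in> polys 1" using polys_affine[of 0 "\<Sum>b\<in>Basis. f b *\<^sub>R b"] by simp
    then show ?case by blast
  next
    case (const c)
    then show ?case using polys_const by blast
  next
    case (add f g)
    then obtain k l where "f \<in> polys k" "g \<in> polys l" by auto
    then have "f \<in> polys (max k l)" "g \<in> polys (max k l)"
      by (auto intro: polys_mono)
    then show ?case using polys_add by blast
  next
    case (mult f g)
    then show ?case by (intro polys_mult)
  qed
qed

lemma polys_real_polynomial_function: "p \<in> polys k \<Longrightarrow> real_polynomial_function p"
  using Union_polys by blast

lemma real_polynomial_function_line: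
  fixes p :: "real^3 \<Rightarrow> real"
  assumes "real_polynomial_function p"
  shows "real_polynomial_function (\<lambda>s::real. p (a + s *\<^sub>R d))"
proof -
  have "polynomial_function (\<lambda>s::real. a + s *\<^sub>R d)"
    by (intro polynomial_function_add polynomial_function_const
        polynomial_function_bounded_linear bounded_linear_scaleR_left)
  then show ?thesis
    using real_polynomial_function_compose[of "\<lambda>s::real. a + s *\<^sub>R d" p] assms
    by (simp add: o_def)
qed

text \<open>On the line from a point of \<open>S\<close> through \<open>x\<close> the polynomial has
  one variable and infinitely many zeros, so it vanishes at parameter 1.\<close>

lemma real_polynomial_function_zero_on_open:
  fixes p :: "real^3 \<Rightarrow> real"
  assumes p: "real_polynomial_function p" and S: "open S" "S \<noteq> {}"
    and zero: "\<And>x. x \<in> S \<Longrightarrow> p x = 0"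
  shows "p x = 0"
proof -
  obtain a where "a \<in> S" using S by auto
  obtain c n where cn: "(\<lambda>s::real. p (a + s *\<^sub>R (x - a))) = (\<lambda>s. \<Sum>i\<le>n. c i * s ^ i)"
    using real_polynomial_function_imp_sum[OF real_polynomial_function_line[OF p]] by metis
  have "open ((\<lambda>s::real. a + s *\<^sub>R (x - a)) -` S)"
    by (intro open_vimage S continuous_intros)
  moreover have "0 \<in> (\<lambda>s::real. a + s *\<^sub>R (x - a)) -` S" using \<open>a \<in> S\<close> by simp
  ultimately obtain e where e: "e > 0" "ball 0 e \<subseteq> (\<lambda>s::real. a + s *\<^sub>R (x - a)) -` S"
    by (meson openE)
  have "ball (0::real) e \<subseteq> {s. (\<Sum>i\<le>n. c i * s ^ i) = 0}"
    using e(2) zero fun_cong[OF cn] by (fastforce simp: subset_iff vimage_def)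
  moreover have "infinite (ball (0::real) e)"
    using e(1) by (simp add: ball_eq_greaterThanLessThan infinite_Ioo)
  ultimately have "infinite {s. (\<Sum>i\<le>n. c i * s ^ i) = 0}"
    using finite_subset by blast
  then have "\<forall>i\<le>n. c i = 0"
    using polyfun_finite_roots[of c n] by auto
  then have "(\<Sum>i\<le>n. c i * 1 ^ i) = 0" by simp
  then show ?thesis using fun_cong[OF cn, of 1] by simp
qed

section \<open>Polynomial representatives of functions given almost everywhere\<close>

lemma AE_lebesgue_on_imp_AE:
  assumes "AE x in lebesgue_on S. P x" "S \<in> sets lebesgue"
  shows "AE x in lebesgue. x \<in> S \<longrightarrow> P x"
  using assms by (simp add: AE_restrict_space_iff)

text \<open>The set where two continuous functions differ is open in \<open>S\<close>, and a
  nonempty open set is not negligible.\<close>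

lemma continuous_AE_eq_on_open:
  fixes f g :: "real^3 \<Rightarrow> 'b::euclidean_space"
  assumes "AE x in lebesgue. x \<in> S \<longrightarrow> f x = g x" and S: "open S"
    and f: "continuous_on S f" and g: "continuous_on S g" and x: "x \<in> S"
  shows "f x = g x"
proof (rule ccontr)
  assume ne: "f x \<noteq> g x"
  have "open (S \<inter> (\<lambda>x. f x - g x) -` (- {0}))"
    by (intro continuous_open_preimage continuous_on_diff f g S) auto
  moreover have "S \<inter> (\<lambda>x. f x - g x) -` (- {0}) \<noteq> {}"
    using ne x by auto
  ultimately have "\<not> negligible (S \<inter> (\<lambda>x. f x - g x) -` (- {0}))"
    by (rule open_not_negligible)
  moreover have "negligible (S \<inter> (\<lambda>x. f x - g x) -` (- {0}))"
  proof -
    obtain N where N: "N \<in> null_sets lebesgue" "{x. \<not> (x \<in> S \<longrightarrow> f x = g x)} \<subseteq> N"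
      using assms(1) unfolding eventually_ae_filter by (auto simp: space_completion)
    then show ?thesis
      using negligible_subset[of N] by (auto simp: negligible_iff_null_sets subset_iff)
  qed
  ultimately show False by simp
qed

text \<open>Two polynomials of whatever degrees that agree almost everywhere on a set with interior
  points are equal; this makes the \<open>THE\<close> in \<open>restr\<close> determined.\<close>

lemma restr_eq:
  assumes p: "real_polynomial_function p" and ae: "AE x in lebesgue_on T. v x = p x"
    and T: "T \<in> sets lebesgue" "interior T \<noteq> {}"
  shows "restr T v = p"
  unfolding restr_def Union_polys mem_Collect_eq
proof (rule the_equality)
  show "real_polynomial_function p \<and> (AE x in lebesgue_on T. v x = p x)"
    using p ae by simp
next
  fix q assume q: "real_polynomial_function q \<and> (AE x in lebesgue_on T. v x = q x)"
  have "AE x in lebesgue_on T. p x = q x"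
    using ae q by (auto elim: AE_mp)
  then have "AE x in lebesgue. x \<in> T \<longrightarrow> p x = q x"
    using T by (rule_tac AE_lebesgue_on_imp_AE) auto
  then have "AE x in lebesgue. x \<in> interior T \<longrightarrow> p x = q x"
    by (rule AE_mp) (auto intro!: AE_I2 dest: interior_subset[THEN subsetD])
  then have "p x = q x" if "x \<in> interior T" for x
    by (rule continuous_AE_eq_on_open)
       (use that p q in \<open>auto intro!: continuous_on_polymonial_function simp: real_polynomial_function_eq\<close>)
  then have "q x - p x = 0" for x
    using real_polynomial_function_zero_on_open[of "\<lambda>x. q x - p x" "interior T" x] p q T(2)
      real_polynomial_function_diff[of q p] by simp
  then show "q = p" by (intro ext) (simp only: right_minus_eq)
qed

section \<open>Smooth functions and test functions\<close>

lemma pd_eq: "(f has_derivative f') (at x) \<Longrightarrow> pd i f x = f' (axis i 1)"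
  unfolding pd_def by (metis frechet_derivative_at)

lemma has_derivative_grad:
  assumes "f differentiable (at x)"
  shows "(f has_derivative (\<lambda>h. grad f x \<bullet> h)) (at x)"
proof -
  let ?f' = "frechet_derivative f (at x)"
  have f': "(f has_derivative ?f') (at x)"
    using assms frechet_derivative_works by blast
  then have lin: "linear ?f'" by (rule has_derivative_linear)
  have "?f' h = grad f x \<bullet> h" for h
  proof -
    have "?f' h = ?f' (\<Sum>i\<in>UNIV. h $ i *\<^sub>R axis i 1)"
      using basis_expansion[of h] by (simp add: scalar_mult_eq_scaleR)
    also have "\<dots> = (\<Sum>i\<in>UNIV. h $ i * ?f' (axis i 1))"
      using lin by (simp add: linear_sum linear_cmul)
    finally show ?thesis
      by (simp add: grad_def pd_def inner_vec_def mult.commute)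
  qed
  then have "?f' = (\<lambda>h. grad f x \<bullet> h)" by blast
  with f' show ?thesis by simp
qed

lemma grad_eq:
  assumes "(f has_derivative (\<lambda>h. g \<bullet> h)) (at x)"
  shows "grad f x = g"
  by (simp add: vec_eq_iff grad_def pd_eq[OF assms] inner_axis)

lemma grad_nth [simp]: "grad f x $ i = pd i f x"
  by (simp add: grad_def)

lemma pd_add:
  "f differentiable (at x) \<Longrightarrow> g differentiable (at x) \<Longrightarrow>
    pd i (\<lambda>x. f x + g x) x = pd i f x + pd i g x"
  by (subst pd_eq[OF has_derivative_add[OF has_derivative_grad has_derivative_grad]])
     (simp_all add: inner_axis)

lemma pd_cmult: "f differentiable (at x) \<Longrightarrow> pd i (\<lambda>x. c * f x) x = c * pd i f x"
  by (subst pd_eq[OF has_derivative_mult_right[OF has_derivative_grad]]) (simp_all add: inner_axis)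

lemma pd_mult:
  "f differentiable (at x) \<Longrightarrow> g differentiable (at x) \<Longrightarrow>
    pd i (\<lambda>x. f x * g x) x = f x * pd i g x + pd i f x * g x"
  by (subst pd_eq[OF has_derivative_mult[OF has_derivative_grad has_derivative_grad]])
     (simp_all add: inner_axis)

lemma pd_const: "pd i (\<lambda>x. c) x = 0"
  by (rule pd_eq) (rule has_derivative_const)

lemma grad_add:
  "f differentiable (at x) \<Longrightarrow> g differentiable (at x) \<Longrightarrow>
    grad (\<lambda>x. f x + g x) x = grad f x + grad g x"
  by (simp add: vec_eq_iff pd_add)

lemma grad_mult:
  "f differentiable (at x) \<Longrightarrow> g differentiable (at x) \<Longrightarrow>
    grad (\<lambda>x. f x * g x) x = f x *\<^sub>R grad g x + g x *\<^sub>R grad f x"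
  by (simp add: vec_eq_iff pd_mult)

definition smooth :: "(real^3 \<Rightarrow> real) \<Rightarrow> bool" where
  "smooth f \<longleftrightarrow> (\<forall>k. Ck k f)"

text \<open>A coinduction principle: exhibiting a family closed under \<open>pd\<close> replaces the
  computation of higher derivatives.\<close>

lemma smoothI:
  assumes "f \<in> S"
    and "\<And>f. f \<in> S \<Longrightarrow> f differentiable_on UNIV"
    and "\<And>f i. f \<in> S \<Longrightarrow> pd i f \<in> S"
  shows "smooth f"
proof -
  have "Ck k f" if "f \<in> S" for k f
    using that
  proof (induction k arbitrary: f)
    case 0
    then show ?case by (auto intro: differentiable_imp_continuous_on assms(2))
  qed (use assms in auto)
  then show ?thesis using assms(1) by (simp add: smooth_def)
qed

lemma smooth_differentiable: "smooth f \<Longrightarrow> f differentiable (at x)"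
  unfolding smooth_def by (metis Ck.simps(2) UNIV_I differentiable_on_def)

lemma smooth_differentiable_on: "smooth f \<Longrightarrow> f differentiable_on S"
  by (simp add: differentiable_on_def smooth_differentiable differentiable_at_withinI)

lemma smooth_pd: "smooth f \<Longrightarrow> smooth (pd i f)"
  unfolding smooth_def by (metis Ck.simps(2))

lemma smooth_continuous_on: "smooth f \<Longrightarrow> continuous_on S f"
  by (simp add: differentiable_imp_continuous_on smooth_differentiable_on)

lemma smooth_borel [measurable_dest]: "smooth f \<Longrightarrow> f \<in> borel_measurable borel"
  by (simp add: borel_measurable_continuous_onI smooth_continuous_on)

lemma smooth_grad_continuous_on: "smooth f \<Longrightarrow> continuous_on S (grad f)"
  unfolding grad_def by (intro continuous_on_vec_lambda smooth_continuous_on smooth_pd)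

lemma smooth_has_derivative: "smooth f \<Longrightarrow> (f has_derivative (\<lambda>h. grad f x \<bullet> h)) (at x)"
  by (intro has_derivative_grad smooth_differentiable)

lemma Ck_SucD: "Ck (Suc k) f \<Longrightarrow> Ck k f"
proof (induction k arbitrary: f)
  case 0
  then show ?case by (simp add: differentiable_imp_continuous_on)
qed auto

lemma Ck_add: "Ck k f \<Longrightarrow> Ck k g \<Longrightarrow> Ck k (\<lambda>x. f x + g x)"
proof (induction k arbitrary: f g)
  case (Suc k)
  have "pd i (\<lambda>x. f x + g x) = (\<lambda>x. pd i f x + pd i g x)" for i
    using Suc.prems by (intro ext pd_add) (auto simp: differentiable_on_def)
  with Suc show ?case by (simp add: differentiable_on_add)
qed (auto intro: continuous_intros)

lemma Ck_mult: "Ck k f \<Longrightarrow> Ck k g \<Longrightarrow> Ck k (\<lambda>x. f x * g x)"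
proof (induction k arbitrary: f g)
  case (Suc k)
  have "pd i (\<lambda>x. f x * g x) = (\<lambda>x. f x * pd i g x + pd i f x * g x)" for i
    using Suc.prems by (intro ext pd_mult) (auto simp: differentiable_on_def)
  moreover have "Ck k f" "Ck k g" using Suc.prems Ck_SucD by blast+
  ultimately show ?case using Suc by (auto simp: differentiable_on_mult intro!: Ck_add)
qed (auto intro: continuous_intros)

lemma smooth_add: "smooth f \<Longrightarrow> smooth g \<Longrightarrow> smooth (\<lambda>x. f x + g x)"
  by (simp add: smooth_def Ck_add)

lemma smooth_mult: "smooth f \<Longrightarrow> smooth g \<Longrightarrow> smooth (\<lambda>x. f x * g x)"
  by (simp add: smooth_def Ck_mult)

lemma smooth_const: "smooth (\<lambda>x. c)"
proof (rule smoothI)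
  show "(\<lambda>x. c) \<in> range (\<lambda>c x. c)" by blast
  show "f differentiable_on UNIV" if "f \<in> range (\<lambda>c x. c)" for f :: "real^3 \<Rightarrow> real"
    using that by auto
  show "pd i f \<in> range (\<lambda>c x. c)" if "f \<in> range (\<lambda>c x. c)" for f i
    using that pd_const by (auto intro!: image_eqI[of _ _ 0])
qed

lemma smooth_cmult: "smooth f \<Longrightarrow> smooth (\<lambda>x. c * f x)"
  by (intro smooth_mult smooth_const)

lemma smooth_uminus: "smooth f \<Longrightarrow> smooth (\<lambda>x. - f x)"
  using smooth_cmult[of f "-1"] by simp

lemma smooth_diff: "smooth f \<Longrightarrow> smooth g \<Longrightarrow> smooth (\<lambda>x. f x - g x)"
  using smooth_add[of f "\<lambda>x. - g x"] smooth_uminus by simp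

lemma smooth_prod: "(\<And>i. i \<in> I \<Longrightarrow> smooth (f i)) \<Longrightarrow> smooth (\<lambda>x. \<Prod>i\<in>I. f i x)"
  by (induction I rule: infinite_finite_induct) (auto intro: smooth_const smooth_mult)

text \<open>The family closed under \<open>pd\<close> carries a free factor \<open>c\<close>, which
  absorbs the power of \<open>r\<close> that each differentiation produces.\<close>

lemma smooth_affine:
  fixes a :: "real^3"
  assumes "smooth f"
  shows "smooth (\<lambda>x. f (a + r *\<^sub>R x))" "pd i (\<lambda>x. f (a + r *\<^sub>R x)) = (\<lambda>x. r * pd i f (a + r *\<^sub>R x))"
proof -
  have D: "((\<lambda>x. c * g (a + r *\<^sub>R x)) has_derivative (\<lambda>h. c * (grad g (a + r *\<^sub>R x) \<bullet> (r *\<^sub>R h)))) (at x)"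
    if "smooth g" for c g and x :: "real^3"
  proof -
    have "((\<lambda>x. a + r *\<^sub>R x) has_derivative (\<lambda>h. r *\<^sub>R h)) (at x)"
      by (auto intro!: derivative_eq_intros)
    from has_derivative_compose[OF this smooth_has_derivative[OF that]] show ?thesis
      by (rule has_derivative_mult_right)
  qed
  have pd: "pd i (\<lambda>x. c * g (a + r *\<^sub>R x)) = (\<lambda>x. (c * r) * pd i g (a + r *\<^sub>R x))" if "smooth g" for c g i
    by (intro ext, subst pd_eq[OF D[OF that]]) (simp add: inner_axis)
  show "pd i (\<lambda>x. f (a + r *\<^sub>R x)) = (\<lambda>x. r * pd i f (a + r *\<^sub>R x))"
    using pd[OF assms, of i 1] by simp
  show "smooth (\<lambda>x. f (a + r *\<^sub>R x))"
  proof (rule smoothI)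
    show "(\<lambda>x. f (a + r *\<^sub>R x)) \<in> {\<lambda>x. c * g (a + r *\<^sub>R x) |c g. smooth g}"
      using assms by (auto intro!: exI[of _ 1])
    show "h differentiable_on UNIV" if "h \<in> {\<lambda>x. c * g (a + r *\<^sub>R x) |c g. smooth g}" for h
      using that D by (auto simp: differentiable_on_def differentiable_def)
    show "pd i h \<in> {\<lambda>x. c * g (a + r *\<^sub>R x) |c g. smooth g}"
      if hh: "h \<in> {\<lambda>x. c * g (a + r *\<^sub>R x) |c g. smooth g}" for i h
    proof -
      obtain c g where h: "h = (\<lambda>x. c * g (a + r *\<^sub>R x))" and g: "smooth g" using hh by blast
      from g have "smooth (pd i g)" by (rule smooth_pd)
      then show ?thesis unfolding h pd[OF g] by blast
    qed
  qed
qed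

text \<open>\<open>D k\<close> plays the role of the \<open>k\<close>-th derivative of a function of
  one variable; by the chain rule each partial derivative moves from \<open>D k\<close> to
  \<open>D (Suc k)\<close> and multiplies by a component of \<open>w\<close>.\<close>

lemma smooth_compose_functional:
  fixes D :: "nat \<Rightarrow> real \<Rightarrow> real" and w :: "real^3"
  assumes D: "\<And>k t. (D k has_real_derivative D (Suc k) t) (at t)"
  shows "smooth (\<lambda>x. D 0 (c + w \<bullet> x))"
proof (rule smoothI)
  have D': "((\<lambda>x. a * D k (c + w \<bullet> x)) has_derivative (\<lambda>h. a * (D (Suc k) (c + w \<bullet> x) * (w \<bullet> h)))) (at x)"
    for a k and x :: "real^3"
  proof -
    have "((\<lambda>x. c + w \<bullet> x) has_derivative (\<lambda>h. w \<bullet> h)) (at x)"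
      by (auto intro!: derivative_eq_intros)
    from has_derivative_compose[OF this D[unfolded has_field_derivative_def]] show ?thesis
      by (rule has_derivative_mult_right)
  qed
  show "(\<lambda>x. D 0 (c + w \<bullet> x)) \<in> {\<lambda>x. a * D k (c + w \<bullet> x) |a k. True}"
    unfolding mem_Collect_eq by (rule exI[of _ 1], rule exI[of _ 0]) simp
  show "h differentiable_on UNIV" if "h \<in> {\<lambda>x. a * D k (c + w \<bullet> x) |a k. True}" for h
    using that D' by (auto simp: differentiable_on_def differentiable_def)
  show "pd i h \<in> {\<lambda>x. a * D k (c + w \<bullet> x) |a k. True}"
    if h: "h \<in> {\<lambda>x. a * D k (c + w \<bullet> x) |a k. True}" for i h
  proof -
    obtain a k where h: "h = (\<lambda>x. a * D k (c + w \<bullet> x))" using h by auto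
    have "pd i h = (\<lambda>x. (a * w $ i) * D (Suc k) (c + w \<bullet> x))"
      unfolding h by (intro ext, subst pd_eq[OF D']) (simp add: inner_axis)
    then show ?thesis by blast
  qed
qed

lemma real_polynomial_function_differentiable:
  "real_polynomial_function (p::real^3 \<Rightarrow> real) \<Longrightarrow> p differentiable (at x)"
  by (rule differentiable_at_real_polynomial_function)

lemma real_polynomial_function_pd:
  assumes "real_polynomial_function p"
  shows "real_polynomial_function (pd i p)"
  using assms
proof induction
  case (linear f)
  then have "pd i f = (\<lambda>x. f (axis i 1))"
    by (intro ext pd_eq) (rule bounded_linear_imp_has_derivative)
  then show ?case by (simp add: real_polynomial_function.intros(2))
next
  case (const c)
  have "pd i (\<lambda>x. c) = (\<lambda>x. 0)" by (intro ext pd_const)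
  then show ?case by (simp add: real_polynomial_function.intros(2))
next
  case (add f g)
  then have "pd i (\<lambda>x. f x + g x) = (\<lambda>x. pd i f x + pd i g x)"
    by (intro ext pd_add real_polynomial_function_differentiable)
  with add show ?case by (simp add: real_polynomial_function.intros(3))
next
  case (mult f g)
  then have "pd i (\<lambda>x. f x * g x) = (\<lambda>x. f x * pd i g x + pd i f x * g x)"
    by (intro ext pd_mult real_polynomial_function_differentiable)
  with mult show ?case by (simp add: real_polynomial_function.intros(3,4))
qed

lemma real_polynomial_function_smooth:
  assumes "real_polynomial_function p"
  shows "smooth p"
proof (rule smoothI[of _ "Collect real_polynomial_function"])
  fix f :: "real^3 \<Rightarrow> real" assume "f \<in> Collect real_polynomial_function"
  then show "f differentiable_on UNIV"
    by (auto simp: differentiable_on_def intro: real_polynomial_function_differentiable)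
qed (use assms real_polynomial_function_pd in auto)

lemma testI:
  assumes "smooth f" "compact K" "K \<subseteq> S" "\<And>x. x \<notin> K \<Longrightarrow> f x = 0"
  shows "f \<in> test S"
proof -
  have "closure {x. f x \<noteq> 0} \<subseteq> K"
    using assms by (intro closure_minimal compact_imp_closed) auto
  moreover from this have "compact (closure {x. f x \<noteq> 0})"
    using assms(2) by (meson bounded_subset closed_closure compact_eq_bounded_closed)
  ultimately show ?thesis using assms by (auto simp: test_def smooth_def)
qed

lemma testE:
  assumes "f \<in> test S"
  obtains K where "compact K" "K \<subseteq> S" "\<And>x. x \<notin> K \<Longrightarrow> f x = 0" "\<And>x i. x \<notin> K \<Longrightarrow> pd i f x = 0"
proof -
  define K where "K = closure {x. f x \<noteq> 0}"
  have K: "compact K" "K \<subseteq> S" using assms by (auto simp: test_def K_def)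
  have z: "f x = 0" if "x \<notin> K" for x
    using that closure_subset[of "{x. f x \<noteq> 0}"] unfolding K_def by blast
  have "open (- K)" using K(1) by (simp add: compact_imp_closed open_Compl)
  have "pd i f x = 0" if "x \<notin> K" for x i
  proof -
    have "((\<lambda>x. 0::real) has_derivative (\<lambda>h. 0)) (at x)" by simp
    then have "(f has_derivative (\<lambda>h. 0)) (at x)"
      by (rule has_derivative_transform_within_open[OF _ \<open>open (- K)\<close>]) (simp_all add: that z)
    from pd_eq[OF this] show ?thesis .
  qed
  with K z that show thesis by blast
qed

lemma test_smooth: "f \<in> test S \<Longrightarrow> smooth f"
  by (simp add: test_def smooth_def)

lemma test_mono: "f \<in> test S \<Longrightarrow> S \<subseteq> S' \<Longrightarrow> f \<in> test S'"
  by (auto simp: test_def)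

lemma test_mult:
  assumes "f \<in> test S" "smooth g"
  shows "(\<lambda>x. f x * g x) \<in> test S"
proof -
  obtain K where "compact K" "K \<subseteq> S" "\<And>x. x \<notin> K \<Longrightarrow> f x = 0" using assms(1) by (rule testE) blast
  then show ?thesis
    by (intro testI[of _ K] smooth_mult test_smooth[OF assms(1)] assms(2)) auto
qed

lemma test_pd:
  assumes "f \<in> test S"
  shows "pd i f \<in> test S"
proof -
  obtain K where "compact K" "K \<subseteq> S" "\<And>x i. x \<notin> K \<Longrightarrow> pd i f x = 0" using assms by (rule testE) blast
  then show ?thesis
    by (intro testI[of _ K] smooth_pd test_smooth[OF assms]) auto
qed

lemma test_cmult: "f \<in> test S \<Longrightarrow> (\<lambda>x. c * f x) \<in> test S"
  using test_mult[OF _ smooth_const[of c]] by (simp add: mult.commute)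

lemma test_add:
  assumes "f \<in> test S" "g \<in> test S"
  shows "(\<lambda>x. f x + g x) \<in> test S"
proof -
  obtain K where K: "compact K" "K \<subseteq> S" "\<And>x. x \<notin> K \<Longrightarrow> f x = 0" using assms(1) by (rule testE) blast
  obtain L where L: "compact L" "L \<subseteq> S" "\<And>x. x \<notin> L \<Longrightarrow> g x = 0" using assms(2) by (rule testE) blast
  show ?thesis
    by (rule testI[of _ "K \<union> L"]) (use K L assms in \<open>auto intro: smooth_add test_smooth\<close>)
qed

lemma test_diff: "f \<in> test S \<Longrightarrow> g \<in> test S \<Longrightarrow> (\<lambda>x. f x - g x) \<in> test S"
  using test_add[of f S "\<lambda>x. (-1) * g x"] test_cmult[of g S "-1"] by simp

lemma test_affine:
  assumes "f \<in> test UNIV" "r \<noteq> 0"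
  shows "(\<lambda>x. f (a + r *\<^sub>R x)) \<in> test UNIV"
proof -
  obtain K where K: "compact K" "\<And>x. x \<notin> K \<Longrightarrow> f x = 0" using assms(1) by (rule testE) blast
  show ?thesis
  proof (rule testI)
    show "smooth (\<lambda>x. f (a + r *\<^sub>R x))" using assms by (intro smooth_affine test_smooth)
    show "compact ((\<lambda>y. (1 / r) *\<^sub>R (y - a)) ` K)"
      by (intro compact_continuous_image K continuous_intros)
    show "f (a + r *\<^sub>R x) = 0" if "x \<notin> (\<lambda>y. (1 / r) *\<^sub>R (y - a)) ` K" for x
      using that assms(2) by (intro K(2)) (force simp: image_iff)
  qed simp
qed

text \<open>Collects the bounds that the dominated convergence arguments need; the Lipschitz
  estimate is the mean value inequality on the convex set \<open>UNIV\<close>.\<close>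

lemma test_bounds:
  assumes "f \<in> test S"
  obtains M R where "M \<ge> 0" "R > 0" "\<And>x. \<bar>f x\<bar> \<le> M" "\<And>x. norm (grad f x) \<le> M"
    "\<And>x. norm x \<ge> R \<Longrightarrow> f x = 0" "\<And>x. norm x \<ge> R \<Longrightarrow> grad f x = 0"
    "\<And>x y. \<bar>f x - f y\<bar> \<le> M * norm (x - y)"
proof -
  obtain K where K: "compact K" "\<And>x. x \<notin> K \<Longrightarrow> f x = 0" "\<And>x i. x \<notin> K \<Longrightarrow> pd i f x = 0"
    using assms(1) by (rule testE) blast
  have smooth: "smooth f" using assms by (rule test_smooth)
  obtain R where R: "\<And>x. x \<in> K \<Longrightarrow> norm x \<le> R"
    using K(1) compact_imp_bounded bounded_iff by metis
  have "bounded (f ` K)" "bounded (grad f ` K)"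
    by (intro compact_imp_bounded compact_continuous_image K smooth_continuous_on
        smooth_grad_continuous_on smooth)+
  then obtain M N where M: "\<And>x. x \<in> K \<Longrightarrow> norm (f x) \<le> M" and N: "\<And>x. x \<in> K \<Longrightarrow> norm (grad f x) \<le> N"
    unfolding bounded_iff by (metis imageI)
  let ?M = "max 0 (max M N)"
  have gr: "grad f x = 0" if "x \<notin> K" for x using K(3)[OF that] by (simp add: vec_eq_iff)
  have grM: "norm (grad f x) \<le> ?M" for x
    using N[of x] gr[of x] by (cases "x \<in> K") auto
  show thesis
  proof
    show "?M \<ge> 0" by simp
    show "max 1 (R + 1) > 0" by simp
    show "\<bar>f x\<bar> \<le> ?M" for x using M[of x] K(2)[of x] by (cases "x \<in> K") auto
    show "norm (grad f x) \<le> ?M" for x by (rule grM)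
    show "f x = 0" if "norm x \<ge> max 1 (R + 1)" for x using that R[of x] K(2) by force
    show "grad f x = 0" if "norm x \<ge> max 1 (R + 1)" for x using that R[of x] gr by force
    show "\<bar>f x - f y\<bar> \<le> ?M * norm (x - y)" for x y
    proof -
      have "onorm (\<lambda>h. grad f z \<bullet> h) \<le> ?M" for z
        using grM[of z] Cauchy_Schwarz_ineq2[of "grad f z"]
        by (intro onorm_le) (meson norm_ge_zero mult_right_mono order_trans real_norm_def[THEN eq_refl])
      then have "norm (f x - f y) \<le> ?M * norm (x - y)"
        by (intro differentiable_bound[of UNIV f "\<lambda>z h. grad f z \<bullet> h"])
           (auto intro: smooth_has_derivative smooth)
      then show ?thesis by simp
    qed
  qed
qed

subsection \<open>Bump functions\<close>

text \<open>This family is closed under differentiation, which makes its member \<open>flat\<close> below smooth.\<close>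

definition flat_poly :: "real poly \<Rightarrow> real \<Rightarrow> real" where
  "flat_poly P t = (if t \<le> 0 then 0 else poly P (1 / t) * exp (- (1 / t)))"

lemma poly_times_exp_tendsto_0: "((\<lambda>s. poly P s * exp (- s)) \<longlongrightarrow> (0::real)) at_top"
proof -
  have "((\<lambda>s. \<Sum>i\<le>degree P. coeff P i * (s ^ i / exp s)) \<longlongrightarrow> (\<Sum>i\<le>degree P. coeff P i * (0::real))) at_top"
    by (intro tendsto_sum tendsto_mult tendsto_const tendsto_power_div_exp_0)
  moreover have "(\<Sum>i\<le>degree P. coeff P i * (s ^ i / exp s)) = poly P s * exp (- s)" for s :: real
    by (simp add: poly_altdef sum_distrib_right exp_minus divide_inverse mult.assoc)
  ultimately show ?thesis by simp
qed

lemma flat_poly_tendsto_0: "(flat_poly P \<longlongrightarrow> 0) (at 0)"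
proof (rule filterlim_split_at)
  have "\<forall>\<^sub>F t in at_left (0::real). 0 = flat_poly P t"
    by (auto simp: eventually_at_filter flat_poly_def)
  then show "(flat_poly P \<longlongrightarrow> 0) (at_left 0)"
    by (rule Lim_transform_eventually[OF tendsto_const])
  have "((\<lambda>t. poly P (1 / t) * exp (- (1 / t))) \<longlongrightarrow> 0) (at_right 0)"
    using filterlim_compose[OF poly_times_exp_tendsto_0 filterlim_inverse_at_top_right]
    by (simp add: inverse_eq_divide)
  moreover have "\<forall>\<^sub>F t in at_right (0::real). poly P (1 / t) * exp (- (1 / t)) = flat_poly P t"
    by (auto simp: eventually_at_filter flat_poly_def)
  ultimately show "(flat_poly P \<longlongrightarrow> 0) (at_right 0)"
    by (rule Lim_transform_eventually)
qed

text \<open>With s = 1 / t one has d/dt = - s^2 d/ds, so the derivative of P(s) exp(-s) is s^2 (P -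
  P')(s) exp(-s); \<open>[:0, 0, 1:]\<close> is s^2.\<close>

lemma flat_poly_deriv:
  "(flat_poly P has_real_derivative flat_poly ([:0, 0, 1:] * (P - pderiv P)) t) (at t)"
proof -
  consider "t < 0" | "t = 0" | "t > 0" by linarith
  then show ?thesis
  proof cases
    case 1
    have "(flat_poly P has_real_derivative 0) (at t)"
      by (rule has_field_derivative_transform_within_open[OF DERIV_const[of 0], of "{..<0}"])
         (use 1 in \<open>auto simp: flat_poly_def\<close>)
    then show ?thesis using 1 by (simp add: flat_poly_def)
  next
    case 2
    \<comment> \<open>The difference quotient at 0 is again a member of the family, with the
      polynomial multiplied by 1 / h, and every member tends to 0 there.\<close>
    have "flat_poly ([:0, 1:] * P) h = (flat_poly P (0 + h) - flat_poly P 0) / h" if "h \<noteq> 0" for h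
      using that by (simp add: flat_poly_def)
    then have "((\<lambda>h. (flat_poly P (0 + h) - flat_poly P 0) / h) \<longlongrightarrow> 0) (at 0)"
      using flat_poly_tendsto_0[of "[:0, 1:] * P"]
      by (rule_tac Lim_transform_eventually) (auto simp: eventually_at_filter)
    then show ?thesis using 2 by (simp add: DERIV_def flat_poly_def)
  next
    case 3
    have "((\<lambda>t. poly P (1 / t) * exp (- (1 / t))) has_real_derivative
        flat_poly ([:0, 0, 1:] * (P - pderiv P)) t) (at t)"
      using 3 by (auto intro!: derivative_eq_intros DERIV_chain2[OF poly_DERIV]
          simp: flat_poly_def field_simps power2_eq_square)
    then show ?thesis
      by (rule has_field_derivative_transform_within_open[of _ _ _ "{0<..}"])
         (use 3 in \<open>auto simp: flat_poly_def\<close>)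
  qed
qed

definition flat :: "real \<Rightarrow> real" where
  "flat = flat_poly 1"

lemma flat_eq: "flat t = (if t \<le> 0 then 0 else exp (- (1 / t)))"
  by (simp add: flat_def flat_poly_def)

lemma smooth_flat: "smooth (\<lambda>x. flat (c + w \<bullet> x))"
proof -
  define D where "D k = flat_poly (((\<lambda>P. [:0, 0, 1:] * (P - pderiv P)) ^^ k) 1)" for k
  have "(D k has_real_derivative D (Suc k) t) (at t)" for k t
    unfolding D_def using flat_poly_deriv by simp
  from smooth_compose_functional[of D, OF this] show ?thesis
    by (simp add: D_def flat_def)
qed

text \<open>The factor \<open>n\<close> steepens the one-sided cutoffs: for \<open>d > 0\<close> the
  values \<open>flat (n * d)\<close> tend to 1, so the bumps tend pointwise to the indicator of the
  open box.\<close>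

definition bump :: "real^3 \<Rightarrow> real^3 \<Rightarrow> real \<Rightarrow> real^3 \<Rightarrow> real" where
  "bump a b n x = (\<Prod>i\<in>UNIV. flat (n * (x $ i - a $ i)) * flat (n * (b $ i - x $ i)))"

lemma bump_smooth: "smooth (bump a b n)"
proof -
  have "smooth (\<lambda>x. flat (n * (x $ i - a $ i)))" for i
    using smooth_flat[of "- n * a $ i" "n *\<^sub>R axis i 1"] by (simp add: inner_axis' algebra_simps)
  moreover have "smooth (\<lambda>x. flat (n * (b $ i - x $ i)))" for i
    using smooth_flat[of "n * b $ i" "(- n) *\<^sub>R axis i 1"] by (simp add: inner_axis' algebra_simps)
  ultimately show ?thesis
    unfolding bump_def[abs_def] by (intro smooth_prod smooth_mult)
qed

lemma mem_box_3: "x \<in> box a b \<longleftrightarrow> (\<forall>i. a $ i < x $ i \<and> x $ i < b $ i)" for x :: "real^3"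
  by (simp add: mem_box_cart)

lemma flat_bounds: "0 \<le> flat t" "flat t \<le> 1"
  by (auto simp: flat_eq)

lemma bump_bounds: "0 \<le> bump a b n x" "bump a b n x \<le> 1"
  unfolding bump_def
  by (auto intro!: prod_nonneg prod_le_1 mult_le_one flat_bounds mult_nonneg_nonneg)

lemma bump_eq_0: "n > 0 \<Longrightarrow> x \<notin> box a b \<Longrightarrow> bump a b n x = 0"
  unfolding bump_def mem_box_3 by (auto simp: flat_eq not_less mult_le_0_iff)

lemma bump_pos: "n > 0 \<Longrightarrow> x \<in> box a b \<Longrightarrow> bump a b n x > 0"
  unfolding bump_def mem_box_3 by (auto simp: flat_eq mult_le_0_iff not_le intro!: prod_pos)

lemma bump_test:
  assumes "n > 0" "cbox a b \<subseteq> S"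
  shows "bump a b n \<in> test S"
proof (rule testI[of _ "cbox a b"])
  show "bump a b n x = 0" if "x \<notin> cbox a b" for x
    using that box_subset_cbox[of a b] bump_eq_0[OF assms(1)] by blast
qed (use assms bump_smooth in auto)

lemma bump_tendsto: "(\<lambda>n. bump a b (real (Suc n)) x) \<longlonglongrightarrow> indicator (box a b) x"
proof (cases "x \<in> box a b")
  case True
  have lim: "(\<lambda>n. flat (real (Suc n) * d)) \<longlonglongrightarrow> 1" if "d > 0" for d
  proof -
    have "(\<lambda>n. exp (- ((1 / d) * inverse (real (Suc n))))) \<longlonglongrightarrow> exp (- ((1 / d) * 0))"
      by (intro tendsto_intros LIMSEQ_inverse_real_of_nat)
    moreover have "exp (- ((1 / d) * inverse (real (Suc n)))) = flat (real (Suc n) * d)" for n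
    proof -
      have "\<not> real (Suc n) * d \<le> 0" using that by (simp add: mult_le_0_iff del: of_nat_Suc)
      then show ?thesis by (simp add: flat_eq divide_inverse mult.commute)
    qed
    ultimately show ?thesis by simp
  qed
  have "(\<lambda>n. bump a b (real (Suc n)) x) \<longlonglongrightarrow> (\<Prod>i\<in>(UNIV::3 set). 1 * 1)"
    unfolding bump_def using True
    by (intro tendsto_prod tendsto_mult lim) (auto simp: mem_box_3)
  then show ?thesis using True by simp
next
  case False
  then show ?thesis using bump_eq_0[of "real (Suc _)"] by (simp del: of_nat_Suc)
qed

section \<open>Integration by parts and the fundamental lemma\<close>

lemma integrable_bounded_support:
  fixes g :: "real^3 \<Rightarrow> real"
  assumes "g \<in> borel_measurable borel" "\<And>x. \<bar>g x\<bar> \<le> K" "\<And>x. norm x \<ge> R \<Longrightarrow> g x = 0"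
  shows "integrable lborel g"
proof (rule Bochner_Integration.integrable_bound)
  show "integrable lborel (\<lambda>x. K * indicator (cball (0::real^3) R) x)"
    using emeasure_lborel_cball_finite[of "0::real^3" R] by (intro integrable_mult_right integrable_real_indicator) auto
  show "AE x in lborel. norm (g x) \<le> norm (K * indicator (cball (0::real^3) R) x)"
  proof (rule AE_I2)
    fix x
    have "0 \<le> K" using assms(2)[of 0] by linarith
    then show "norm (g x) \<le> norm (K * indicator (cball (0::real^3) R) x)"
      using assms(2,3)[of x] by (auto simp: indicator_def)
  qed
qed (use assms in simp)

lemma Lipschitz_borel_measurable:
  fixes \<phi> :: "real^3 \<Rightarrow> real"
  assumes "\<And>x y. \<bar>\<phi> x - \<phi> y\<bar> \<le> L * norm (x - y)"
  shows "\<phi> \<in> borel_measurable borel"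
proof -
  have "norm (\<phi> x - \<phi> y) \<le> max L 0 * norm (x - y)" for x y
    using assms[of x y] by (smt (verit) mult_right_mono norm_ge_zero real_norm_def)
  then have "(max L 0)-lipschitz_on UNIV \<phi>"
    by (intro lipschitz_onI) (auto simp: dist_norm)
  then show ?thesis by (intro borel_measurable_continuous_onI lipschitz_on_continuous_on)
qed

text \<open>All differentiability is put on \<open>\<phi>\<close>, since \<open>f\<close> will be a
  discontinuous cone function. For \<open>\<phi>\<close> a Lipschitz bound and a directional
  derivative almost everywhere suffice, because the bound dominates the difference quotients; this
  admits functions with a kink at the frontier of an element.\<close>

lemma integral_translate_has_derivative:
  fixes f D \<phi> :: "real^3 \<Rightarrow> real" and e :: "real^3"
  assumes f: "f \<in> borel_measurable borel" "\<And>x. \<bar>f x\<bar> \<le> M"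
    and \<phi>: "\<And>x. \<bar>\<phi> x\<bar> \<le> K" "\<And>x y. \<bar>\<phi> x - \<phi> y\<bar> \<le> L * norm (x - y)" "\<And>x. norm x \<ge> R \<Longrightarrow> \<phi> x = 0"
    and D: "D \<in> borel_measurable borel"
      "AE x in lborel. ((\<lambda>s. \<phi> (x + s *\<^sub>R e)) has_real_derivative D x) (at 0)"
  shows "((\<lambda>s. \<integral>x. f x * \<phi> (x + s *\<^sub>R e) \<partial>lborel) has_real_derivative (\<integral>x. f x * D x \<partial>lborel)) (at 0)"
    (is "(?F has_real_derivative _) _")
proof -
  have [measurable]: "\<phi> \<in> borel_measurable borel"
    using \<phi>(2) by (rule Lipschitz_borel_measurable)
  note [measurable] = f(1) D(1)
  have M: "0 \<le> M" using f(2)[of 0] by linarith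
  have "0 \<le> L * norm (axis 1 1 - 0 :: real^3)"
    using \<phi>(2)[of "axis 1 1" 0] by linarith
  then have L: "0 \<le> L" by simp
  have int: "integrable lborel (\<lambda>x. f x * \<phi> (x + s *\<^sub>R e))" for s
  proof (rule integrable_bounded_support)
    show "\<bar>f x * \<phi> (x + s *\<^sub>R e)\<bar> \<le> M * K" for x
      unfolding abs_mult by (intro mult_mono f \<phi> M) simp
    show "f x * \<phi> (x + s *\<^sub>R e) = 0" if "R + norm (s *\<^sub>R e) \<le> norm x" for x
      using that norm_diff_ineq[of x "s *\<^sub>R e"] by (simp add: \<phi>(3))
  qed measurable
  have "(\<lambda>n. (?F (X n) - ?F 0) / X n) \<longlonglongrightarrow> (\<integral>x. f x * D x \<partial>lborel)"
    if X: "\<And>n. X n \<noteq> 0" "X \<longlonglongrightarrow> 0" for X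
  proof -
    obtain B where B: "\<And>n. \<bar>X n\<bar> \<le> B"
      using X(2) convergent_imp_Bseq[of X] unfolding convergent_def Bseq_def by auto
    define Q where "Q n x = f x * ((\<phi> (x + X n *\<^sub>R e) - \<phi> x) / X n)" for n x
    have "(\<lambda>n. \<integral>x. Q n x \<partial>lborel) \<longlonglongrightarrow> (\<integral>x. f x * D x \<partial>lborel)"
    proof (rule integral_dominated_convergence)
      \<comment> \<open>As \<open>B\<close> bounds all increments, one ball contains the supports of
        all translates.\<close>
      show "integrable lborel (\<lambda>x. (M * (L * norm e)) * indicator (cball (0::real^3) (R + B * norm e)) x)"
        using emeasure_lborel_cball_finite[of "0::real^3" "R + B * norm e"]
        by (intro integrable_mult_right integrable_real_indicator) auto
      show "AE x in lborel. (\<lambda>n. Q n x) \<longlonglongrightarrow> f x * D x"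
        using D(2)
      proof (rule AE_mp, intro AE_I2 impI)
        fix x assume "((\<lambda>s. \<phi> (x + s *\<^sub>R e)) has_real_derivative D x) (at 0)"
        then have "((\<lambda>h. (\<phi> (x + (0 + h) *\<^sub>R e) - \<phi> (x + 0 *\<^sub>R e)) / h) \<longlongrightarrow> D x) (at 0)"
          by (simp only: DERIV_def)
        then have "((\<lambda>h. (\<phi> (x + h *\<^sub>R e) - \<phi> x) / h) \<circ> X) \<longlonglongrightarrow> D x"
          using X by (auto simp: tendsto_at_iff_sequentially)
        then show "(\<lambda>n. Q n x) \<longlonglongrightarrow> f x * D x"
          unfolding Q_def by (intro tendsto_mult tendsto_const) (simp add: o_def)
      qed
      show "AE x in lborel. norm (Q n x) \<le> (M * (L * norm e)) * indicator (cball (0::real^3) (R + B * norm e)) x" for n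
      proof (rule AE_I2)
        fix x
        show "norm (Q n x) \<le> (M * (L * norm e)) * indicator (cball (0::real^3) (R + B * norm e)) x"
        proof (cases "norm x \<le> R + B * norm e")
          case True
          have "\<bar>\<phi> (x + X n *\<^sub>R e) - \<phi> x\<bar> / \<bar>X n\<bar> \<le> L * norm e"
            using \<phi>(2)[of "x + X n *\<^sub>R e" x] X(1)[of n] by (simp add: field_simps)
          then have "\<bar>f x\<bar> * (\<bar>\<phi> (x + X n *\<^sub>R e) - \<phi> x\<bar> / \<bar>X n\<bar>) \<le> M * (L * norm e)"
            by (intro mult_mono f M) auto
          then show ?thesis using True by (simp add: Q_def abs_mult)
        next
          case False
          have "B * norm e \<ge> 0" using B[of 0] by simp
          moreover have "norm (X n *\<^sub>R e) \<le> B * norm e"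
            using B[of n] by (simp add: mult_right_mono)
          ultimately have "\<phi> x = 0" "\<phi> (x + X n *\<^sub>R e) = 0"
            using False norm_diff_ineq[of x "X n *\<^sub>R e"] by (auto intro!: \<phi>(3))
          then show ?thesis using False by (simp add: Q_def)
        qed
      qed
      show "(\<lambda>x. f x * D x) \<in> borel_measurable lborel" by measurable
      show "Q n \<in> borel_measurable lborel" for n unfolding Q_def by measurable
    qed
    moreover have "(\<integral>x. Q n x \<partial>lborel) = (?F (X n) - ?F 0) / X n" for n
    proof -
      have "Q n = (\<lambda>x. (f x * \<phi> (x + X n *\<^sub>R e) - f x * \<phi> (x + 0 *\<^sub>R e)) / X n)"
        by (auto simp: Q_def field_simps)
      then show ?thesis
        using int[of "X n"] int[of 0] by (simp only: integral_divide_zero Bochner_Integration.integral_diff)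
    qed
    ultimately show ?thesis by simp
  qed
  then show ?thesis
    unfolding DERIV_def tendsto_at_iff_sequentially by (auto simp: o_def)
qed

lemma lborel_integral_translate:
  fixes f :: "real^3 \<Rightarrow> real"
  assumes "f \<in> borel_measurable borel"
  shows "(\<integral>x. f (x + a) \<partial>lborel) = (\<integral>x. f x \<partial>lborel)"
proof -
  have "(\<integral>x. f x \<partial>lborel) = (\<integral>x. f x \<partial>distr lborel borel ((+) a))"
    by (simp add: lborel_distr_plus)
  also have "\<dots> = (\<integral>x. f (x + a) \<partial>lborel)"
    using assms by (simp add: integral_distr add.commute)
  finally show ?thesis ..
qed

text \<open>Translating the whole integrand changes nothing, and \<open>f\<close> is invariant, so
  translating \<open>\<phi>\<close> alone does not change the integral either; its derivative is
  zero. With \<open>f = 1\<close> this is the vanishing integral of a derivative.\<close>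

lemma integral_invariant_derivative_eq_0:
  fixes f D \<phi> :: "real^3 \<Rightarrow> real" and e :: "real^3"
  assumes f: "f \<in> borel_measurable borel" "\<And>x. \<bar>f x\<bar> \<le> M" "\<And>x s. f (x + s *\<^sub>R e) = f x"
    and \<phi>: "\<And>x. \<bar>\<phi> x\<bar> \<le> K" "\<And>x y. \<bar>\<phi> x - \<phi> y\<bar> \<le> L * norm (x - y)" "\<And>x. norm x \<ge> R \<Longrightarrow> \<phi> x = 0"
    and D: "D \<in> borel_measurable borel"
      "AE x in lborel. ((\<lambda>s. \<phi> (x + s *\<^sub>R e)) has_real_derivative D x) (at 0)"
  shows "(\<integral>x. f x * D x \<partial>lborel) = 0"
proof -
  have "(\<integral>x. f x * \<phi> (x + s *\<^sub>R e) \<partial>lborel) = (\<integral>x. f x * \<phi> x \<partial>lborel)" for s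
  proof -
    have "\<phi> \<in> borel_measurable borel"
      using \<phi>(2) by (rule Lipschitz_borel_measurable)
    then have "(\<integral>x. f (x + s *\<^sub>R e) * \<phi> (x + s *\<^sub>R e) \<partial>lborel) = (\<integral>x. f x * \<phi> x \<partial>lborel)"
      using f(1) by (intro lborel_integral_translate[of "\<lambda>x. f x * \<phi> x"]) measurable
    then show ?thesis by (simp add: f(3))
  qed
  then have "((\<lambda>s. \<integral>x. f x * \<phi> (x + s *\<^sub>R e) \<partial>lborel) has_real_derivative 0) (at 0)"
    by simp
  then show ?thesis
    using integral_translate_has_derivative[OF f(1,2) \<phi> D] DERIV_unique by blast
qed

lemma smooth_directional_derivative:
  assumes "smooth f"
  shows "((\<lambda>s. f (x + s *\<^sub>R e)) has_real_derivative grad f (x + s *\<^sub>R e) \<bullet> e) (at s)"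
proof -
  have "((\<lambda>s. x + s *\<^sub>R e) has_derivative (\<lambda>h. h *\<^sub>R e)) (at s)"
    by (auto intro!: derivative_eq_intros)
  from has_derivative_compose[OF this smooth_has_derivative[OF assms]]
  show ?thesis
    unfolding has_field_derivative_def by (rule has_derivative_eq_rhs) (simp add: fun_eq_iff)
qed

lemma grad_borel_measurable [measurable_dest]: "smooth f \<Longrightarrow> grad f \<in> borel_measurable borel"
  by (intro borel_measurable_continuous_onI smooth_grad_continuous_on)

lemma test_integral_pd:
  assumes "\<phi> \<in> test S"
  shows "(\<integral>x. pd i \<phi> x \<partial>lborel) = 0"
proof -
  obtain M R where b: "\<And>x. \<bar>\<phi> x\<bar> \<le> M" "\<And>x. norm x \<ge> R \<Longrightarrow> \<phi> x = 0"
      "\<And>x y. \<bar>\<phi> x - \<phi> y\<bar> \<le> M * norm (x - y)"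
    using assms by (rule test_bounds) blast
  have sm: "smooth \<phi>" using assms by (rule test_smooth)
  have "(\<integral>x. 1 * pd i \<phi> x \<partial>lborel) = 0"
  proof (rule integral_invariant_derivative_eq_0[of _ 1 "axis i 1" \<phi> M M R])
    show "AE x in lborel. ((\<lambda>s. \<phi> (x + s *\<^sub>R axis i 1)) has_real_derivative pd i \<phi> x) (at 0)"
      using smooth_directional_derivative[OF sm, of _ "axis i 1" 0] by (simp add: inner_axis)
    show "pd i \<phi> \<in> borel_measurable borel" by (intro smooth_borel smooth_pd sm)
  qed (use b in auto)
  then show ?thesis by simp
qed

lemma test_integrable:
  assumes "\<phi> \<in> test S"
  shows "integrable lborel \<phi>"
  using assms
  by (rule test_bounds)
     (auto intro: integrable_bounded_support smooth_borel test_smooth assms)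

lemma test_integration_by_parts:
  assumes \<phi>: "\<phi> \<in> test S" and f: "smooth f"
  shows "(\<integral>x. f x * pd i \<phi> x \<partial>lborel) = - (\<integral>x. pd i f x * \<phi> x \<partial>lborel)"
proof -
  have "integrable lborel (\<lambda>x. f x * pd i \<phi> x)" "integrable lborel (\<lambda>x. pd i f x * \<phi> x)"
    using test_integrable[OF test_mult[OF test_pd[OF \<phi>] f]] test_integrable[OF test_mult[OF \<phi> smooth_pd[OF f]]]
    by (simp_all add: mult.commute)
  moreover have "pd i (\<lambda>x. \<phi> x * f x) = (\<lambda>x. f x * pd i \<phi> x + pd i f x * \<phi> x)"
    using pd_mult[OF smooth_differentiable[OF test_smooth[OF \<phi>]] smooth_differentiable[OF f]]
    by (auto simp: mult.commute)
  ultimately show ?thesis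
    using test_integral_pd[OF test_mult[OF \<phi> f], of i] by simp
qed

lemma borel_imp_lebesgue_on [intro]:
  "f \<in> borel_measurable borel \<Longrightarrow> f \<in> borel_measurable (lebesgue_on S)"
  by (simp add: measurable_completion measurable_restrict_space1)

lemma integral_lebesgue_on_eq_lborel:
  fixes f :: "real^3 \<Rightarrow> 'b::euclidean_space"
  assumes "f \<in> borel_measurable borel" "S \<in> sets lebesgue" "\<And>x. x \<notin> S \<Longrightarrow> f x = 0"
  shows "(\<integral>x. f x \<partial>lebesgue_on S) = (\<integral>x. f x \<partial>lborel)"
proof -
  have "(\<integral>x. f x \<partial>lebesgue_on S) = (\<integral>x. indicator S x *\<^sub>R f x \<partial>lebesgue)"
    using assms(2) by (simp add: integral_restrict_space)
  also have "(\<lambda>x. indicator S x *\<^sub>R f x) = f"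
    using assms(3) by (auto simp: indicator_def)
  finally show ?thesis using assms(1) by (simp add: integral_completion)
qed

lemma integral_lebesgue_on_subset:
  fixes f :: "real^3 \<Rightarrow> 'b::euclidean_space"
  assumes "S \<in> sets lebesgue" "T \<in> sets lebesgue" "S \<subseteq> T" "\<And>x. x \<in> T \<Longrightarrow> x \<notin> S \<Longrightarrow> f x = 0"
  shows "(\<integral>x. f x \<partial>lebesgue_on T) = (\<integral>x. f x \<partial>lebesgue_on S)"
proof -
  have "(\<lambda>x. indicator T x *\<^sub>R f x) = (\<lambda>x. indicator S x *\<^sub>R f x)"
    using assms(3,4) by (auto simp: indicator_def fun_eq_iff)
  then show ?thesis using assms(1,2) by (simp add: integral_restrict_space)
qed

lemma integrable_lebesgue_on_subset:
  fixes f :: "real^3 \<Rightarrow> 'b::euclidean_space"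
  assumes "S \<in> sets lebesgue" "T \<in> sets lebesgue" "S \<subseteq> T" "integrable (lebesgue_on T) f"
  shows "integrable (lebesgue_on S) f"
  using assms set_integrable_subset[of lebesgue T f S]
  by (simp add: integrable_restrict_space set_integrable_def)

lemma integrable_bounded_mult:
  fixes f :: "real^3 \<Rightarrow> 'b::euclidean_space"
  assumes "integrable (lebesgue_on S) f" "g \<in> borel_measurable borel" "\<And>x. \<bar>g x\<bar> \<le> M"
  shows "integrable (lebesgue_on S) (\<lambda>x. g x *\<^sub>R f x)"
proof (rule Bochner_Integration.integrable_bound)
  show "integrable (lebesgue_on S) (\<lambda>x. M *\<^sub>R f x)" using assms(1) by simp
  have [measurable]: "g \<in> borel_measurable (lebesgue_on S)" using assms(2) by auto
  show "(\<lambda>x. g x *\<^sub>R f x) \<in> borel_measurable (lebesgue_on S)"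
    using assms(1) by measurable
  have "\<bar>g x\<bar> * norm (f x) \<le> \<bar>M\<bar> * norm (f x)" for x
    using assms(3)[of x] by (intro mult_right_mono) auto
  then show "AE x in lebesgue_on S. norm (g x *\<^sub>R f x) \<le> norm (M *\<^sub>R f x)" by auto
qed

text \<open>Bumps converge to indicators of boxes, so \<open>f\<close> has integral zero over every
  closed box inside \<open>S\<close>. Lebesgue differentiation along cubes with corner
  \<open>x\<close> then gives \<open>f x = 0\<close> for almost every \<open>x\<close>.\<close>

lemma fundamental_lemma:
  fixes f :: "real^3 \<Rightarrow> real"
  assumes S: "open S" and f: "integrable (lebesgue_on S) f"
    and zero: "\<And>\<phi>. \<phi> \<in> test S \<Longrightarrow> (\<integral>x. f x * \<phi> x \<partial>lebesgue_on S) = 0"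
  shows "AE x in lebesgue_on S. f x = 0"
proof -
  have Sl: "S \<in> sets lebesgue" using S by simp
  have box0: "integral (cbox a b) f = 0" if ab: "cbox a b \<subseteq> S" for a b
  proof -
    have "(\<lambda>n. \<integral>x. f x * bump a b (real (Suc n)) x \<partial>lebesgue_on S) \<longlonglongrightarrow>
        (\<integral>x. f x * indicator (box a b) x \<partial>lebesgue_on S)"
    proof (rule integral_dominated_convergence)
      have m[measurable]: "f \<in> borel_measurable (lebesgue_on S)" using f by auto
      have [measurable]: "indicator (box a b) \<in> borel_measurable (lebesgue_on S)"
        by (auto intro!: borel_imp_lebesgue_on)
      have [measurable]: "bump a b (real (Suc n)) \<in> borel_measurable (lebesgue_on S)" for n
        by (intro borel_imp_lebesgue_on smooth_borel bump_smooth)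
      show "(\<lambda>x. f x * indicator (box a b) x) \<in> borel_measurable (lebesgue_on S)" by measurable
      show "(\<lambda>x. f x * bump a b (real (Suc n)) x) \<in> borel_measurable (lebesgue_on S)" for n by measurable
      show "integrable (lebesgue_on S) (\<lambda>x. norm (f x))" using f by simp
      show "AE x in lebesgue_on S. (\<lambda>n. f x * bump a b (real (Suc n)) x) \<longlonglongrightarrow> f x * indicator (box a b) x"
        by (intro AE_I2 tendsto_mult tendsto_const bump_tendsto)
      show "AE x in lebesgue_on S. norm (f x * bump a b (real (Suc n)) x) \<le> norm (f x)" for n
        using bump_bounds by (intro AE_I2) (simp add: abs_mult mult_left_le)
    qed
    moreover have "(\<integral>x. f x * bump a b (real (Suc n)) x \<partial>lebesgue_on S) = 0" for n
      using ab by (intro zero bump_test) auto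
    ultimately have 0: "(\<integral>x. f x * indicator (box a b) x \<partial>lebesgue_on S) = 0"
      by (simp add: LIMSEQ_const_iff)
    have boxS: "box a b \<subseteq> S" using ab box_subset_cbox by blast
    have "(\<integral>x. f x * indicator (box a b) x \<partial>lebesgue_on S) = (\<integral>x. f x * indicator (box a b) x \<partial>lebesgue_on (box a b))"
      using boxS Sl by (intro integral_lebesgue_on_subset) auto
    also have "\<dots> = (\<integral>x. f x \<partial>lebesgue_on (box a b))"
      by (intro Bochner_Integration.integral_cong) auto
    also have "\<dots> = integral (box a b) f"
      using integrable_lebesgue_on_subset[OF _ Sl boxS f] by (intro lebesgue_integral_eq_integral) auto
    finally show ?thesis using 0 by (simp add: integral_open_interval)
  qed
  let ?f = "\<lambda>x. if x \<in> S then f x else 0"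
  have "integrable lebesgue ?f"
  proof -
    have "(\<lambda>x. indicator S x *\<^sub>R f x) = ?f" by (auto simp: indicator_def)
    then show ?thesis using f Sl by (simp add: integrable_restrict_space)
  qed
  then have "?f integrable_on UNIV" by (rule integrable_on_lebesgue)
  then have "?f integrable_on cbox a b" for a b
    by (rule integrable_on_subcbox) simp
  then obtain N where N: "negligible N" "\<And>x e. x \<notin> N \<Longrightarrow> 0 < e \<Longrightarrow>
      \<exists>d>0. \<forall>h. 0 < h \<and> h < d \<longrightarrow>
        norm (integral (cbox x (x + h *\<^sub>R One)) ?f /\<^sub>R h ^ DIM(real^3) - ?f x) < e"
    using integrable_ccontinuous_explicit[of ?f] by blast
  have "f x = 0" if x: "x \<in> S" "x \<notin> N" for x
  proof (rule ccontr)
    assume "f x \<noteq> 0"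
    then obtain d where d: "d > 0" "\<And>h. 0 < h \<Longrightarrow> h < d \<Longrightarrow>
        norm (integral (cbox x (x + h *\<^sub>R One)) ?f /\<^sub>R h ^ DIM(real^3) - ?f x) < \<bar>f x\<bar>"
      using N(2)[OF x(2), of "\<bar>f x\<bar>"] by auto
    obtain e where e: "e > 0" "ball x e \<subseteq> S" using S x(1) openE by blast
    \<comment> \<open>Small enough for the differentiation estimate and for the cube, whose diagonal
      is \<open>h * norm One\<close>, to stay inside \<open>ball x e\<close>.\<close>
    define h where "h = min (d / 2) (e / (2 * norm (One::real^3) + 2))"
    have h: "0 < h" "h < d" using d(1) e(1) by (auto simp: h_def add_nonneg_pos)
    have "cbox x (x + h *\<^sub>R One) \<subseteq> ball x e"
    proof
      fix y assume y: "y \<in> cbox x (x + h *\<^sub>R One)"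
      have "norm (y - x) \<le> norm (h *\<^sub>R (One::real^3))"
        by (rule norm_le_componentwise) (use y h(1) in \<open>auto simp: mem_box inner_simps abs_if\<close>)
      also have "\<dots> = h * norm (One::real^3)" using h(1) by simp
      also have "\<dots> \<le> e / (2 * norm (One::real^3) + 2) * norm (One::real^3)"
        by (intro mult_right_mono) (auto simp: h_def)
      also have "\<dots> < e" using e(1) by (simp add: field_simps add_nonneg_pos)
      finally show "y \<in> ball x e" by (simp add: dist_norm norm_minus_commute)
    qed
    then have sub: "cbox x (x + h *\<^sub>R One) \<subseteq> S" using e by blast
    have "integral (cbox x (x + h *\<^sub>R One)) ?f = integral (cbox x (x + h *\<^sub>R One)) f"
      by (rule Henstock_Kurzweil_Integration.integral_cong) (use sub in auto)
    then show False using d(2)[OF h] box0[OF sub] x(1) by simp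
  qed
  then show ?thesis
    using N(1) Sl by (auto simp: AE_restrict_space_iff negligible_iff_null_sets intro!: AE_I'[of N])
qed

text \<open>The derivative along the translation at parameter \<open>s\<close> is the one at 0 for
  the shifted test function, and a directional derivative is a combination of partial derivatives.
  This replaces the statement that \<open>f\<close> is constant almost everywhere.\<close>

lemma integral_const_along_translations:
  fixes f :: "real^3 \<Rightarrow> real"
  assumes f: "f \<in> borel_measurable borel" "\<And>x. \<bar>f x\<bar> \<le> M"
    and zero: "\<And>\<phi> i. \<phi> \<in> test UNIV \<Longrightarrow> (\<integral>x. f x * pd i \<phi> x \<partial>lborel) = 0"
    and \<phi>: "\<phi> \<in> test UNIV"
  shows "(\<integral>x. f x * \<phi> (x + a) \<partial>lborel) = (\<integral>x. f x * \<phi> x \<partial>lborel)"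
proof -
  have tr: "(\<lambda>x. \<phi> (b + x)) \<in> test UNIV" for b
    using test_affine[OF \<phi>, of 1 b] by simp
  define F where "F s = (\<integral>x. f x * \<phi> (x + s *\<^sub>R a) \<partial>lborel)" for s
  have "(F has_real_derivative 0) (at s)" for s
  proof -
    define \<psi> where "\<psi> = (\<lambda>x. \<phi> (s *\<^sub>R a + x))"
    have \<psi>: "\<psi> \<in> test UNIV" unfolding \<psi>_def by (rule tr)
    then have sm: "smooth \<psi>" by (rule test_smooth)
    obtain K R where b: "\<And>x. \<bar>\<psi> x\<bar> \<le> K" "\<And>x. norm x \<ge> R \<Longrightarrow> \<psi> x = 0"
        "\<And>x y. \<bar>\<psi> x - \<psi> y\<bar> \<le> K * norm (x - y)"
      using \<psi> by (rule test_bounds) blast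
    have "((\<lambda>h. \<integral>x. f x * \<psi> (x + h *\<^sub>R a) \<partial>lborel) has_real_derivative (\<integral>x. f x * (grad \<psi> x \<bullet> a) \<partial>lborel)) (at 0)"
    proof (rule integral_translate_has_derivative[OF f b(1,3,2)])
      have "continuous_on UNIV (\<lambda>x. grad \<psi> x \<bullet> a)"
        by (intro continuous_intros smooth_grad_continuous_on sm)
      then show "(\<lambda>x. grad \<psi> x \<bullet> a) \<in> borel_measurable borel"
        by (rule borel_measurable_continuous_onI)
      show "AE x in lborel. ((\<lambda>s. \<psi> (x + s *\<^sub>R a)) has_real_derivative grad \<psi> x \<bullet> a) (at 0)"
        using smooth_directional_derivative[OF sm, of _ a 0] by simp
    qed
    moreover have "(\<integral>x. f x * (grad \<psi> x \<bullet> a) \<partial>lborel) = 0"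
    proof -
      have int: "integrable lborel (\<lambda>x. f x * pd i \<psi> x)" for i
      proof -
        obtain K R where b: "\<And>x. \<bar>pd i \<psi> x\<bar> \<le> K" "\<And>x. norm x \<ge> R \<Longrightarrow> pd i \<psi> x = 0"
          using test_pd[OF \<psi>] by (rule test_bounds) blast
        have [measurable]: "pd i \<psi> \<in> borel_measurable borel" by (intro smooth_borel smooth_pd sm)
        note [measurable] = f(1)
        have "\<bar>f x * pd i \<psi> x\<bar> \<le> M * K" for x
          unfolding abs_mult using f(2)[of x] b(1)[of x] by (intro mult_mono) auto
        then show ?thesis
          by (intro integrable_bounded_support[of _ "M * K" R]) (use b(2) in \<open>simp_all, measurable\<close>)
      qed
      have "(\<integral>x. f x * (grad \<psi> x \<bullet> a) \<partial>lborel) = (\<integral>x. (\<Sum>i\<in>UNIV. a $ i * (f x * pd i \<psi> x)) \<partial>lborel)"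
        by (simp add: inner_vec_def sum_distrib_left mult_ac)
      also have "\<dots> = 0"
        using int zero[OF \<psi>] by (simp add: Bochner_Integration.integral_sum)
      finally show ?thesis .
    qed
    ultimately have "((\<lambda>h. F (s + h)) has_real_derivative 0) (at 0)"
      by (simp add: F_def \<psi>_def scaleR_add_left algebra_simps)
    then show ?thesis using DERIV_at_within_shift[of F 0 s 0 UNIV] by simp
  qed
  then have "F 1 = F 0" by (metis DERIV_isconst_all)
  then show ?thesis by (simp add: F_def)
qed

section \<open>Weak derivatives\<close>

lemma open_bounded_finite_measure:
  fixes \<Omega> :: "(real^3) set"
  assumes "open \<Omega>" "bounded \<Omega>"
  shows "finite_measure (lebesgue_on \<Omega>)"
  by (intro finite_measure_lebesgue_on lmeasurable_open assms)

lemma L2_integrable: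
  fixes f :: "real^3 \<Rightarrow> 'b::euclidean_space"
  assumes "open \<Omega>" "bounded \<Omega>" "f \<in> L2 \<Omega>"
  shows "integrable (lebesgue_on \<Omega>) f"
proof (rule Bochner_Integration.integrable_bound)
  interpret finite_measure "lebesgue_on \<Omega>" using assms(1,2) by (rule open_bounded_finite_measure)
  show "integrable (lebesgue_on \<Omega>) (\<lambda>x. 1 + (norm (f x))\<^sup>2)"
    using assms(3) by (intro Bochner_Integration.integrable_add integrable_const) (simp add: sq_int_def)
  have "norm (f x) \<le> norm (1 + (norm (f x))\<^sup>2)" for x
    using sum_power2_ge_zero[of "norm (f x) - 1" 0] by (simp add: power2_eq_square algebra_simps) (smt (verit) zero_le_square)
  then show "AE x in lebesgue_on \<Omega>. norm (f x) \<le> norm (1 + (norm (f x))\<^sup>2)" by simp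
qed (use assms(3) in \<open>simp add: sq_int_def\<close>)

lemma L2_measurable: "f \<in> L2 \<Omega> \<Longrightarrow> f \<in> borel_measurable (lebesgue_on \<Omega>)"
  by (simp add: sq_int_def)

lemma L2_bound:
  fixes f :: "real^3 \<Rightarrow> 'b::euclidean_space" and g :: "real^3 \<Rightarrow> 'c::euclidean_space"
  assumes "f \<in> L2 \<Omega>" "g \<in> borel_measurable (lebesgue_on \<Omega>)" "\<And>x. norm (g x) \<le> norm (f x)"
  shows "g \<in> L2 \<Omega>"
proof -
  have "integrable (lebesgue_on \<Omega>) (\<lambda>x. (norm (g x))\<^sup>2)"
  proof (rule Bochner_Integration.integrable_bound)
    show "integrable (lebesgue_on \<Omega>) (\<lambda>x. (norm (f x))\<^sup>2)" using assms(1) by (simp add: sq_int_def)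
    show "(\<lambda>x. (norm (g x))\<^sup>2) \<in> borel_measurable (lebesgue_on \<Omega>)" using assms(2) by measurable
    show "AE x in lebesgue_on \<Omega>. norm ((norm (g x))\<^sup>2) \<le> norm ((norm (f x))\<^sup>2)"
      using assms(3) by (auto intro!: power_mono)
  qed
  with assms(2) show ?thesis by (simp add: sq_int_def)
qed

lemma L2_add:
  fixes f g :: "real^3 \<Rightarrow> 'b::euclidean_space"
  assumes "f \<in> L2 \<Omega>" "g \<in> L2 \<Omega>"
  shows "(\<lambda>x. f x + g x) \<in> L2 \<Omega>"
proof -
  have [measurable]: "f \<in> borel_measurable (lebesgue_on \<Omega>)" "g \<in> borel_measurable (lebesgue_on \<Omega>)"
    using assms by (simp_all add: sq_int_def)
  have "integrable (lebesgue_on \<Omega>) (\<lambda>x. (norm (f x + g x))\<^sup>2)"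
  proof (rule Bochner_Integration.integrable_bound)
    show "integrable (lebesgue_on \<Omega>) (\<lambda>x. 2 * (norm (f x))\<^sup>2 + 2 * (norm (g x))\<^sup>2)"
      using assms by (simp add: sq_int_def)
    have "(norm (f x + g x))\<^sup>2 \<le> 2 * (norm (f x))\<^sup>2 + 2 * (norm (g x))\<^sup>2" for x
    proof -
      have "(norm (f x + g x))\<^sup>2 \<le> (norm (f x) + norm (g x))\<^sup>2"
        by (intro power_mono norm_triangle_ineq) simp
      also have "\<dots> \<le> 2 * (norm (f x))\<^sup>2 + 2 * (norm (g x))\<^sup>2"
        using zero_le_power2[of "norm (f x) - norm (g x)"] by (simp add: power2_sum power2_diff)
      finally show ?thesis .
    qed
    then show "AE x in lebesgue_on \<Omega>. norm ((norm (f x + g x))\<^sup>2) \<le> norm (2 * (norm (f x))\<^sup>2 + 2 * (norm (g x))\<^sup>2)"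
      by simp
  qed measurable
  then show ?thesis by (simp add: sq_int_def)
qed

lemma L2_cmult:
  fixes f :: "real^3 \<Rightarrow> 'b::euclidean_space"
  assumes "f \<in> L2 \<Omega>"
  shows "(\<lambda>x. c *\<^sub>R f x) \<in> L2 \<Omega>"
  using assms by (auto simp: sq_int_def power_mult_distrib)

lemma L2_diff:
  fixes f g :: "real^3 \<Rightarrow> 'b::euclidean_space"
  shows "f \<in> L2 \<Omega> \<Longrightarrow> g \<in> L2 \<Omega> \<Longrightarrow> (\<lambda>x. f x - g x) \<in> L2 \<Omega>"
  using L2_add[OF _ L2_cmult[of g \<Omega> "-1"]] by simp

lemma L2_component:
  assumes "v \<in> L2 \<Omega>"
  shows "component i v \<in> L2 \<Omega>"
proof (rule L2_bound[OF assms])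
  have v: "v \<in> borel_measurable (lebesgue_on \<Omega>)" using assms by (rule L2_measurable)
  show "component i v \<in> borel_measurable (lebesgue_on \<Omega>)"
    unfolding component_def[abs_def]
    by (rule measurable_compose[OF v borel_measurable_nth])
  show "norm (component i v x) \<le> norm (v x)" for x
    unfolding component_def real_norm_def by (rule component_le_norm_cart)
qed

lemma norm_sq_components: "(norm x)\<^sup>2 = (\<Sum>i\<in>UNIV. (x $ i)\<^sup>2)" for x :: "real^3"
  unfolding power2_norm_eq_inner inner_vec_def by (simp add: power2_eq_square)

lemma L2_vec:
  assumes "\<And>i. component i v \<in> L2 \<Omega>"
  shows "v \<in> L2 \<Omega>"
proof -
  have m: "(\<lambda>x. v x $ i) \<in> borel_measurable (lebesgue_on \<Omega>)" for i
    using L2_measurable[OF assms[of i]] by (simp add: component_def[abs_def])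
  have "v \<in> borel_measurable (lebesgue_on \<Omega>)"
    by (subst borel_measurable_euclidean_space) (auto simp: Basis_vec_def inner_axis m)
  moreover have "integrable (lebesgue_on \<Omega>) (\<lambda>x. (norm (v x))\<^sup>2)"
    unfolding norm_sq_components using assms
    by (intro Bochner_Integration.integrable_sum) (simp add: sq_int_def component_def)
  ultimately show ?thesis by (simp add: sq_int_def)
qed

lemma bounded_on_L2:
  fixes f :: "real^3 \<Rightarrow> 'b::euclidean_space"
  assumes \<Omega>: "open \<Omega>" "bounded \<Omega>" and f: "f \<in> borel_measurable (lebesgue_on \<Omega>)"
    and b: "\<And>x. x \<in> \<Omega> \<Longrightarrow> norm (f x) \<le> M"
  shows "f \<in> L2 \<Omega>"
proof -
  interpret finite_measure "lebesgue_on \<Omega>" using \<Omega> by (rule open_bounded_finite_measure)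
  have "AE x in lebesgue_on \<Omega>. norm ((norm (f x))\<^sup>2) \<le> M\<^sup>2"
    using b by (auto intro!: AE_I2 power_mono)
  then have "integrable (lebesgue_on \<Omega>) (\<lambda>x. (norm (f x))\<^sup>2)"
    using f by (intro integrable_const_bound) auto
  then show ?thesis using f by (simp add: sq_int_def)
qed

lemma continuous_L2:
  fixes f :: "real^3 \<Rightarrow> 'b::euclidean_space"
  assumes \<Omega>: "open \<Omega>" "bounded \<Omega>" and f: "continuous_on UNIV f"
  shows "f \<in> L2 \<Omega>"
proof -
  have "compact (f ` closure \<Omega>)"
    using \<Omega> f by (intro compact_continuous_image) (auto intro: continuous_on_subset)
  then obtain M where "\<And>x. x \<in> closure \<Omega> \<Longrightarrow> norm (f x) \<le> M"
    using compact_imp_bounded[of "f ` closure \<Omega>"] unfolding bounded_iff by auto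
  then show ?thesis
    using closure_subset[of \<Omega>]
    by (intro bounded_on_L2[OF \<Omega>, of f M] borel_imp_lebesgue_on borel_measurable_continuous_onI f) auto
qed

lemma smooth_L2: "open \<Omega> \<Longrightarrow> bounded \<Omega> \<Longrightarrow> smooth f \<Longrightarrow> f \<in> L2 \<Omega>"
  by (intro continuous_L2 smooth_continuous_on)

lemma L2_test_integrable:
  fixes f :: "real^3 \<Rightarrow> 'b::euclidean_space"
  assumes "open \<Omega>" "bounded \<Omega>" "f \<in> L2 \<Omega>" "\<phi> \<in> test S"
  shows "integrable (lebesgue_on \<Omega>) (\<lambda>x. \<phi> x *\<^sub>R f x)"
proof -
  obtain M where "\<And>x. \<bar>\<phi> x\<bar> \<le> M" using assms(4) by (rule test_bounds) blast
  then show ?thesis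
    by (intro integrable_bounded_mult[of _ _ _ M] L2_integrable assms smooth_borel test_smooth[OF assms(4)])
qed

lemma L2_test_integrable_mult:
  assumes "open \<Omega>" "bounded \<Omega>" "f \<in> L2 \<Omega>" "\<phi> \<in> test S"
  shows "integrable (lebesgue_on \<Omega>) (\<lambda>x. f x * \<phi> x)"
  using L2_test_integrable[OF assms] by (simp add: mult.commute)

lemma l2norm_mono:
  fixes f :: "real^3 \<Rightarrow> 'b::euclidean_space" and g :: "real^3 \<Rightarrow> 'c::euclidean_space"
  assumes "f \<in> L2 \<Omega>" "g \<in> borel_measurable (lebesgue_on \<Omega>)" "\<And>x. norm (g x) \<le> norm (f x)"
  shows "l2norm (lebesgue_on \<Omega>) g \<le> l2norm (lebesgue_on \<Omega>) f"
  unfolding l2norm_def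
proof (intro real_sqrt_le_mono Bochner_Integration.integral_mono)
  show "integrable (lebesgue_on \<Omega>) (\<lambda>x. (norm (g x))\<^sup>2)"
    using L2_bound[OF assms] by (simp add: sq_int_def)
qed (use assms in \<open>auto simp: sq_int_def intro!: power_mono\<close>)

lemma l2norm_component_tendsto_0:
  assumes "\<And>n. f n \<in> L2 \<Omega>" "(\<lambda>n. l2norm (lebesgue_on \<Omega>) (f n)) \<longlonglongrightarrow> 0"
  shows "(\<lambda>n. l2norm (lebesgue_on \<Omega>) (component i (f n))) \<longlonglongrightarrow> 0"
proof (rule tendsto_sandwich[OF _ _ tendsto_const assms(2)])
  show "\<forall>\<^sub>F n in sequentially. l2norm (lebesgue_on \<Omega>) (component i (f n)) \<le> l2norm (lebesgue_on \<Omega>) (f n)"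
    using assms(1) by (intro always_eventually allI l2norm_mono)
      (auto simp: component_def component_le_norm_cart intro: L2_measurable L2_component)
qed (simp add: l2norm_def)

text \<open>On a set of finite measure the inequality |t| \<le> \<delta> + t^2 / \<delta> turns
  convergence in L2 into convergence in L1, and test functions are bounded.\<close>

lemma l2norm_tendsto_integral:
  fixes f :: "nat \<Rightarrow> real^3 \<Rightarrow> real"
  assumes \<Omega>: "open \<Omega>" "bounded \<Omega>" and fn: "\<And>n. f n \<in> L2 \<Omega>" and f: "u \<in> L2 \<Omega>"
    and conv: "(\<lambda>n. l2norm (lebesgue_on \<Omega>) (\<lambda>x. f n x - u x)) \<longlonglongrightarrow> 0"
    and \<phi>: "\<phi> \<in> test S"
  shows "(\<lambda>n. \<integral>x. f n x * \<phi> x \<partial>lebesgue_on \<Omega>) \<longlonglongrightarrow> (\<integral>x. u x * \<phi> x \<partial>lebesgue_on \<Omega>)"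
proof -
  interpret finite_measure "lebesgue_on \<Omega>" using \<Omega> by (rule open_bounded_finite_measure)
  obtain M where M: "M \<ge> 0" "\<And>x. \<bar>\<phi> x\<bar> \<le> M" using \<phi> by (rule test_bounds) blast
  define d where "d n x = f n x - u x" for n x
  have d: "d n \<in> L2 \<Omega>" for n unfolding d_def by (intro L2_diff fn f)
  let ?\<mu> = "measure (lebesgue_on \<Omega>) (space (lebesgue_on \<Omega>))"
  let ?q = "\<lambda>n. \<integral>x. (d n x)\<^sup>2 \<partial>lebesgue_on \<Omega>"
  have "(\<lambda>n. (l2norm (lebesgue_on \<Omega>) (d n))\<^sup>2) \<longlonglongrightarrow> 0\<^sup>2"
    using conv unfolding d_def by (intro tendsto_power)
  then have q: "?q \<longlonglongrightarrow> 0" by (simp add: l2norm_def)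
  have bound: "(\<integral>x. \<bar>d n x\<bar> \<partial>lebesgue_on \<Omega>) \<le> \<delta> * ?\<mu> + ?q n / \<delta>" if "\<delta> > 0" for n \<delta>
  proof -
    have int: "integrable (lebesgue_on \<Omega>) (\<lambda>x. (d n x)\<^sup>2)" using d[of n] by (simp add: sq_int_def)
    have "\<bar>t\<bar> \<le> \<delta> + t\<^sup>2 / \<delta>" for t :: real
    proof -
      have "0 \<le> \<delta> * \<bar>t\<bar>" using that by simp
      moreover have "2 * (\<delta> * \<bar>t\<bar>) \<le> \<delta>\<^sup>2 + \<bar>t\<bar>\<^sup>2"
        using zero_le_power2[of "\<delta> - \<bar>t\<bar>"] unfolding power2_diff by simp
      ultimately have "\<delta> * \<bar>t\<bar> \<le> \<delta>\<^sup>2 + \<bar>t\<bar>\<^sup>2" by linarith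
      then show ?thesis using that by (simp add: field_simps power2_eq_square)
    qed
    then have "(\<integral>x. \<bar>d n x\<bar> \<partial>lebesgue_on \<Omega>) \<le> (\<integral>x. \<delta> + (d n x)\<^sup>2 / \<delta> \<partial>lebesgue_on \<Omega>)"
      using int L2_integrable[OF \<Omega> d[of n]] by (intro Bochner_Integration.integral_mono) auto
    also have "\<dots> = \<delta> * ?\<mu> + ?q n / \<delta>" using int by simp
    finally show ?thesis .
  qed
  have "(\<lambda>n. \<integral>x. \<bar>d n x\<bar> \<partial>lebesgue_on \<Omega>) \<longlonglongrightarrow> 0"
  proof (rule LIMSEQ_I)
    fix r :: real assume r: "r > 0"
    \<comment> \<open>Makes the constant part of the bound at most \<open>r / 2\<close>; the added 1
      avoids division by a measure that could be zero.\<close>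
    define \<delta> where "\<delta> = (r / 2) / (?\<mu> + 1)"
    have \<delta>: "\<delta> > 0" using r by (simp add: \<delta>_def add_nonneg_pos)
    have le: "\<delta> * ?\<mu> \<le> r / 2"
    proof -
      have "\<delta> * ?\<mu> \<le> \<delta> * (?\<mu> + 1)" using \<delta> by simp
      also have "\<dots> = r / 2"
      proof -
        have "?\<mu> + 1 \<noteq> 0" using measure_nonneg[of "lebesgue_on \<Omega>" "space (lebesgue_on \<Omega>)"] by linarith
        then show ?thesis by (rule nonzero_eq_divide_eq[THEN iffD1, OF _ \<delta>_def])
      qed
      finally show ?thesis .
    qed
    have "r * \<delta> / 2 > 0" using r \<delta> by simp
    then obtain N where "\<And>n. n \<ge> N \<Longrightarrow> ?q n < r * \<delta> / 2"
      using LIMSEQ_D[OF q, of "r * \<delta> / 2"] by auto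
    then have lt: "?q n / \<delta> < r / 2" if "n \<ge> N" for n
      using that \<delta> by (simp add: field_simps)
    have "(\<integral>x. \<bar>d n x\<bar> \<partial>lebesgue_on \<Omega>) < r" if "n \<ge> N" for n
      using bound[OF \<delta>, of n] lt[OF that] le by linarith
    then show "\<exists>N. \<forall>n\<ge>N. norm ((\<integral>x. \<bar>d n x\<bar> \<partial>lebesgue_on \<Omega>) - 0) < r"
      by (intro exI[of _ N]) simp
  qed
  then have "(\<lambda>n. M * (\<integral>x. \<bar>d n x\<bar> \<partial>lebesgue_on \<Omega>)) \<longlonglongrightarrow> M * 0"
    by (intro tendsto_mult tendsto_const)
  then have lim: "(\<lambda>n. M * (\<integral>x. \<bar>d n x\<bar> \<partial>lebesgue_on \<Omega>)) \<longlonglongrightarrow> 0" by simp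
  have "norm ((\<integral>x. f n x * \<phi> x \<partial>lebesgue_on \<Omega>) - (\<integral>x. u x * \<phi> x \<partial>lebesgue_on \<Omega>)) \<le>
      M * (\<integral>x. \<bar>d n x\<bar> \<partial>lebesgue_on \<Omega>)" for n
  proof -
    have i: "integrable (lebesgue_on \<Omega>) (\<lambda>x. h x * \<phi> x)" if "h \<in> L2 \<Omega>" for h
      by (rule L2_test_integrable_mult[OF \<Omega> that \<phi>])
    have "(\<integral>x. f n x * \<phi> x \<partial>lebesgue_on \<Omega>) - (\<integral>x. u x * \<phi> x \<partial>lebesgue_on \<Omega>) = (\<integral>x. d n x * \<phi> x \<partial>lebesgue_on \<Omega>)"
      using i[OF fn[of n]] i[OF f] by (simp add: d_def left_diff_distrib)
    also have "norm \<dots> \<le> (\<integral>x. norm (d n x * \<phi> x) \<partial>lebesgue_on \<Omega>)"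
      by (rule integral_norm_bound)
    also have "\<dots> \<le> (\<integral>x. M * \<bar>d n x\<bar> \<partial>lebesgue_on \<Omega>)"
    proof (rule Bochner_Integration.integral_mono)
      show "integrable (lebesgue_on \<Omega>) (\<lambda>x. norm (d n x * \<phi> x))" by (rule integrable_norm[OF i[OF d]])
      show "integrable (lebesgue_on \<Omega>) (\<lambda>x. M * \<bar>d n x\<bar>)" using L2_integrable[OF \<Omega> d[of n]] by simp
      show "norm (d n x * \<phi> x) \<le> M * \<bar>d n x\<bar>" for x
        using mult_right_mono[OF M(2)[of x], of "\<bar>d n x\<bar>"] by (simp add: abs_mult mult.commute)
    qed
    finally show ?thesis by simp
  qed
  then have "(\<lambda>n. (\<integral>x. f n x * \<phi> x \<partial>lebesgue_on \<Omega>) - (\<integral>x. u x * \<phi> x \<partial>lebesgue_on \<Omega>)) \<longlonglongrightarrow> 0"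
    by (intro Lim_null_comparison[OF _ lim]) (auto intro: always_eventually)
  then show ?thesis by (simp add: LIM_zero_iff)
qed

lemma integral_nth:
  fixes f :: "'a \<Rightarrow> real^3"
  assumes "integrable M f"
  shows "integral\<^sup>L M f $ i = (\<integral>x. f x $ i \<partial>M)"
  using integral_bounded_linear[OF bounded_linear_vec_nth assms, of i] by simp

text \<open>Components may be taken under both integrals because the integrands are integrable on
  the bounded set.\<close>

lemma has_weak_grad_iff:
  assumes \<Omega>: "open \<Omega>" "bounded \<Omega>"
  shows "has_weak_grad \<Omega> u g \<longleftrightarrow> u \<in> L2 \<Omega> \<and> g \<in> L2 \<Omega> \<and>
    (\<forall>\<phi>\<in>test \<Omega>. \<forall>i. (\<integral>x. u x * pd i \<phi> x \<partial>lebesgue_on \<Omega>) = - (\<integral>x. g x $ i * \<phi> x \<partial>lebesgue_on \<Omega>))"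
proof -
  have "((\<integral>x. u x *\<^sub>R grad \<phi> x \<partial>lebesgue_on \<Omega>) = - (\<integral>x. \<phi> x *\<^sub>R g x \<partial>lebesgue_on \<Omega>)) \<longleftrightarrow>
      (\<forall>i. (\<integral>x. u x * pd i \<phi> x \<partial>lebesgue_on \<Omega>) = - (\<integral>x. g x $ i * \<phi> x \<partial>lebesgue_on \<Omega>))"
    if L: "u \<in> L2 \<Omega>" "g \<in> L2 \<Omega>" and \<phi>: "\<phi> \<in> test \<Omega>" for \<phi>
  proof -
    have "integrable (lebesgue_on \<Omega>) (\<lambda>x. u x *\<^sub>R grad \<phi> x)"
    proof -
      obtain M where M: "\<And>x. norm (grad \<phi> x) \<le> M" using \<phi> by (rule test_bounds) blast
      have [measurable]: "u \<in> borel_measurable (lebesgue_on \<Omega>)" "grad \<phi> \<in> borel_measurable (lebesgue_on \<Omega>)"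
        using L by (auto intro: L2_measurable grad_borel_measurable test_smooth[OF \<phi>])
      show ?thesis
      proof (rule Bochner_Integration.integrable_bound)
        show "integrable (lebesgue_on \<Omega>) (\<lambda>x. M * u x)" using L2_integrable[OF \<Omega> L(1)] by simp
        have "norm (grad \<phi> x) \<le> \<bar>M\<bar>" for x using M[of x] by linarith
        then have "norm (u x *\<^sub>R grad \<phi> x) \<le> norm (M * u x)" for x
          using mult_right_mono[of "norm (grad \<phi> x)" "\<bar>M\<bar>" "\<bar>u x\<bar>" for x] by (simp add: abs_mult mult.commute)
        then show "AE x in lebesgue_on \<Omega>. norm (u x *\<^sub>R grad \<phi> x) \<le> norm (M * u x)" by simp
      qed measurable
    qed
    then show ?thesis
      using L2_test_integrable[OF \<Omega> L(2) \<phi>]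
      by (simp add: vec_eq_iff integral_nth mult.commute)
  qed
  then show ?thesis unfolding has_weak_grad_def by blast
qed

lemma L2_fundamental_lemma:
  fixes f g :: "real^3 \<Rightarrow> real"
  assumes \<Omega>: "open \<Omega>" "bounded \<Omega>" and L: "f \<in> L2 \<Omega>" "g \<in> L2 \<Omega>"
    and eq: "\<And>\<phi>. \<phi> \<in> test \<Omega> \<Longrightarrow> (\<integral>x. f x * \<phi> x \<partial>lebesgue_on \<Omega>) = (\<integral>x. g x * \<phi> x \<partial>lebesgue_on \<Omega>)"
  shows "AE x in lebesgue_on \<Omega>. f x = g x"
proof -
  have "AE x in lebesgue_on \<Omega>. f x - g x = 0"
  proof (rule fundamental_lemma[OF \<Omega>(1)])
    show "integrable (lebesgue_on \<Omega>) (\<lambda>x. f x - g x)"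
      by (intro L2_integrable L2_diff \<Omega> L)
    show "(\<integral>x. (f x - g x) * \<phi> x \<partial>lebesgue_on \<Omega>) = 0" if "\<phi> \<in> test \<Omega>" for \<phi>
      using L2_test_integrable_mult[OF \<Omega> L(1) that] L2_test_integrable_mult[OF \<Omega> L(2) that] eq[OF that]
      by (simp add: left_diff_distrib)
  qed
  then show ?thesis by simp
qed

lemma AE_vec_eqI:
  fixes f g :: "'a \<Rightarrow> real^3"
  assumes "\<And>i. AE x in M. f x $ i = g x $ i"
  shows "AE x in M. f x = g x"
proof -
  have "AE x in M. \<forall>i\<in>UNIV. f x $ i = g x $ i" by (intro AE_finite_allI) (use assms in auto)
  then show ?thesis by (simp add: vec_eq_iff)
qed

lemma weak_grad_unique:
  assumes \<Omega>: "open \<Omega>" "bounded \<Omega>" and "has_weak_grad \<Omega> u g" "has_weak_grad \<Omega> u h"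
  shows "AE x in lebesgue_on \<Omega>. g x = h x"
proof (rule AE_vec_eqI)
  fix i
  note w = assms(3,4)[unfolded has_weak_grad_iff[OF \<Omega>]]
  have "AE x in lebesgue_on \<Omega>. component i g x = component i h x"
    using w by (intro L2_fundamental_lemma[OF \<Omega>] L2_component) (auto simp: component_def)
  then show "AE x in lebesgue_on \<Omega>. g x $ i = h x $ i" by (simp add: component_def)
qed

lemma integral_cong_AE_test:
  fixes f g :: "real^3 \<Rightarrow> real"
  assumes "f \<in> L2 \<Omega>" "g \<in> L2 \<Omega>" "AE x in lebesgue_on \<Omega>. f x = g x" "\<phi> \<in> test S"
  shows "(\<integral>x. f x * \<phi> x \<partial>lebesgue_on \<Omega>) = (\<integral>x. g x * \<phi> x \<partial>lebesgue_on \<Omega>)"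
proof (rule integral_cong_AE)
  have [measurable]: "f \<in> borel_measurable (lebesgue_on \<Omega>)" "g \<in> borel_measurable (lebesgue_on \<Omega>)"
      "\<phi> \<in> borel_measurable (lebesgue_on \<Omega>)"
    using assms by (auto intro: L2_measurable smooth_borel test_smooth)
  show "(\<lambda>x. f x * \<phi> x) \<in> borel_measurable (lebesgue_on \<Omega>)" "(\<lambda>x. g x * \<phi> x) \<in> borel_measurable (lebesgue_on \<Omega>)"
    by measurable
qed (use assms(3) in auto)

lemma has_weak_grad_cong:
  assumes \<Omega>: "open \<Omega>" "bounded \<Omega>" and w: "has_weak_grad \<Omega> u g"
    and L: "v \<in> L2 \<Omega>" "h \<in> L2 \<Omega>"
    and ae: "AE x in lebesgue_on \<Omega>. u x = v x" "AE x in lebesgue_on \<Omega>. g x = h x"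
  shows "has_weak_grad \<Omega> v h"
  unfolding has_weak_grad_iff[OF \<Omega>]
proof (intro conjI L ballI allI)
  note w = w[unfolded has_weak_grad_iff[OF \<Omega>]]
  fix \<phi> i assume \<phi>: "\<phi> \<in> test \<Omega>"
  have "(\<integral>x. u x * pd i \<phi> x \<partial>lebesgue_on \<Omega>) = (\<integral>x. v x * pd i \<phi> x \<partial>lebesgue_on \<Omega>)"
    using w by (intro integral_cong_AE_test[OF _ L(1) ae(1) test_pd[OF \<phi>]]) auto
  moreover have "(\<integral>x. component i g x * \<phi> x \<partial>lebesgue_on \<Omega>) = (\<integral>x. component i h x * \<phi> x \<partial>lebesgue_on \<Omega>)"
    using w ae(2) by (intro integral_cong_AE_test[OF _ _ _ \<phi>] L2_component L) (auto simp: component_def)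
  ultimately show "(\<integral>x. v x * pd i \<phi> x \<partial>lebesgue_on \<Omega>) = - (\<integral>x. h x $ i * \<phi> x \<partial>lebesgue_on \<Omega>)"
    using w \<phi> by (simp add: component_def)
qed

lemma has_weak_grad_add:
  assumes \<Omega>: "open \<Omega>" "bounded \<Omega>" and "has_weak_grad \<Omega> u g" "has_weak_grad \<Omega> v h"
  shows "has_weak_grad \<Omega> (\<lambda>x. u x + v x) (\<lambda>x. g x + h x)"
  unfolding has_weak_grad_iff[OF \<Omega>]
proof (intro conjI ballI allI)
  note w = assms(3,4)[unfolded has_weak_grad_iff[OF \<Omega>]]
  show "(\<lambda>x. u x + v x) \<in> L2 \<Omega>" "(\<lambda>x. g x + h x) \<in> L2 \<Omega>" using w by (auto intro: L2_add)
  fix \<phi> i assume \<phi>: "\<phi> \<in> test \<Omega>"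
  have i: "integrable (lebesgue_on \<Omega>) (\<lambda>x. f x * \<psi> x)" if "f \<in> L2 \<Omega>" "\<psi> \<in> test \<Omega>" for f \<psi>
    by (rule L2_test_integrable_mult[OF \<Omega> that])
  have "integrable (lebesgue_on \<Omega>) (\<lambda>x. g x $ i * \<phi> x)" "integrable (lebesgue_on \<Omega>) (\<lambda>x. h x $ i * \<phi> x)"
    using i[OF L2_component \<phi>, of g i] i[OF L2_component \<phi>, of h i] w by (auto simp: component_def)
  moreover have "integrable (lebesgue_on \<Omega>) (\<lambda>x. u x * pd i \<phi> x)" "integrable (lebesgue_on \<Omega>) (\<lambda>x. v x * pd i \<phi> x)"
    using w by (auto intro!: i test_pd \<phi>)
  ultimately show "(\<integral>x. (u x + v x) * pd i \<phi> x \<partial>lebesgue_on \<Omega>) = - (\<integral>x. (g x + h x) $ i * \<phi> x \<partial>lebesgue_on \<Omega>)"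
    using w \<phi> by (simp add: distrib_right)
qed

text \<open>The approximants have compact support in \<Omega>, so integration by parts leaves no
  boundary term even against test functions on the whole space, and the identity passes to the
  limit. The boundary condition of \<open>H01\<close> enters the later arguments in this form: the
  extension by zero has a weak gradient.\<close>

lemma H01_extension:
  assumes \<Omega>: "open \<Omega>" "bounded \<Omega>" and "u \<in> H01 \<Omega>"
  obtains g where "has_weak_grad \<Omega> u g"
    "\<And>\<phi> i. \<phi> \<in> test UNIV \<Longrightarrow>
      (\<integral>x. u x * pd i \<phi> x \<partial>lebesgue_on \<Omega>) = - (\<integral>x. g x $ i * \<phi> x \<partial>lebesgue_on \<Omega>)"
proof -
  obtain f g where f: "\<And>n. f n \<in> test \<Omega>" and g: "has_weak_grad \<Omega> u g"
    and c: "(\<lambda>n. l2norm (lebesgue_on \<Omega>) (\<lambda>x. f n x - u x)) \<longlonglongrightarrow> 0"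
    and c': "(\<lambda>n. l2norm (lebesgue_on \<Omega>) (\<lambda>x. grad (f n) x - g x)) \<longlonglongrightarrow> 0"
    using assms(3) unfolding H01_def H1_conv_def by auto
  have L: "u \<in> L2 \<Omega>" "g \<in> L2 \<Omega>" using g by (auto simp: has_weak_grad_def)
  show thesis
  proof (rule that[OF g])
    fix \<phi> i assume \<phi>: "\<phi> \<in> test UNIV"
    have pdL: "pd i (f n) \<in> L2 \<Omega>" for n by (intro smooth_L2 \<Omega> smooth_pd test_smooth[OF f])
    have gL: "(\<lambda>x. g x $ i) \<in> L2 \<Omega>" using L2_component[OF L(2), of i] by (simp add: component_def[abs_def])
    have "(\<lambda>n. l2norm (lebesgue_on \<Omega>) (component i (\<lambda>x. grad (f n) x - g x))) \<longlonglongrightarrow> 0"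
      by (intro l2norm_component_tendsto_0[OF _ c'] L2_diff L continuous_L2 \<Omega> smooth_grad_continuous_on test_smooth[OF f])
    then have "(\<lambda>n. l2norm (lebesgue_on \<Omega>) (\<lambda>x. pd i (f n) x - g x $ i)) \<longlonglongrightarrow> 0"
      by (simp add: component_def[abs_def])
    from l2norm_tendsto_integral[OF \<Omega> pdL gL this \<phi>]
    have 1: "(\<lambda>n. \<integral>x. pd i (f n) x * \<phi> x \<partial>lebesgue_on \<Omega>) \<longlonglongrightarrow> (\<integral>x. g x $ i * \<phi> x \<partial>lebesgue_on \<Omega>)" .
    have 2: "(\<lambda>n. \<integral>x. f n x * pd i \<phi> x \<partial>lebesgue_on \<Omega>) \<longlonglongrightarrow> (\<integral>x. u x * pd i \<phi> x \<partial>lebesgue_on \<Omega>)"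
      by (intro l2norm_tendsto_integral[OF \<Omega> _ L(1) c test_pd[OF \<phi>]] smooth_L2 \<Omega> test_smooth[OF f])
    have "(\<integral>x. f n x * pd i \<phi> x \<partial>lebesgue_on \<Omega>) = - (\<integral>x. pd i (f n) x * \<phi> x \<partial>lebesgue_on \<Omega>)" for n
    proof -
      obtain K where K: "K \<subseteq> \<Omega>" "\<And>x. x \<notin> K \<Longrightarrow> f n x = 0" "\<And>x i. x \<notin> K \<Longrightarrow> pd i (f n) x = 0"
        using f[of n] by (rule testE) blast
      have m: "f n \<in> borel_measurable borel" "pd i (f n) \<in> borel_measurable borel"
          "\<phi> \<in> borel_measurable borel" "pd i \<phi> \<in> borel_measurable borel"
        by (intro smooth_borel smooth_pd test_smooth[OF f] test_smooth[OF \<phi>])+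
      have "(\<integral>x. f n x * pd i \<phi> x \<partial>lebesgue_on \<Omega>) = (\<integral>x. f n x * pd i \<phi> x \<partial>lborel)"
        using m K \<Omega> by (intro integral_lebesgue_on_eq_lborel) auto
      moreover have "(\<integral>x. pd i (f n) x * \<phi> x \<partial>lebesgue_on \<Omega>) = (\<integral>x. pd i (f n) x * \<phi> x \<partial>lborel)"
        using m K \<Omega> by (intro integral_lebesgue_on_eq_lborel) auto
      ultimately show ?thesis
        using test_integration_by_parts[OF \<phi> test_smooth[OF f[of n]], of i] by simp
    qed
    then have "(\<lambda>n. - (\<integral>x. pd i (f n) x * \<phi> x \<partial>lebesgue_on \<Omega>)) \<longlonglongrightarrow> (\<integral>x. u x * pd i \<phi> x \<partial>lebesgue_on \<Omega>)"
      using 2 by simp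
    with tendsto_minus[OF 1] show "(\<integral>x. u x * pd i \<phi> x \<partial>lebesgue_on \<Omega>) = - (\<integral>x. g x $ i * \<phi> x \<partial>lebesgue_on \<Omega>)"
      by (rule LIMSEQ_unique[rotated])
  qed
qed

text \<open>An approximating sequence for one representative serves for every other one;
  \<open>wgrad\<close> is fixed only up to null sets.\<close>

lemma H01_cong:
  assumes \<Omega>: "open \<Omega>" "bounded \<Omega>" and u: "H1_conv \<Omega> \<phi> u"
    and \<phi>: "\<And>n. \<phi> n \<in> test \<Omega>"
    and v: "v \<in> L2 \<Omega>" "AE x in lebesgue_on \<Omega>. u x = v x"
  shows "v \<in> H01 \<Omega>"
proof -
  obtain g where g: "has_weak_grad \<Omega> u g"
    and c: "(\<lambda>n. l2norm (lebesgue_on \<Omega>) (\<lambda>x. \<phi> n x - u x)) \<longlonglongrightarrow> 0"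
    and c': "(\<lambda>n. l2norm (lebesgue_on \<Omega>) (\<lambda>x. grad (\<phi> n) x - g x)) \<longlonglongrightarrow> 0"
    using u unfolding H1_conv_def by auto
  have L: "u \<in> L2 \<Omega>" "g \<in> L2 \<Omega>" using g by (auto simp: has_weak_grad_def)
  have "has_weak_grad \<Omega> v g"
    using v by (intro has_weak_grad_cong[OF \<Omega> g] L) auto
  moreover have "l2norm (lebesgue_on \<Omega>) (\<lambda>x. \<phi> n x - u x) = l2norm (lebesgue_on \<Omega>) (\<lambda>x. \<phi> n x - v x)" for n
    unfolding l2norm_def
  proof (intro arg_cong[of _ _ sqrt] integral_cong_AE)
    have "(\<lambda>x. \<phi> n x - u x) \<in> L2 \<Omega>" "(\<lambda>x. \<phi> n x - v x) \<in> L2 \<Omega>"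
      by (intro L2_diff L v smooth_L2 \<Omega> test_smooth[OF \<phi>])+
    then show "(\<lambda>x. (norm (\<phi> n x - u x))\<^sup>2) \<in> borel_measurable (lebesgue_on \<Omega>)"
        "(\<lambda>x. (norm (\<phi> n x - v x))\<^sup>2) \<in> borel_measurable (lebesgue_on \<Omega>)"
      by (auto simp: sq_int_def)
  qed (use v(2) in auto)
  ultimately have "H1_conv \<Omega> \<phi> v" using c c' unfolding H1_conv_def by auto
  then show ?thesis using \<phi> unfolding H01_def by blast
qed

text \<open>The squared L2 error of a gradient is the sum of the squared errors of its components,
  so convergence of the components suffices for \<open>H01\<close>. Uniqueness of weak gradients
  passes from the gradient \<open>g\<close> of the definition to the chosen
  \<open>wgrad\<close>.\<close>

lemma H02_facts:
  assumes \<Omega>: "open \<Omega>" "bounded \<Omega>" and v: "v \<in> H02 \<Omega>"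
  shows "has_weak_grad \<Omega> v (wgrad \<Omega> v)" "v \<in> H01 \<Omega>" "wgrad \<Omega> v \<in> H01_vec \<Omega>"
proof -
  obtain \<phi> g where \<phi>: "\<And>n. \<phi> n \<in> test \<Omega>" and g: "has_weak_grad \<Omega> v g"
    and c: "(\<lambda>n. l2norm (lebesgue_on \<Omega>) (\<lambda>x. \<phi> n x - v x)) \<longlonglongrightarrow> 0"
    and c': "\<And>i. H1_conv \<Omega> (\<lambda>n. pd i (\<phi> n)) (component i g)"
    using v unfolding H02_def by auto
  show wg: "has_weak_grad \<Omega> v (wgrad \<Omega> v)"
    unfolding wgrad_def by (rule someI[of "has_weak_grad \<Omega> v"]) (rule g)
  have L: "g \<in> L2 \<Omega>" "wgrad \<Omega> v \<in> L2 \<Omega>" using g wg by (auto simp: has_weak_grad_def)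
  have "(\<lambda>n. l2norm (lebesgue_on \<Omega>) (\<lambda>x. grad (\<phi> n) x - g x)) \<longlonglongrightarrow> 0"
  proof -
    let ?q = "\<lambda>n i. \<integral>x. (pd i (\<phi> n) x - g x $ i)\<^sup>2 \<partial>lebesgue_on \<Omega>"
    have q: "(\<lambda>n. ?q n i) \<longlonglongrightarrow> 0" for i
    proof -
      have "(\<lambda>n. (l2norm (lebesgue_on \<Omega>) (\<lambda>x. pd i (\<phi> n) x - component i g x))\<^sup>2) \<longlonglongrightarrow> 0\<^sup>2"
        using c'[of i] unfolding H1_conv_def by (intro tendsto_power) auto
      then show ?thesis by (simp add: l2norm_def component_def)
    qed
    have "l2norm (lebesgue_on \<Omega>) (\<lambda>x. grad (\<phi> n) x - g x) = sqrt (\<Sum>i\<in>UNIV. ?q n i)" for n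
    proof -
      have "(\<lambda>x. pd i (\<phi> n) x - component i g x) \<in> L2 \<Omega>" for i
        by (intro L2_diff L2_component L smooth_L2 \<Omega> smooth_pd test_smooth[OF \<phi>])
      then have "integrable (lebesgue_on \<Omega>) (\<lambda>x. (pd i (\<phi> n) x - g x $ i)\<^sup>2)" for i
        by (simp add: sq_int_def component_def)
      then show ?thesis
        by (simp add: l2norm_def norm_sq_components Bochner_Integration.integral_sum)
    qed
    moreover have "(\<lambda>n. sqrt (\<Sum>i\<in>UNIV. ?q n i)) \<longlonglongrightarrow> sqrt (\<Sum>i\<in>(UNIV::3 set). 0)"
      by (intro tendsto_real_sqrt tendsto_sum q)
    ultimately show ?thesis by simp
  qed
  then show "v \<in> H01 \<Omega>" using \<phi> g c unfolding H01_def H1_conv_def by blast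
  have "AE x in lebesgue_on \<Omega>. g x = wgrad \<Omega> v x" using weak_grad_unique[OF \<Omega> g wg] .
  then have "AE x in lebesgue_on \<Omega>. component i g x = component i (wgrad \<Omega> v) x" for i
    by (auto simp: component_def)
  then have "component i (wgrad \<Omega> v) \<in> H01 \<Omega>" for i
    by (intro H01_cong[OF \<Omega> c'] test_pd \<phi> L2_component L)
  then show "wgrad \<Omega> v \<in> H01_vec \<Omega>" by (simp add: H01_vec_def)
qed

lemma inner_3: "x \<bullet> y = x $ 1 * y $ 1 + x $ 2 * y $ 2 + x $ 3 * y $ 3" for x y :: "real^3"
  by (simp add: inner_vec_def sum_3)

text \<open>Makes \<open>\<Pi>\<^sub>N\<^sub>D\<close> and its commuting relation applicable to
  fields in \<open>H01_vec\<close>. The componentwise identities against \<open>test UNIV\<close>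
  combine to Green's formula for the curl without a boundary term.\<close>

lemma H01_vec_H0curl:
  assumes \<Omega>: "open \<Omega>" "bounded \<Omega>" and v: "v \<in> H01_vec \<Omega>"
  shows "v \<in> H0curl \<Omega>"
proof -
  have ex: "\<exists>g. has_weak_grad \<Omega> (component k v) g \<and> (\<forall>\<phi>\<in>test UNIV. \<forall>i.
      (\<integral>x. v x $ k * pd i \<phi> x \<partial>lebesgue_on \<Omega>) = - (\<integral>x. g x $ i * \<phi> x \<partial>lebesgue_on \<Omega>))" for k
  proof -
    have "component k v \<in> H01 \<Omega>" using v by (simp add: H01_vec_def)
    then show ?thesis by (rule H01_extension[OF \<Omega>]) (auto simp: component_def)
  qed
  obtain g where gg: "\<forall>k. has_weak_grad \<Omega> (component k v) (g k) \<and> (\<forall>\<phi>\<in>test UNIV. \<forall>i.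
      (\<integral>x. v x $ k * pd i \<phi> x \<partial>lebesgue_on \<Omega>) = - (\<integral>x. g k x $ i * \<phi> x \<partial>lebesgue_on \<Omega>))"
    using choice[of "\<lambda>k g. has_weak_grad \<Omega> (component k v) g \<and> (\<forall>\<phi>\<in>test UNIV. \<forall>i.
      (\<integral>x. v x $ k * pd i \<phi> x \<partial>lebesgue_on \<Omega>) = - (\<integral>x. g x $ i * \<phi> x \<partial>lebesgue_on \<Omega>))"] ex
    by blast
  have g: "has_weak_grad \<Omega> (component k v) (g k)" for k using gg by blast
  have ext: "(\<integral>x. v x $ k * pd i \<phi> x \<partial>lebesgue_on \<Omega>) = - (\<integral>x. g k x $ i * \<phi> x \<partial>lebesgue_on \<Omega>)"
    if "\<phi> \<in> test UNIV" for k \<phi> i using gg that by blast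
  have vk: "component k v \<in> L2 \<Omega>" and gk: "g k \<in> L2 \<Omega>" for k
    using g[of k] by (auto simp: has_weak_grad_def)
  have vL: "v \<in> L2 \<Omega>" using vk by (rule L2_vec)
  have gki: "(\<lambda>x. g k x $ i) \<in> L2 \<Omega>" for k i
    using L2_component[OF gk, of i k] by (simp add: component_def[abs_def])
  \<comment> \<open>Here \<open>g k x $ i\<close> stands for the \<open>i\<close>-th partial
    derivative of the \<open>k\<close>-th component, so this is the usual formula for the
    curl.\<close>
  define w :: "real^3 \<Rightarrow> real^3" where
    "w x = vector [g 3 x $ 2 - g 2 x $ 3, g 1 x $ 3 - g 3 x $ 1, g 2 x $ 1 - g 1 x $ 2]" for x
  have "component k w \<in> L2 \<Omega>" for k
    using exhaust_3[of k] by (auto simp: w_def component_def[abs_def] intro!: L2_diff gki)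
  then have wL: "w \<in> L2 \<Omega>" by (rule L2_vec)
  have "(\<integral>x. v x \<bullet> curl \<psi> x \<partial>lebesgue_on \<Omega>) = (\<integral>x. w x \<bullet> \<psi> x \<partial>lebesgue_on \<Omega>)" if \<psi>: "\<psi> \<in> vtest UNIV" for \<psi>
  proof -
    have t: "component i \<psi> \<in> test UNIV" for i using \<psi> by (simp add: vtest_def)
    have i1: "integrable (lebesgue_on \<Omega>) (\<lambda>x. v x $ k * pd i (component j \<psi>) x)" for k i j
      using L2_test_integrable_mult[OF \<Omega> vk[of k] test_pd[OF t[of j], of i]] by (simp add: component_def)
    have i2: "integrable (lebesgue_on \<Omega>) (\<lambda>x. g k x $ i * component j \<psi> x)" for k i j
      by (rule L2_test_integrable_mult[OF \<Omega> gki t])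
    have "(\<integral>x. v x \<bullet> curl \<psi> x \<partial>lebesgue_on \<Omega>) = (\<integral>x.
        (v x $ 1 * pd 2 (component 3 \<psi>) x - v x $ 1 * pd 3 (component 2 \<psi>) x) +
        (v x $ 2 * pd 3 (component 1 \<psi>) x - v x $ 2 * pd 1 (component 3 \<psi>) x) +
        (v x $ 3 * pd 1 (component 2 \<psi>) x - v x $ 3 * pd 2 (component 1 \<psi>) x) \<partial>lebesgue_on \<Omega>)"
      by (simp add: inner_3 curl_def right_diff_distrib)
    also have "\<dots> = (\<integral>x.
        (g 3 x $ 2 * component 1 \<psi> x - g 2 x $ 3 * component 1 \<psi> x) +
        (g 1 x $ 3 * component 2 \<psi> x - g 3 x $ 1 * component 2 \<psi> x) +
        (g 2 x $ 1 * component 3 \<psi> x - g 1 x $ 2 * component 3 \<psi> x) \<partial>lebesgue_on \<Omega>)"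
      using i1 i2 by (simp add: ext[OF t])
    also have "\<dots> = (\<integral>x. w x \<bullet> \<psi> x \<partial>lebesgue_on \<Omega>)"
      by (simp add: inner_3 w_def component_def left_diff_distrib)
    finally show ?thesis .
  qed
  moreover from this have "has_weak_curl \<Omega> v w"
    unfolding has_weak_curl_def using vL wL by (auto simp: vtest_def intro: test_mono)
  ultimately show ?thesis unfolding H0curl_def by auto
qed

text \<open>The mean value theorem twice: in direction \<open>i\<close> for the increment along
  \<open>j\<close>, then in direction \<open>j\<close> for the partial derivative.\<close>

lemma mixed_difference:
  assumes f: "smooth f" and h: "h > 0"
  obtains \<xi> \<eta> where "0 < \<xi>" "\<xi> < h" "0 < \<eta>" "\<eta> < h"
    "f (x + h *\<^sub>R axis i 1 + h *\<^sub>R axis j 1) - f (x + h *\<^sub>R axis i 1) - f (x + h *\<^sub>R axis j 1) + f x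
      = h * h * pd j (pd i f) (x + \<xi> *\<^sub>R axis i 1 + \<eta> *\<^sub>R axis j 1)"
proof -
  let ?e = "axis i 1 :: real^3" and ?d = "axis j 1 :: real^3"
  have D: "((\<lambda>s. g (y + s *\<^sub>R axis k 1)) has_real_derivative pd k g (y + s *\<^sub>R axis k 1)) (at s)"
    if "smooth g" for g y s k
    using smooth_directional_derivative[OF that, of y "axis k 1" s] by (simp add: inner_axis)
  have "((\<lambda>s. f (x + h *\<^sub>R ?d + s *\<^sub>R ?e) - f (x + s *\<^sub>R ?e)) has_real_derivative
      pd i f (x + h *\<^sub>R ?d + s *\<^sub>R ?e) - pd i f (x + s *\<^sub>R ?e)) (at s)" for s
    by (intro DERIV_diff D f)
  then obtain \<xi> where \<xi>: "0 < \<xi>" "\<xi> < h"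
    "(f (x + h *\<^sub>R ?d + h *\<^sub>R ?e) - f (x + h *\<^sub>R ?e)) - (f (x + h *\<^sub>R ?d + 0 *\<^sub>R ?e) - f (x + 0 *\<^sub>R ?e))
      = (h - 0) * (pd i f (x + h *\<^sub>R ?d + \<xi> *\<^sub>R ?e) - pd i f (x + \<xi> *\<^sub>R ?e))"
    using MVT2[OF h, of "\<lambda>s. f (x + h *\<^sub>R ?d + s *\<^sub>R ?e) - f (x + s *\<^sub>R ?e)"
        "\<lambda>s. pd i f (x + h *\<^sub>R ?d + s *\<^sub>R ?e) - pd i f (x + s *\<^sub>R ?e)"] by blast
  obtain \<eta> where \<eta>: "0 < \<eta>" "\<eta> < h"
    "pd i f (x + \<xi> *\<^sub>R ?e + h *\<^sub>R ?d) - pd i f (x + \<xi> *\<^sub>R ?e + 0 *\<^sub>R ?d)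
      = (h - 0) * pd j (pd i f) (x + \<xi> *\<^sub>R ?e + \<eta> *\<^sub>R ?d)"
    using MVT2[OF h, of "\<lambda>s. pd i f (x + \<xi> *\<^sub>R ?e + s *\<^sub>R ?d)"
        "\<lambda>s. pd j (pd i f) (x + \<xi> *\<^sub>R ?e + s *\<^sub>R ?d)"] D[OF smooth_pd[OF f]] by blast
  have c: "x + h *\<^sub>R ?d + \<xi> *\<^sub>R ?e = x + \<xi> *\<^sub>R ?e + h *\<^sub>R ?d" "x + h *\<^sub>R ?d + h *\<^sub>R ?e = x + h *\<^sub>R ?e + h *\<^sub>R ?d"
    by (simp_all add: algebra_simps)
  have "f (x + h *\<^sub>R ?e + h *\<^sub>R ?d) - f (x + h *\<^sub>R ?e) - f (x + h *\<^sub>R ?d) + f x =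
      h * (pd i f (x + \<xi> *\<^sub>R ?e + h *\<^sub>R ?d) - pd i f (x + \<xi> *\<^sub>R ?e))"
    using \<xi>(3)[unfolded c] by simp
  also have "pd i f (x + \<xi> *\<^sub>R ?e + h *\<^sub>R ?d) - pd i f (x + \<xi> *\<^sub>R ?e) =
      h * pd j (pd i f) (x + \<xi> *\<^sub>R ?e + \<eta> *\<^sub>R ?d)"
    using \<eta>(3) by simp
  finally show thesis using \<xi> \<eta> by (intro that[of \<xi> \<eta>]) (simp_all only: mult.assoc)
qed

text \<open>The second difference is symmetric in \<open>i\<close> and \<open>j\<close>, and divided
  by \<open>h * h\<close> it is a value of either mixed derivative near \<open>x\<close>; continuity
  excludes that the two differ at \<open>x\<close>.\<close>

lemma pd_commute:
  assumes f: "smooth f"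
  shows "pd i (pd j f) x = pd j (pd i f) x"
proof (rule ccontr)
  assume ne: "pd i (pd j f) x \<noteq> pd j (pd i f) x"
  define \<epsilon> where "\<epsilon> = \<bar>pd i (pd j f) x - pd j (pd i f) x\<bar> / 2"
  have \<epsilon>: "\<epsilon> > 0" using ne by (simp add: \<epsilon>_def)
  have cont: "\<exists>\<delta>>0. \<forall>y. dist y x < \<delta> \<longrightarrow> \<bar>pd k (pd l f) y - pd k (pd l f) x\<bar> < \<epsilon>" for k l
  proof -
    have "continuous_on UNIV (pd k (pd l f))" by (intro smooth_continuous_on smooth_pd f)
    then show ?thesis using \<epsilon> unfolding continuous_on_iff by (auto simp: dist_real_def)
  qed
  obtain \<delta>1 where 1: "\<delta>1 > 0" "\<And>y. dist y x < \<delta>1 \<Longrightarrow> \<bar>pd i (pd j f) y - pd i (pd j f) x\<bar> < \<epsilon>"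
    using cont by blast
  obtain \<delta>2 where 2: "\<delta>2 > 0" "\<And>y. dist y x < \<delta>2 \<Longrightarrow> \<bar>pd j (pd i f) y - pd j (pd i f) x\<bar> < \<epsilon>"
    using cont by blast
  \<comment> \<open>The half leaves room for two offsets, each shorter than
    \<open>h\<close>.\<close>
  define h where "h = min \<delta>1 \<delta>2 / 2"
  have h: "h > 0" using 1 2 by (simp add: h_def)
  have near: "dist (x + s *\<^sub>R axis k 1 + t *\<^sub>R axis l 1) x < min \<delta>1 \<delta>2" if "0 < s" "s < h" "0 < t" "t < h" for s t k l
  proof -
    have "dist (x + s *\<^sub>R axis k 1 + t *\<^sub>R axis l 1) x \<le> norm (s *\<^sub>R axis k 1 :: real^3) + norm (t *\<^sub>R axis l 1 :: real^3)"
      unfolding dist_norm by (metis add_diff_cancel_left' norm_triangle_ineq add.assoc)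
    also have "\<dots> < min \<delta>1 \<delta>2" using that by (simp add: h_def)
    finally show ?thesis .
  qed
  obtain s t where st: "0 < s" "s < h" "0 < t" "t < h" and
    e1: "f (x + h *\<^sub>R axis i 1 + h *\<^sub>R axis j 1) - f (x + h *\<^sub>R axis i 1) - f (x + h *\<^sub>R axis j 1) + f x
      = h * h * pd j (pd i f) (x + s *\<^sub>R axis i 1 + t *\<^sub>R axis j 1)"
    by (rule mixed_difference[OF f h, of x i j])
  obtain s' t' where st': "0 < s'" "s' < h" "0 < t'" "t' < h" and
    e2: "f (x + h *\<^sub>R axis j 1 + h *\<^sub>R axis i 1) - f (x + h *\<^sub>R axis j 1) - f (x + h *\<^sub>R axis i 1) + f x
      = h * h * pd i (pd j f) (x + s' *\<^sub>R axis j 1 + t' *\<^sub>R axis i 1)"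
    by (rule mixed_difference[OF f h, of x j i])
  have c: "x + h *\<^sub>R axis j 1 + h *\<^sub>R axis i 1 = x + h *\<^sub>R axis i 1 + h *\<^sub>R axis j 1" by (simp add: algebra_simps)
  have "h * h * pd j (pd i f) (x + s *\<^sub>R axis i 1 + t *\<^sub>R axis j 1) =
      h * h * pd i (pd j f) (x + s' *\<^sub>R axis j 1 + t' *\<^sub>R axis i 1)"
    using e1 e2[unfolded c] by linarith
  then have "pd j (pd i f) (x + s *\<^sub>R axis i 1 + t *\<^sub>R axis j 1) = pd i (pd j f) (x + s' *\<^sub>R axis j 1 + t' *\<^sub>R axis i 1)"
    using h by simp
  moreover have "\<bar>pd j (pd i f) (x + s *\<^sub>R axis i 1 + t *\<^sub>R axis j 1) - pd j (pd i f) x\<bar> < \<epsilon>"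
    using near[OF st] by (intro 2) simp
  moreover have "\<bar>pd i (pd j f) (x + s' *\<^sub>R axis j 1 + t' *\<^sub>R axis i 1) - pd i (pd j f) x\<bar> < \<epsilon>"
    using near[OF st'] by (intro 1) simp
  ultimately show False unfolding \<epsilon>_def by (smt (verit) field_sum_of_halves)
qed

text \<open>Moving one more derivative to the test field produces \<open>u\<close> times the
  divergence of a curl, which cancels by symmetry of second derivatives.\<close>

lemma weak_curl_weak_grad:
  assumes \<Omega>: "open \<Omega>" "bounded \<Omega>" and w: "has_weak_grad \<Omega> u g"
  shows "has_weak_curl \<Omega> g (\<lambda>x. 0)"
  unfolding has_weak_curl_def
proof (intro conjI ballI)
  note w = w[unfolded has_weak_grad_iff[OF \<Omega>]]
  show "g \<in> L2 \<Omega>" using w by simp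
  show "(\<lambda>x. 0) \<in> L2 \<Omega>" by (simp add: sq_int_def)
  fix \<psi> assume \<psi>: "\<psi> \<in> vtest \<Omega>"
  have t: "component i \<psi> \<in> test \<Omega>" for i using \<psi> by (simp add: vtest_def)
  have gi: "integrable (lebesgue_on \<Omega>) (\<lambda>x. g x $ k * pd i (component j \<psi>) x)" for k i j
    using L2_test_integrable_mult[OF \<Omega> L2_component[of g \<Omega> k] test_pd[OF t[of j], of i]] w
    by (simp add: component_def)
  have eq: "(\<integral>x. g x $ k * pd i (component j \<psi>) x \<partial>lebesgue_on \<Omega>) =
      - (\<integral>x. u x * pd k (pd i (component j \<psi>)) x \<partial>lebesgue_on \<Omega>)" for i j k
    using w test_pd[OF t, of i j] by simp
  have comm: "pd k (pd i (component j \<psi>)) = pd i (pd k (component j \<psi>))" for i j k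
    by (intro ext pd_commute test_smooth[OF t])
  have "(\<integral>x. g x \<bullet> curl \<psi> x \<partial>lebesgue_on \<Omega>) = (\<integral>x.
        (g x $ 1 * pd 2 (component 3 \<psi>) x - g x $ 1 * pd 3 (component 2 \<psi>) x) +
        (g x $ 2 * pd 3 (component 1 \<psi>) x - g x $ 2 * pd 1 (component 3 \<psi>) x) +
        (g x $ 3 * pd 1 (component 2 \<psi>) x - g x $ 3 * pd 2 (component 1 \<psi>) x) \<partial>lebesgue_on \<Omega>)"
    by (simp add: inner_3 curl_def right_diff_distrib)
  also have "\<dots> = 0"
    using gi by (simp add: eq comm[of 2 1] comm[of 3 1] comm[of 3 2])
  finally show "(\<integral>x. g x \<bullet> curl \<psi> x \<partial>lebesgue_on \<Omega>) = (\<integral>x. 0 \<bullet> \<psi> x \<partial>lebesgue_on \<Omega>)" by simp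
qed

section \<open>Meshes and blow-up at a boundary point\<close>

text \<open>Test functions supported in \<open>S\<close> see only the smooth field \<open>P\<close>,
  for which integration by parts is classical. The minus sign reflects that the identity
  \<open>eq\<close> makes \<open>- H\<close> the weak divergence of \<open>U\<close>.\<close>

lemma local_weak_divergence:
  assumes \<Omega>: "open \<Omega>" "bounded \<Omega>" and S: "open S" "S \<subseteq> \<Omega>"
    and L: "U \<in> L2 \<Omega>" "H \<in> L2 \<Omega>"
    and eq: "\<And>\<phi>. \<phi> \<in> test S \<Longrightarrow> (\<integral>x. U x \<bullet> grad \<phi> x \<partial>lebesgue_on \<Omega>) = (\<integral>x. H x * \<phi> x \<partial>lebesgue_on \<Omega>)"
    and P: "\<And>i. smooth (component i P)" and ae: "AE x in lebesgue_on S. U x = P x"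
  shows "AE x in lebesgue_on S. H x = - (\<Sum>i\<in>UNIV. pd i (component i P) x)"
proof -
  have bS: "bounded S" using \<Omega>(2) S(2) by (rule bounded_subset)
  have Sl: "S \<in> sets lebesgue" "\<Omega> \<in> sets lebesgue" using S \<Omega> by auto
  have US: "U \<in> L2 S" "H \<in> L2 S"
  proof -
    have "integrable (lebesgue_on S) (\<lambda>x. (norm (U x))\<^sup>2)" "integrable (lebesgue_on S) (\<lambda>x. (norm (H x))\<^sup>2)"
      using L by (auto intro!: integrable_lebesgue_on_subset[OF Sl S(2)] simp: sq_int_def)
    moreover have "U \<in> borel_measurable (lebesgue_on S)" "H \<in> borel_measurable (lebesgue_on S)"
      using integrable_lebesgue_on_subset[OF Sl S(2) L2_integrable[OF \<Omega> L(1)]]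
        integrable_lebesgue_on_subset[OF Sl S(2) L2_integrable[OF \<Omega> L(2)]] by auto
    ultimately show "U \<in> L2 S" "H \<in> L2 S" by (simp_all add: sq_int_def)
  qed
  define D where "D x = (\<Sum>i\<in>UNIV. pd i (component i P) x)" for x
  have smD: "smooth (\<lambda>x. - D x)"
    unfolding D_def sum_3 by (intro smooth_uminus smooth_add smooth_pd P)
  have "AE x in lebesgue_on S. H x = - D x"
  proof (rule L2_fundamental_lemma[OF S(1) bS US(2)])
    show "(\<lambda>x. - D x) \<in> L2 S" by (intro smooth_L2 S(1) bS smD)
    fix \<phi> assume \<phi>: "\<phi> \<in> test S"
    obtain K where K: "K \<subseteq> S" "\<And>x. x \<notin> K \<Longrightarrow> \<phi> x = 0" "\<And>x i. x \<notin> K \<Longrightarrow> pd i \<phi> x = 0"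
      using \<phi> by (rule testE) blast
    have gr: "grad \<phi> x = 0" "\<phi> x = 0" "\<And>i. pd i \<phi> x = 0" if "x \<notin> S" for x
      using that K by (auto simp: vec_eq_iff)
    have m: "component i P \<in> borel_measurable borel" "pd i \<phi> \<in> borel_measurable borel" "\<phi> \<in> borel_measurable borel" for i
      by (intro smooth_borel smooth_pd P test_smooth[OF \<phi>])+
    have "(\<integral>x. H x * \<phi> x \<partial>lebesgue_on S) = (\<integral>x. H x * \<phi> x \<partial>lebesgue_on \<Omega>)"
      using gr by (intro integral_lebesgue_on_subset[symmetric] Sl S) auto
    also have "\<dots> = (\<integral>x. U x \<bullet> grad \<phi> x \<partial>lebesgue_on \<Omega>)" by (rule eq[OF \<phi>, symmetric])
    also have "\<dots> = (\<integral>x. U x \<bullet> grad \<phi> x \<partial>lebesgue_on S)"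
      using gr by (intro integral_lebesgue_on_subset Sl S) auto
    also have "\<dots> = (\<integral>x. (\<Sum>i\<in>UNIV. component i P x * pd i \<phi> x) \<partial>lebesgue_on S)"
    proof (rule integral_cong_AE)
      have [measurable]: "U \<in> borel_measurable (lebesgue_on S)" using US(1) by (rule L2_measurable)
      have [measurable]: "grad \<phi> \<in> borel_measurable (lebesgue_on S)"
        by (intro borel_imp_lebesgue_on grad_borel_measurable test_smooth[OF \<phi>])
      show "(\<lambda>x. U x \<bullet> grad \<phi> x) \<in> borel_measurable (lebesgue_on S)" by measurable
      show "(\<lambda>x. \<Sum>i\<in>UNIV. component i P x * pd i \<phi> x) \<in> borel_measurable (lebesgue_on S)"
        by (intro borel_imp_lebesgue_on borel_measurable_sum borel_measurable_times m)
      show "AE x in lebesgue_on S. U x \<bullet> grad \<phi> x = (\<Sum>i\<in>UNIV. component i P x * pd i \<phi> x)"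
        using ae by (auto simp: inner_vec_def component_def)
    qed
    also have "\<dots> = (\<integral>x. (\<Sum>i\<in>UNIV. component i P x * pd i \<phi> x) \<partial>lborel)"
      using gr(3) Sl by (intro integral_lebesgue_on_eq_lborel borel_measurable_sum borel_measurable_times m) auto
    also have "\<dots> = (\<Sum>i\<in>UNIV. \<integral>x. component i P x * pd i \<phi> x \<partial>lborel)"
      using test_integrable[OF test_mult[OF test_pd[OF \<phi>] P]]
      by (intro Bochner_Integration.integral_sum) (simp add: mult.commute)
    also have "\<dots> = (\<Sum>i\<in>UNIV. - (\<integral>x. pd i (component i P) x * \<phi> x \<partial>lborel))"
      by (intro sum.cong refl test_integration_by_parts[OF \<phi> P])
    also have "\<dots> = (\<integral>x. - D x * \<phi> x \<partial>lborel)"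
      using test_integrable[OF test_mult[OF \<phi> smooth_pd[OF P]]]
      by (simp add: D_def sum_negf sum_distrib_right mult.commute[of "\<phi> _"] Bochner_Integration.integral_sum)
    also have "\<dots> = (\<integral>x. - D x * \<phi> x \<partial>lebesgue_on S)"
      using gr Sl smooth_borel[OF smD] m(3)
      by (intro integral_lebesgue_on_eq_lborel[symmetric] borel_measurable_times) auto
    finally show "(\<integral>x. H x * \<phi> x \<partial>lebesgue_on S) = (\<integral>x. - D x * \<phi> x \<partial>lebesgue_on S)" .
  qed
  then show ?thesis by (simp add: D_def)
qed

text \<open>The parameters at which the ray hits \<open>S\<close> form an interval; if it has points
  arbitrarily close to 0, it contains all small positive parameters.\<close>

lemma ray_eventually_convex:
  fixes x y :: "real^3"
  assumes "convex S"
  shows "(\<forall>\<^sub>F r in at_right 0. x + r *\<^sub>R y \<in> S) \<or> (\<forall>\<^sub>F r in at_right 0. x + r *\<^sub>R y \<notin> S)"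
proof (rule disjCI)
  assume "\<not> (\<forall>\<^sub>F r in at_right 0. x + r *\<^sub>R y \<notin> S)"
  then have freq: "\<exists>r. 0 < r \<and> r < b \<and> x + r *\<^sub>R y \<in> S" if "b > 0" for b
    using that unfolding eventually_at_right_field by auto
  obtain r1 where r1: "0 < r1" "x + r1 *\<^sub>R y \<in> S" using freq[of 1] by auto
  have "x + r *\<^sub>R y \<in> S" if r: "0 < r" "r < r1" for r
  proof -
    obtain r' where r': "0 < r'" "r' < r" "x + r' *\<^sub>R y \<in> S" using freq[of r] r by auto
    define u where "u = (r - r') / (r1 - r')"
    have u: "0 \<le> u" "u \<le> 1" using r r' by (auto simp: u_def)
    have ur: "r = (1 - u) * r' + u * r1"
    proof -
      have "u * (r1 - r') = r - r'" using r r' by (simp add: u_def)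
      then show ?thesis by (simp add: algebra_simps)
    qed
    have "(1 - u) *\<^sub>R (x + r' *\<^sub>R y) + u *\<^sub>R (x + r1 *\<^sub>R y) \<in> S"
      using assms r' r1 u by (intro convexD_alt) auto
    moreover have "(1 - u) *\<^sub>R (x + r' *\<^sub>R y) + u *\<^sub>R (x + r1 *\<^sub>R y) = x + ((1 - u) * r' + u * r1) *\<^sub>R y"
      by (simp add: algebra_simps)
    ultimately show ?thesis using ur by simp
  qed
  then show "\<forall>\<^sub>F r in at_right 0. x + r *\<^sub>R y \<in> S"
    unfolding eventually_at_right_field using r1(1) by auto
qed

text \<open>A halfspace with \<open>x\<close> on its boundary is a cone at \<open>x\<close>, any
  other one contains a ball around \<open>x\<close>; the smallest of finitely many radii works for
  all.\<close>

lemma polyhedron_locally_conic: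
  fixes T :: "(real^3) set"
  assumes "polyhedron T" "x \<in> T"
  obtains \<epsilon> where "\<epsilon> > 0" "\<And>z s. z \<in> ball x \<epsilon> \<Longrightarrow> 0 < s \<Longrightarrow> s \<le> 1 \<Longrightarrow> x + s *\<^sub>R (z - x) \<in> T \<Longrightarrow> z \<in> T"
proof -
  obtain F where F: "finite F" "T = \<Inter>F" "\<And>h. h \<in> F \<Longrightarrow> \<exists>a b. a \<noteq> 0 \<and> h = {x. a \<bullet> x \<le> b}"
    using assms(1) unfolding polyhedron_def by auto
  have "\<exists>\<epsilon>>0. \<forall>z s. z \<in> ball x \<epsilon> \<longrightarrow> 0 < s \<longrightarrow> s \<le> 1 \<longrightarrow> x + s *\<^sub>R (z - x) \<in> h \<longrightarrow> z \<in> h" if h: "h \<in> F" for h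
  proof -
    obtain a b where ab: "h = {x. a \<bullet> x \<le> b}" using F(3)[OF h] by blast
    have xb: "a \<bullet> x \<le> b" using assms(2) F(2) h ab by auto
    show ?thesis
    proof (cases "a \<bullet> x = b")
      case True
      have "z \<in> h" if "0 < s" "x + s *\<^sub>R (z - x) \<in> h" for z s
      proof -
        have "s * (a \<bullet> (z - x)) \<le> 0" using that(2) True by (simp add: ab inner_add_right)
        then have "a \<bullet> (z - x) \<le> 0" using that(1) by (simp add: mult_le_0_iff)
        then show ?thesis using True by (simp add: ab inner_diff_right)
      qed
      then show ?thesis by (intro exI[of _ 1]) auto
    next
      case False
      then have "x \<in> {x. a \<bullet> x < b}" using xb by simp
      then obtain \<epsilon> where "\<epsilon> > 0" "ball x \<epsilon> \<subseteq> {x. a \<bullet> x < b}"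
        using open_halfspace_lt openE by metis
      then show ?thesis by (intro exI[of _ \<epsilon>]) (auto simp: ab)
    qed
  qed
  then obtain \<epsilon> where \<epsilon>: "\<And>h. h \<in> F \<Longrightarrow> \<epsilon> h > (0::real)"
    "\<And>h z s. h \<in> F \<Longrightarrow> z \<in> ball x (\<epsilon> h) \<Longrightarrow> 0 < s \<Longrightarrow> s \<le> 1 \<Longrightarrow> x + s *\<^sub>R (z - x) \<in> h \<Longrightarrow> z \<in> h"
    by metis
  define e where "e = Min (insert 1 (\<epsilon> ` F))"
  have e: "e > 0" "\<And>h. h \<in> F \<Longrightarrow> e \<le> \<epsilon> h" using F(1) \<epsilon>(1) by (auto simp: e_def)
  show thesis
  proof (rule that[OF e(1)])
    fix z s assume z: "z \<in> ball x e" "0 < s" "s \<le> 1" "x + s *\<^sub>R (z - x) \<in> T"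
    have "z \<in> h" if "h \<in> F" for h
      using z e(2)[OF that] F(2) that by (intro \<epsilon>(2)[of h z s]) auto
    then show "z \<in> T" using F(2) by blast
  qed
qed

section \<open>Elements of the mesh, piecewise fields and cones at a point\<close>

locale meshed_domain =
  fixes \<Omega> :: "(real^3) set" and \<T> :: "(real^3) set set"
  assumes domain: "polyhedral_domain \<Omega>" and bounded_domain: "bounded \<Omega>" and mesh: "tet_mesh \<Omega> \<T>"
begin

lemma open_domain: "open \<Omega>"
  using domain by (simp add: polyhedral_domain_def)

lemmas dom = open_domain bounded_domain

lemma finite_mesh: "finite \<T>"
  using mesh by (simp add: tet_mesh_def triangulation_def)

lemma mesh_simplex: "T \<in> \<T> \<Longrightarrow> 3 simplex T"
  using mesh by (simp add: tet_mesh_def)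

lemma mesh_Union: "closure \<Omega> = \<Union>\<T>"
  using mesh by (simp add: tet_mesh_def)

lemma mesh_face_inter: "T \<in> \<T> \<Longrightarrow> T' \<in> \<T> \<Longrightarrow> T \<inter> T' face_of T"
  using mesh by (simp add: tet_mesh_def triangulation_def)

lemma mesh_convex: "T \<in> \<T> \<Longrightarrow> convex T"
  by (meson convex_simplex mesh_simplex)

lemma mesh_compact: "T \<in> \<T> \<Longrightarrow> compact T"
  by (meson compact_simplex mesh_simplex)

lemma mesh_lebesgue: "T \<in> \<T> \<Longrightarrow> T \<in> sets lebesgue"
  by (simp add: borel_compact mesh_compact)

lemma mesh_interior: "T \<in> \<T> \<Longrightarrow> interior T \<noteq> {}"
  using mesh_simplex[of T] aff_dim_simplex[of 3 T] mesh_convex[of T] interior_rel_interior_gen[of T]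
    simplex_empty[of 3] rel_interior_eq_empty[of T] by (cases "T = {}") auto

text \<open>Elements only cover the closure; the condition
  \<open>\<Omega> = interior (closure \<Omega>)\<close> is what brings their interiors back into
  \<Omega>.\<close>

lemma interior_subset_domain: "T \<in> \<T> \<Longrightarrow> interior T \<subseteq> \<Omega>"
proof -
  assume "T \<in> \<T>"
  then have "interior T \<subseteq> interior (closure \<Omega>)" by (intro interior_mono) (auto simp: mesh_Union)
  also have "\<dots> = \<Omega>" using domain by (simp add: polyhedral_domain_def)
  finally show ?thesis .
qed

text \<open>A face of \<open>S\<close> that meets the relative interior of \<open>S\<close> is all
  of \<open>S\<close>, so a common interior point forces inclusion, and by symmetry
  equality.\<close>

lemma disjoint_interiors:
  assumes "T \<in> \<T>" "T' \<in> \<T>" "x \<in> interior T" "x \<in> interior T'"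
  shows "T = T'"
proof -
  have *: "S \<subseteq> S'" if S: "S \<in> \<T>" "S' \<in> \<T>" "x \<in> interior S" "x \<in> interior S'" for S S'
  proof -
    have "x \<in> rel_interior S" using that(3) interior_subset_rel_interior by blast
    moreover have "x \<in> S'" using that(4) interior_subset by blast
    ultimately have "S \<inter> S' = S"
      using face_of_disjoint_rel_interior[OF mesh_face_inter[OF S(1,2)]] rel_interior_subset by blast
    then show ?thesis by blast
  qed
  show ?thesis using *[OF assms] *[OF assms(2,1,4,3)] by blast
qed

text \<open>What remains lies in finitely many frontiers of convex sets, which are
  negligible.\<close>

lemma AE_interior: "AE x in lebesgue_on \<Omega>. \<exists>T\<in>\<T>. x \<in> interior T"
proof -
  have "negligible (\<Union>T\<in>\<T>. frontier T)"
    using finite_mesh by (intro negligible_Union) (auto intro: negligible_convex_frontier mesh_convex)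
  moreover have "{x. \<not> (x \<in> \<Omega> \<longrightarrow> (\<exists>T\<in>\<T>. x \<in> interior T))} \<subseteq> (\<Union>T\<in>\<T>. frontier T)"
  proof clarsimp
    fix x assume x: "x \<in> \<Omega>" "\<forall>T\<in>\<T>. x \<notin> interior T"
    then obtain T where "T \<in> \<T>" "x \<in> T" using mesh_Union closure_subset by blast
    then show "\<exists>T\<in>\<T>. x \<in> frontier T" using x closure_subset by (auto simp: frontier_def)
  qed
  ultimately have "AE x in lebesgue. x \<in> \<Omega> \<longrightarrow> (\<exists>T\<in>\<T>. x \<in> interior T)"
    by (intro AE_I'[of "\<Union>T\<in>\<T>. frontier T"]) (auto simp: negligible_iff_null_sets)
  then show ?thesis using open_domain by (simp add: AE_restrict_space_iff)
qed

lemma AE_mesh_interior: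
  assumes "T \<in> \<T>" "AE x in lebesgue_on T. Q x"
  shows "AE x in lebesgue_on (interior T). Q x"
proof -
  have "AE x in lebesgue. x \<in> T \<longrightarrow> Q x"
    using assms mesh_lebesgue by (simp add: AE_restrict_space_iff)
  then have "AE x in lebesgue. x \<in> interior T \<longrightarrow> Q x"
    by (rule AE_mp) (auto intro!: AE_I2 dest: interior_subset[THEN subsetD])
  then show ?thesis by (simp add: AE_restrict_space_iff)
qed

lemma AE_domainI:
  assumes "\<And>T. T \<in> \<T> \<Longrightarrow> AE x in lebesgue_on (interior T). Q x"
  shows "AE x in lebesgue_on \<Omega>. Q x"
proof -
  have "AE x in lebesgue. \<forall>T\<in>\<T>. x \<in> interior T \<longrightarrow> Q x"
    using assms by (intro AE_finite_allI finite_mesh) (simp add: AE_restrict_space_iff)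
  moreover have "AE x in lebesgue. x \<in> \<Omega> \<longrightarrow> (\<exists>T\<in>\<T>. x \<in> interior T)"
    using AE_interior open_domain by (simp add: AE_restrict_space_iff)
  ultimately have "AE x in lebesgue. x \<in> \<Omega> \<longrightarrow> Q x" by (auto elim: AE_mp)
  then show ?thesis using open_domain by (simp add: AE_restrict_space_iff)
qed

text \<open>A finite sum of indicators instead of a choice of the element: measurability is
  immediate, and the value outside \<Omega> is zero, so integrals over \<Omega> extend to the whole
  space.\<close>

definition glue :: "((real^3) set \<Rightarrow> real^3 \<Rightarrow> 'b::real_normed_vector) \<Rightarrow> real^3 \<Rightarrow> 'b" where
  "glue P x = (\<Sum>T\<in>\<T>. indicator (interior T) x *\<^sub>R P T x)"

lemma sum_disjoint_indicator:
  assumes "T \<in> \<T>" "x \<in> K T" "\<And>T'. T' \<in> \<T> \<Longrightarrow> x \<in> K T' \<Longrightarrow> T' = T"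
  shows "(\<Sum>T\<in>\<T>. indicator (K T) x *\<^sub>R (f T :: 'b::real_normed_vector)) = f T"
proof -
  have "(\<Sum>T\<in>\<T>. indicator (K T) x *\<^sub>R f T) = (\<Sum>T'\<in>\<T>. if T' = T then f T else 0)"
  proof (rule sum.cong)
    fix T' assume T': "T' \<in> \<T>"
    show "indicator (K T') x *\<^sub>R f T' = (if T' = T then f T else 0)"
    proof (cases "T' = T")
      case False
      then have "x \<notin> K T'" using assms(3)[OF T'] by blast
      then show ?thesis using False by simp
    qed (use assms(2) in simp)
  qed simp
  then show ?thesis using assms(1) finite_mesh by simp
qed

lemma glue_eq: "T \<in> \<T> \<Longrightarrow> x \<in> interior T \<Longrightarrow> glue P x = P T x"
  unfolding glue_def using disjoint_interiors by (intro sum_disjoint_indicator) auto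

lemma glue_outside: "x \<notin> \<Omega> \<Longrightarrow> glue P x = 0"
  unfolding glue_def using interior_subset_domain by (intro sum.neutral) (auto simp: indicator_def)

lemma glue_borel:
  fixes P :: "(real^3) set \<Rightarrow> real^3 \<Rightarrow> 'b::euclidean_space"
  assumes "\<And>T. T \<in> \<T> \<Longrightarrow> continuous_on UNIV (P T)"
  shows "glue P \<in> borel_measurable borel"
  unfolding glue_def[abs_def] using assms
  by (intro borel_measurable_sum borel_measurable_scaleR borel_measurable_indicator
      borel_measurable_continuous_onI) auto

lemma glue_bounded:
  fixes P :: "(real^3) set \<Rightarrow> real^3 \<Rightarrow> 'b::euclidean_space"
  assumes "\<And>T. T \<in> \<T> \<Longrightarrow> continuous_on UNIV (P T)"
  obtains M where "M \<ge> 0" "\<And>x. norm (glue P x) \<le> M"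
proof -
  have "\<exists>B. \<forall>x\<in>T. norm (P T x) \<le> B" if T: "T \<in> \<T>" for T
  proof -
    have "compact (P T ` T)"
      by (intro compact_continuous_image mesh_compact T continuous_on_subset[OF assms[OF T]]) auto
    then show ?thesis using compact_imp_bounded[of "P T ` T"] unfolding bounded_iff by auto
  qed
  then obtain B where B: "\<And>T x. T \<in> \<T> \<Longrightarrow> x \<in> T \<Longrightarrow> norm (P T x) \<le> B T" by metis
  have le: "norm (indicator (interior T) x *\<^sub>R P T x) \<le> \<bar>B T\<bar>" if "T \<in> \<T>" for T x
    using B[OF that, of x] interior_subset[of T] by (auto simp: indicator_def)
  show thesis
  proof
    show "0 \<le> (\<Sum>T\<in>\<T>. \<bar>B T\<bar>)" by (simp add: sum_nonneg)
    show "norm (glue P x) \<le> (\<Sum>T\<in>\<T>. \<bar>B T\<bar>)" for x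
      unfolding glue_def by (rule sum_norm_le) (rule le)
  qed
qed

lemma AE_eq_glue:
  assumes "\<And>T. T \<in> \<T> \<Longrightarrow> AE x in lebesgue_on (interior T). v x = P T x"
  shows "AE x in lebesgue_on \<Omega>. v x = glue P x"
proof (rule AE_domainI)
  fix T assume T: "T \<in> \<T>"
  have "AE x in lebesgue_on (interior T). x \<in> interior T" by (rule AE_I2) simp
  with assms[OF T] show "AE x in lebesgue_on (interior T). v x = glue P x"
    by eventually_elim (simp add: glue_eq[OF T])
qed

lemma glue_L2:
  fixes P :: "(real^3) set \<Rightarrow> real^3 \<Rightarrow> 'b::euclidean_space"
  assumes "\<And>T. T \<in> \<T> \<Longrightarrow> continuous_on UNIV (P T)"
  shows "glue P \<in> L2 \<Omega>"
proof -
  obtain M where M: "\<And>x. norm (glue P x) \<le> M" using glue_bounded[of P] assms by blast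
  show ?thesis by (rule bounded_on_L2[OF dom borel_imp_lebesgue_on[OF glue_borel[OF assms]] M])
qed

text \<open>The limit of \<open>interior T\<close> under magnification at \<open>x\<close>.\<close>

definition cone_at :: "real^3 \<Rightarrow> (real^3) set \<Rightarrow> (real^3) set" where
  "cone_at x T = {y. \<forall>\<^sub>F r in at_right 0. x + r *\<^sub>R y \<in> interior T}"

lemma cone_at_outside:
  assumes "T \<in> \<T>" "x \<notin> T"
  shows "cone_at x T = {}"
proof -
  have op: "open (- T)" using mesh_compact[OF assms(1)] by (simp add: compact_imp_closed open_Compl)
  have "\<forall>\<^sub>F r in at_right 0. x + r *\<^sub>R y \<in> - T" for y
  proof -
    have "((\<lambda>r. x + r *\<^sub>R y) \<longlongrightarrow> x + 0 *\<^sub>R y) (at_right 0)" by (intro tendsto_intros)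
    then show ?thesis using op assms(2) by (intro topological_tendstoD) auto
  qed
  then have out: "\<forall>\<^sub>F r in at_right 0. x + r *\<^sub>R y \<notin> interior T" for y
    by (rule eventually_mono) (use interior_subset in blast)
  have False if "\<forall>\<^sub>F r in at_right 0. x + r *\<^sub>R y \<in> interior T" for y
    using eventually_happens[OF eventually_conj[OF that out]] by auto
  then show ?thesis unfolding cone_at_def by blast
qed

lemma cone_at_scaled:
  assumes T: "T \<in> \<T>" and x: "x \<in> T" and y: "0 < r" "x + r *\<^sub>R y \<in> interior T"
  shows "y \<in> cone_at x T"
proof -
  have "x + s *\<^sub>R y \<in> interior T" if s: "0 < s" "s < r" for s
  proof -
    have "x - (s / r) *\<^sub>R (x - (x + r *\<^sub>R y)) \<in> interior T"
      by (rule mem_interior_convex_shrink[OF mesh_convex[OF T] y(2) x])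
        (use s y(1) in \<open>auto simp: field_simps\<close>)
    moreover have "x - (s / r) *\<^sub>R (x - (x + r *\<^sub>R y)) = x + s *\<^sub>R y"
      using y(1) by simp
    ultimately show ?thesis by (simp only:)
  qed
  then show ?thesis
    unfolding cone_at_def mem_Collect_eq eventually_at_right_field using y(1) by blast
qed

lemma cone_atE:
  assumes "y \<in> cone_at x T" "b > 0"
  obtains r where "0 < r" "r < b" "x + r *\<^sub>R y \<in> interior T"
proof -
  obtain c where c: "c > 0" "\<And>r. 0 < r \<Longrightarrow> r < c \<Longrightarrow> x + r *\<^sub>R y \<in> interior T"
    using assms(1) unfolding cone_at_def mem_Collect_eq eventually_at_right_field by auto
  show thesis by (rule that[of "min b c / 2"]) (use c assms(2) in auto)
qed

lemma open_cone_at: "T \<in> \<T> \<Longrightarrow> open (cone_at x T)"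
proof (cases "x \<in> T")
  case False
  then show "T \<in> \<T> \<Longrightarrow> open (cone_at x T)" by (simp add: cone_at_outside)
next
  case True
  assume T: "T \<in> \<T>"
  have "cone_at x T = (\<Union>r\<in>{0<..}. (\<lambda>y. x + r *\<^sub>R y) -` interior T)"
  proof (intro equalityI subsetI)
    fix y assume "y \<in> cone_at x T"
    then obtain r where "0 < r" "r < 1" "x + r *\<^sub>R y \<in> interior T" by (rule cone_atE[of _ _ _ 1]) simp
    then show "y \<in> (\<Union>r\<in>{0<..}. (\<lambda>y. x + r *\<^sub>R y) -` interior T)" by auto
  next
    fix y assume "y \<in> (\<Union>r\<in>{0<..}. (\<lambda>y. x + r *\<^sub>R y) -` interior T)"
    then obtain r where "0 < r" "x + r *\<^sub>R y \<in> interior T" by auto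
    then show "y \<in> cone_at x T" by (rule cone_at_scaled[OF T True])
  qed
  moreover have "open ((\<lambda>y. x + r *\<^sub>R y) -` interior T)" for r
    by (intro open_vimage continuous_intros) auto
  ultimately show ?thesis by auto
qed

lemma cone_at_nonempty:
  assumes "T \<in> \<T>" "x \<in> T"
  shows "cone_at x T \<noteq> {}"
proof -
  obtain z where "z \<in> interior T" using mesh_interior[OF assms(1)] by blast
  then have "z - x \<in> cone_at x T" by (intro cone_at_scaled[OF assms, of 1]) auto
  then show ?thesis by blast
qed

lemma disjoint_cones:
  assumes "T \<in> \<T>" "T' \<in> \<T>" "y \<in> cone_at x T" "y \<in> cone_at x T'"
  shows "T = T'"
proof -
  have "\<forall>\<^sub>F r in at_right (0::real). x + r *\<^sub>R y \<in> interior T \<and> x + r *\<^sub>R y \<in> interior T'"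
    using assms(3,4) by (auto simp: cone_at_def intro: eventually_conj)
  then obtain r where "x + r *\<^sub>R y \<in> interior T" "x + r *\<^sub>R y \<in> interior T'"
    using eventually_happens[of _ "at_right (0::real)"] by auto
  then show ?thesis using disjoint_interiors assms by blast
qed

text \<open>If all points near \<open>x\<close> were in \<open>closure \<Omega>\<close>, then
  \<open>x\<close> would lie in \<open>interior (closure \<Omega>) = \<Omega>\<close>. So there are
  exterior points arbitrarily close to \<open>x\<close>; since the elements are conic near
  \<open>x\<close>, the directions to exterior points in a small ball avoid every cone.\<close>

lemma exterior_cone:
  assumes x: "x \<in> frontier \<Omega>"
  obtains E where "open E" "E \<noteq> {}" "\<And>T. T \<in> \<T> \<Longrightarrow> E \<inter> cone_at x T = {}"
proof -
  have "\<exists>\<epsilon>>0. \<forall>z s. z \<in> ball x \<epsilon> \<longrightarrow> 0 < s \<longrightarrow> s \<le> 1 \<longrightarrow> x + s *\<^sub>R (z - x) \<in> T \<longrightarrow> z \<in> T"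
    if "T \<in> \<T>" "x \<in> T" for T
  proof -
    have "polyhedron T" using mesh_simplex[OF that(1)] by (meson simplex_imp_polyhedron)
    then show ?thesis using that(2) polyhedron_locally_conic by metis
  qed
  then obtain \<epsilon> where \<epsilon>: "\<And>T. T \<in> \<T> \<Longrightarrow> x \<in> T \<Longrightarrow> \<epsilon> T > (0::real)"
    "\<And>T z s. T \<in> \<T> \<Longrightarrow> x \<in> T \<Longrightarrow> z \<in> ball x (\<epsilon> T) \<Longrightarrow> 0 < s \<Longrightarrow> s \<le> 1 \<Longrightarrow> x + s *\<^sub>R (z - x) \<in> T \<Longrightarrow> z \<in> T"
    by metis
  define e where "e = Min (insert 1 (\<epsilon> ` {T\<in>\<T>. x \<in> T}))"
  have e: "e > 0" "\<And>T. T \<in> \<T> \<Longrightarrow> x \<in> T \<Longrightarrow> e \<le> \<epsilon> T"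
    using finite_mesh \<epsilon>(1) by (auto simp: e_def)
  have "\<Omega> = interior (closure \<Omega>)" using domain by (simp add: polyhedral_domain_def)
  then have "x \<notin> interior (closure \<Omega>)" using x open_domain by (metis DiffE frontier_def interior_open)
  then have "\<not> ball x e \<subseteq> closure \<Omega>" using e(1) by (meson centre_in_ball interior_maximal open_ball subsetD)
  then obtain z where z: "z \<in> ball x e" "z \<notin> closure \<Omega>" by blast
  define E where "E = (\<lambda>y. x + y) -` (ball x e - closure \<Omega>)"
  show thesis
  proof
    show "open E" unfolding E_def by (intro open_vimage open_Diff continuous_intros) auto
    have "z - x \<in> E" using z by (simp add: E_def)
    then show "E \<noteq> {}" by blast
    show "E \<inter> cone_at x T = {}" if T: "T \<in> \<T>" for T
    proof (cases "x \<in> T")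
      case True
      have False if y: "y \<in> E" "y \<in> cone_at x T" for y
      proof -
        obtain r where r: "0 < r" "r < 1" "x + r *\<^sub>R y \<in> interior T"
          using y(2) by (rule cone_atE[of _ _ _ 1]) auto
        have "x + y \<in> ball x (\<epsilon> T)" using y(1) e(2)[OF T True] by (auto simp: E_def)
        then have "x + y \<in> T"
        proof (rule \<epsilon>(2)[OF T True])
          show "x + r *\<^sub>R (x + y - x) \<in> T" using r(3) interior_subset[of T] by auto
        qed (use r in auto)
        then show False using y(1) T by (auto simp: E_def mesh_Union)
      qed
      then show ?thesis by blast
    qed (simp add: cone_at_outside[OF T])
  qed
qed

text \<open>Weak derivative zero makes the integral against a bump function invariant under translations,
  and the bump can be translated into the exterior cone.\<close>

lemma cone_function_eq_0:
  assumes x: "x \<in> frontier \<Omega>" and T: "T \<in> \<T>" "x \<in> T"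
    and zero: "\<And>\<phi> i. \<phi> \<in> test UNIV \<Longrightarrow>
      (\<integral>y. (\<Sum>T\<in>\<T>. indicator (cone_at x T) y *\<^sub>R \<alpha> T) * pd i \<phi> y \<partial>lborel) = 0"
  shows "\<alpha> T = (0::real)"
proof -
  define f where "f y = (\<Sum>T\<in>\<T>. indicator (cone_at x T) y *\<^sub>R \<alpha> T)" for y
  have fm: "f \<in> borel_measurable borel"
    unfolding f_def[abs_def] using open_cone_at
    by (intro borel_measurable_sum borel_measurable_scaleR borel_measurable_indicator) auto
  have fb: "\<bar>f y\<bar> \<le> (\<Sum>T\<in>\<T>. \<bar>\<alpha> T\<bar>)" for y
    unfolding f_def by (rule order_trans[OF sum_abs]) (auto intro!: sum_mono simp: indicator_def)
  have fT: "f y = \<alpha> T" if "y \<in> cone_at x T" for y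
    unfolding f_def using T that disjoint_cones by (intro sum_disjoint_indicator) auto
  obtain E where E: "open E" "E \<noteq> {}" "\<And>T. T \<in> \<T> \<Longrightarrow> E \<inter> cone_at x T = {}"
    using exterior_cone[OF x] by blast
  have f0: "f y = 0" if "y \<in> E" for y
    unfolding f_def using E(3) that by (intro sum.neutral) (auto simp: indicator_def)
  obtain z where z: "z \<in> E" using E by blast
  obtain c where c: "c \<in> cone_at x T" using cone_at_nonempty[OF T] by blast
  obtain d where d: "d > 0" "cball z d \<subseteq> E" using E(1) z open_contains_cball by blast
  obtain d' where d': "d' > 0" "cball c d' \<subseteq> cone_at x T"
    using open_cone_at[OF T(1)] c open_contains_cball by blast
  \<comment> \<open>Half the side of a cube whose half diagonal is \<open>min d d'\<close>: it fits
    into the ball around \<open>c\<close> and, after translation, into the ball around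
    \<open>z\<close>.\<close>
  define \<delta> where "\<delta> = min d d' / norm (One :: real^3)"
  have One: "norm (One :: real^3) > 0" by simp
  have \<delta>: "\<delta> > 0" unfolding \<delta>_def using d d' One by (intro divide_pos_pos) auto
  let ?\<phi> = "bump (c - \<delta> *\<^sub>R One) (c + \<delta> *\<^sub>R One) 1"
  have box: "norm (y - c) \<le> min d d'" if "y \<in> box (c - \<delta> *\<^sub>R One) (c + \<delta> *\<^sub>R One)" for y
  proof -
    have "norm (y - c) \<le> norm (\<delta> *\<^sub>R (One :: real^3))"
      by (rule norm_le_componentwise) (use that \<delta> in \<open>auto simp: mem_box inner_simps abs_le_iff less_imp_le\<close>)
    also have "\<dots> = min d d'" using \<delta> d d' by (simp add: \<delta>_def)
    finally show ?thesis .
  qed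
  have \<phi>: "?\<phi> \<in> test UNIV" by (intro bump_test) auto
  have "(\<integral>y. f y * ?\<phi> y \<partial>lborel) = (\<integral>y. \<alpha> T * ?\<phi> y \<partial>lborel)"
  proof (rule Bochner_Integration.integral_cong)
    show "f y * ?\<phi> y = \<alpha> T * ?\<phi> y" for y
    proof (cases "y \<in> box (c - \<delta> *\<^sub>R One) (c + \<delta> *\<^sub>R One)")
      case True
      then have "y \<in> cball c d'" using box[OF True] by (simp add: dist_norm norm_minus_commute)
      then show ?thesis using d'(2) fT by auto
    qed (simp add: bump_eq_0)
  qed simp
  \<comment> \<open>This translate of the bump lives near \<open>z\<close>, in the exterior cone,
    where \<open>f\<close> vanishes.\<close>
  moreover have "(\<integral>y. f y * ?\<phi> (y + (c - z)) \<partial>lborel) = 0"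
  proof -
    have "f y * ?\<phi> (y + (c - z)) = 0" for y
    proof (cases "y + (c - z) \<in> box (c - \<delta> *\<^sub>R One) (c + \<delta> *\<^sub>R One)")
      case True
      then have "y \<in> cball z d" using box[OF True] by (simp add: dist_norm norm_minus_commute)
      then show ?thesis using d(2) f0 by auto
    qed (simp add: bump_eq_0)
    then show ?thesis by (simp only: Bochner_Integration.integral_zero)
  qed
  moreover have "(\<integral>y. f y * ?\<phi> (y + (c - z)) \<partial>lborel) = (\<integral>y. f y * ?\<phi> y \<partial>lborel)"
    by (rule integral_const_along_translations[OF fm fb zero[folded f_def] \<phi>])
  ultimately have "\<alpha> T * (\<integral>y. ?\<phi> y \<partial>lborel) = 0" by simp
  moreover have "(\<integral>y. ?\<phi> y \<partial>lborel) \<noteq> 0"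
  proof
    assume "(\<integral>y. ?\<phi> y \<partial>lborel) = 0"
    then have "AE y in lborel. ?\<phi> y = 0"
      using integral_nonneg_eq_0_iff_AE[OF test_integrable[OF \<phi>]] bump_bounds by simp
    then have "AE y in lebesgue. y \<in> box (c - \<delta> *\<^sub>R One) (c + \<delta> *\<^sub>R One) \<longrightarrow> ?\<phi> y = 0"
      by (intro AE_completion) auto
    moreover have cb: "c \<in> box (c - \<delta> *\<^sub>R One) (c + \<delta> *\<^sub>R One)" using \<delta> by (simp add: mem_box inner_simps)
    ultimately have "?\<phi> c = 0"
      by (intro continuous_AE_eq_on_open[where f = ?\<phi> and g = "\<lambda>_. 0"]) (auto intro: smooth_continuous_on bump_smooth)
    then show False using bump_pos[OF _ cb, of 1] by simp
  qed
  ultimately show ?thesis by simp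
qed

end

lemma lborel_integral_affine:
  fixes f :: "real^3 \<Rightarrow> real"
  assumes "f \<in> borel_measurable borel" "r > 0"
  shows "(\<integral>x. f x \<partial>lborel) = r ^ 3 * (\<integral>y. f (x + r *\<^sub>R y) \<partial>lborel)"
proof -
  have "(\<integral>x. f x \<partial>lborel) = (\<integral>z. f z \<partial>density (distr lborel borel (\<lambda>y. x + r *\<^sub>R y)) (\<lambda>_. ennreal (\<bar>r\<bar> ^ DIM(real^3))))"
    using lborel_affine[of r x] assms(2) by simp
  also have "\<dots> = (\<integral>y. r ^ 3 * f (x + r *\<^sub>R y) \<partial>lborel)"
    using assms by (simp add: integral_density integral_distr)
  finally show ?thesis by simp
qed

section \<open>Magnification at a boundary point and boundary values\<close>

context meshed_domain
begin

text \<open>By convexity the ray is eventually inside or eventually outside, so the sequence is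
  eventually constant and converges at every \<open>y\<close>.\<close>

lemma ray_indicator_tendsto:
  assumes "T \<in> \<T>" "r \<longlonglongrightarrow> 0" "\<And>n. r n > 0"
  shows "(\<lambda>n. indicat_real (interior T) (x + r n *\<^sub>R y)) \<longlonglongrightarrow> indicator (cone_at x T) y"
proof -
  have lim: "filterlim r (at_right 0) sequentially"
    using assms(2,3) by (auto simp: filterlim_at less_imp_neq[THEN not_sym] intro!: always_eventually)
  have "convex (interior T)" by (intro convex_interior mesh_convex assms)
  from ray_eventually_convex[OF this, of x y] show ?thesis
  proof
    assume ev: "\<forall>\<^sub>F r in at_right 0. x + r *\<^sub>R y \<in> interior T"
    then have "\<forall>\<^sub>F n in sequentially. 1 = indicat_real (interior T) (x + r n *\<^sub>R y)"
      using filterlim_iff[THEN iffD1, OF lim] by (auto elim!: eventually_mono)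
    then have "(\<lambda>n. indicat_real (interior T) (x + r n *\<^sub>R y)) \<longlonglongrightarrow> 1"
      by (rule Lim_transform_eventually[OF tendsto_const])
    then show ?thesis using ev by (simp add: cone_at_def)
  next
    assume ev: "\<forall>\<^sub>F r in at_right 0. x + r *\<^sub>R y \<notin> interior T"
    then have "\<forall>\<^sub>F n in sequentially. 0 = indicat_real (interior T) (x + r n *\<^sub>R y)"
      using filterlim_iff[THEN iffD1, OF lim] by (auto elim!: eventually_mono)
    then have "(\<lambda>n. indicat_real (interior T) (x + r n *\<^sub>R y)) \<longlonglongrightarrow> 0"
      by (rule Lim_transform_eventually[OF tendsto_const])
    moreover have "y \<notin> cone_at x T"
      using eventually_happens[OF eventually_conj[OF ev]] by (auto simp: cone_at_def)
    ultimately show ?thesis by simp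
  qed
qed

text \<open>Magnifying a field with bounded weak divergence at \<open>x\<close> multiplies its divergence by the
  vanishing length scale, so the limit, which is constant on each cone, is divergence free.\<close>

lemma blow_up_divergence_free:
  fixes P :: "(real^3) set \<Rightarrow> real^3 \<Rightarrow> real^3"
  assumes P: "\<And>T i. T \<in> \<T> \<Longrightarrow> smooth (component i (P T))"
    and UP: "\<And>T. T \<in> \<T> \<Longrightarrow> AE x in lebesgue_on (interior T). U x = P T x"
    and L: "U \<in> L2 \<Omega>" "H \<in> L2 \<Omega>"
    and eq: "\<And>\<phi>. \<phi> \<in> test UNIV \<Longrightarrow> (\<integral>x. U x \<bullet> grad \<phi> x \<partial>lebesgue_on \<Omega>) = (\<integral>x. H x * \<phi> x \<partial>lebesgue_on \<Omega>)"
    and \<phi>: "\<phi> \<in> test UNIV"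
  shows "(\<integral>y. (\<Sum>T\<in>\<T>. indicator (cone_at x T) y *\<^sub>R P T x) \<bullet> grad \<phi> y \<partial>lborel) = 0"
proof -
  define D where "D T x = - (\<Sum>i\<in>UNIV. pd i (component i (P T)) x)" for T x
  have contP: "continuous_on UNIV (P T)" if "T \<in> \<T>" for T
    using smooth_continuous_on[OF P[OF that]]
    by (subst continuous_on_componentwise) (auto simp: Basis_vec_def inner_axis component_def[abs_def])
  have contD: "continuous_on UNIV (D T)" if "T \<in> \<T>" for T
    unfolding D_def[abs_def]
    by (intro continuous_on_minus continuous_on_sum smooth_continuous_on smooth_pd P that)
  have HD: "AE x in lebesgue_on (interior T). H x = D T x" if T: "T \<in> \<T>" for T
    unfolding D_def
    by (rule local_weak_divergence[OF dom open_interior interior_subset_domain[OF T] L])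
       (auto intro: eq test_mono P T UP)
  define u where "u = glue P"
  define h where "h = glue D"
  have um: "u \<in> borel_measurable borel" and hm: "h \<in> borel_measurable borel"
    unfolding u_def h_def by (intro glue_borel contP contD; assumption)+
  obtain M where M: "M \<ge> 0" "\<And>x. norm (u x) \<le> M"
    using glue_bounded[of P] contP unfolding u_def by blast
  obtain N where N: "N \<ge> 0" "\<And>x. norm (h x) \<le> N"
    using glue_bounded[of D] contD unfolding h_def by blast
  have Uu: "AE x in lebesgue_on \<Omega>. U x = u x" and Hh: "AE x in lebesgue_on \<Omega>. H x = h x"
    unfolding u_def h_def by (intro AE_eq_glue UP HD; assumption)+
  have uL: "u \<in> L2 \<Omega>" and hL: "h \<in> L2 \<Omega>"
    unfolding u_def h_def by (intro glue_L2 contP contD; assumption)+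
  have domL: "\<Omega> \<in> sets lebesgue" using open_domain by simp
  \<comment> \<open>The glued representatives vanish outside \<Omega>, so the identity can be read
    on the whole space, where affine substitution is available.\<close>
  have eq': "(\<integral>x. u x \<bullet> grad \<psi> x \<partial>lborel) = (\<integral>x. h x * \<psi> x \<partial>lborel)" if \<psi>: "\<psi> \<in> test UNIV" for \<psi>
  proof -
    have gm: "grad \<psi> \<in> borel_measurable borel" and \<psi>m: "\<psi> \<in> borel_measurable borel"
      by (intro grad_borel_measurable smooth_borel test_smooth[OF \<psi>])+
    have [measurable]: "grad \<psi> \<in> borel_measurable (lebesgue_on \<Omega>)" "u \<in> borel_measurable (lebesgue_on \<Omega>)"
      "U \<in> borel_measurable (lebesgue_on \<Omega>)"
      using gm L2_measurable[OF uL] L2_measurable[OF L(1)] by (auto intro: borel_imp_lebesgue_on)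
    have "(\<integral>x. u x \<bullet> grad \<psi> x \<partial>lborel) = (\<integral>x. u x \<bullet> grad \<psi> x \<partial>lebesgue_on \<Omega>)"
      using um gm domL by (intro integral_lebesgue_on_eq_lborel[symmetric]) (auto simp: u_def glue_outside)
    also have "\<dots> = (\<integral>x. U x \<bullet> grad \<psi> x \<partial>lebesgue_on \<Omega>)"
      using Uu by (intro integral_cong_AE) auto
    also have "\<dots> = (\<integral>x. H x * \<psi> x \<partial>lebesgue_on \<Omega>)" by (rule eq[OF \<psi>])
    also have "\<dots> = (\<integral>x. h x * \<psi> x \<partial>lebesgue_on \<Omega>)" by (rule integral_cong_AE_test[OF L(2) hL Hh \<psi>])
    also have "\<dots> = (\<integral>x. h x * \<psi> x \<partial>lborel)"
      using hm \<psi>m domL by (intro integral_lebesgue_on_eq_lborel) (auto simp: h_def glue_outside)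
    finally show ?thesis .
  qed
  obtain K R where b: "K \<ge> 0" "\<And>x. \<bar>\<phi> x\<bar> \<le> K" "\<And>x. norm (grad \<phi> x) \<le> K"
      "\<And>x. norm x \<ge> R \<Longrightarrow> \<phi> x = 0" "\<And>x. norm x \<ge> R \<Longrightarrow> grad \<phi> x = 0"
    using \<phi> by (rule test_bounds) blast
  have \<phi>m[measurable]: "\<phi> \<in> borel_measurable borel" and gm[measurable]: "grad \<phi> \<in> borel_measurable borel"
    by (intro smooth_borel grad_borel_measurable test_smooth[OF \<phi>])+
  note [measurable] = um hm
  have scaled: "(\<integral>y. u (x + r *\<^sub>R y) \<bullet> grad \<phi> y \<partial>lborel) = r * (\<integral>y. h (x + r *\<^sub>R y) * \<phi> y \<partial>lborel)"
    if r: "r > 0" for r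
  proof -
    \<comment> \<open>The pullback with \<open>\<psi> (x + r *\<^sub>R y) = \<phi> y\<close>. Its
      gradient carries the factor 1 / r while the Jacobian occurs on both sides and cancels; this
      leaves the factor \<open>r\<close> in front of the divergence term.\<close>
    define \<psi> where "\<psi> = (\<lambda>z. \<phi> (- (1 / r) *\<^sub>R x + (1 / r) *\<^sub>R z))"
    have \<psi>: "\<psi> \<in> test UNIV" unfolding \<psi>_def using r by (intro test_affine \<phi>) auto
    have g: "grad \<psi> z = (1 / r) *\<^sub>R grad \<phi> (- (1 / r) *\<^sub>R x + (1 / r) *\<^sub>R z)" for z
    proof -
      have "pd i \<psi> = (\<lambda>z. (1 / r) * pd i \<phi> (- (1 / r) *\<^sub>R x + (1 / r) *\<^sub>R z))" for i
        unfolding \<psi>_def by (rule smooth_affine(2)[OF test_smooth[OF \<phi>]])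
      then show ?thesis by (simp only: vec_eq_iff grad_nth vector_scaleR_component real_scaleR_def) simp
    qed
    have inv: "- (1 / r) *\<^sub>R x + (1 / r) *\<^sub>R (x + r *\<^sub>R y) = y" for y
      using r by (simp add: algebra_simps)
    have gm': "grad \<psi> \<in> borel_measurable borel" and \<psi>m': "\<psi> \<in> borel_measurable borel"
      by (intro grad_borel_measurable smooth_borel test_smooth[OF \<psi>])+
    have "r ^ 3 * (\<integral>y. u (x + r *\<^sub>R y) \<bullet> grad \<psi> (x + r *\<^sub>R y) \<partial>lborel) =
        r ^ 3 * (\<integral>y. h (x + r *\<^sub>R y) * \<psi> (x + r *\<^sub>R y) \<partial>lborel)"
      using eq'[OF \<psi>] lborel_integral_affine[OF _ r, of "\<lambda>z. u z \<bullet> grad \<psi> z" x]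
        lborel_integral_affine[OF _ r, of "\<lambda>z. h z * \<psi> z" x] um hm gm' \<psi>m' by simp
    then have "(\<integral>y. u (x + r *\<^sub>R y) \<bullet> grad \<psi> (x + r *\<^sub>R y) \<partial>lborel) =
        (\<integral>y. h (x + r *\<^sub>R y) * \<psi> (x + r *\<^sub>R y) \<partial>lborel)"
      using r by simp
    then have "(1 / r) * (\<integral>y. u (x + r *\<^sub>R y) \<bullet> grad \<phi> y \<partial>lborel) = (\<integral>y. h (x + r *\<^sub>R y) * \<phi> y \<partial>lborel)"
      unfolding g unfolding \<psi>_def inv by simp
    then show ?thesis using r by (simp add: field_simps)
  qed
  define r where "r n = inverse (real (Suc n))" for n
  have r: "r \<longlonglongrightarrow> 0" "\<And>n. r n > 0"
    unfolding r_def by (rule LIMSEQ_inverse_real_of_nat) simp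
  let ?u0 = "\<lambda>y. \<Sum>T\<in>\<T>. indicator (cone_at x T) y *\<^sub>R P T x"
  have "(\<lambda>n. \<integral>y. u (x + r n *\<^sub>R y) \<bullet> grad \<phi> y \<partial>lborel) \<longlonglongrightarrow> (\<integral>y. ?u0 y \<bullet> grad \<phi> y \<partial>lborel)"
  proof (rule integral_dominated_convergence)
    have [measurable]: "cone_at x T \<in> sets borel" if "T \<in> \<T>" for T
      by (intro borel_open open_cone_at that)
    have [measurable]: "?u0 \<in> borel_measurable borel"
      by (intro borel_measurable_sum borel_measurable_scaleR borel_measurable_indicator) auto
    show "(\<lambda>y. ?u0 y \<bullet> grad \<phi> y) \<in> borel_measurable lborel" by measurable
    show "(\<lambda>y. u (x + r n *\<^sub>R y) \<bullet> grad \<phi> y) \<in> borel_measurable lborel" for n by measurable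
    show "integrable lborel (\<lambda>y. (M * K) * indicator (cball (0::real^3) R) y)"
      using emeasure_lborel_cball_finite[of "0::real^3" R]
      by (intro integrable_mult_right integrable_real_indicator) auto
    show "AE y in lborel. (\<lambda>n. u (x + r n *\<^sub>R y) \<bullet> grad \<phi> y) \<longlonglongrightarrow> ?u0 y \<bullet> grad \<phi> y"
    proof (rule AE_I2)
      fix y
      have "(\<lambda>n. P T (x + r n *\<^sub>R y)) \<longlonglongrightarrow> P T x" if "T \<in> \<T>" for T
      proof -
        have "(\<lambda>n. x + r n *\<^sub>R y) \<longlonglongrightarrow> x + 0 *\<^sub>R y" by (intro tendsto_intros r)
        then have "(\<lambda>n. x + r n *\<^sub>R y) \<longlonglongrightarrow> x" by simp
        then show ?thesis by (rule continuous_on_tendsto_compose[OF contP[OF that]]) auto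
      qed
      then show "(\<lambda>n. u (x + r n *\<^sub>R y) \<bullet> grad \<phi> y) \<longlonglongrightarrow> ?u0 y \<bullet> grad \<phi> y"
        unfolding u_def glue_def
        by (intro tendsto_inner tendsto_sum tendsto_scaleR tendsto_const ray_indicator_tendsto r)
    qed
    show "AE y in lborel. norm (u (x + r n *\<^sub>R y) \<bullet> grad \<phi> y) \<le> (M * K) * indicator (cball (0::real^3) R) y" for n
    proof (rule AE_I2)
      fix y
      have "\<bar>u (x + r n *\<^sub>R y) \<bullet> grad \<phi> y\<bar> \<le> norm (u (x + r n *\<^sub>R y)) * norm (grad \<phi> y)"
        by (rule Cauchy_Schwarz_ineq2)
      also have "\<dots> \<le> M * K" by (intro mult_mono M b) auto
      finally show "norm (u (x + r n *\<^sub>R y) \<bullet> grad \<phi> y) \<le> (M * K) * indicator (cball (0::real^3) R) y"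
        using b(5)[of y] by (auto simp: indicator_def not_le dest: less_imp_le)
    qed
  qed
  moreover have "(\<lambda>n. \<integral>y. u (x + r n *\<^sub>R y) \<bullet> grad \<phi> y \<partial>lborel) \<longlonglongrightarrow> 0"
  proof (rule Lim_null_comparison)
    show "\<forall>\<^sub>F n in sequentially. norm (\<integral>y. u (x + r n *\<^sub>R y) \<bullet> grad \<phi> y \<partial>lborel) \<le> r n * (N * (\<integral>y. \<bar>\<phi> y\<bar> \<partial>lborel))"
    proof (intro always_eventually allI)
      fix n
      have "\<bar>\<integral>y. h (x + r n *\<^sub>R y) * \<phi> y \<partial>lborel\<bar> \<le> (\<integral>y. \<bar>h (x + r n *\<^sub>R y) * \<phi> y\<bar> \<partial>lborel)"
        by (rule integral_abs_bound)
      also have "\<dots> \<le> (\<integral>y. N * \<bar>\<phi> y\<bar> \<partial>lborel)"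
      proof (rule Bochner_Integration.integral_mono)
        show 1: "integrable lborel (\<lambda>y. N * \<bar>\<phi> y\<bar>)" using test_integrable[OF \<phi>] by simp
        show le: "\<bar>h (x + r n *\<^sub>R y) * \<phi> y\<bar> \<le> N * \<bar>\<phi> y\<bar>" for y
          unfolding abs_mult using N(2)[of "x + r n *\<^sub>R y"] by (intro mult_right_mono) auto
        show "integrable lborel (\<lambda>y. \<bar>h (x + r n *\<^sub>R y) * \<phi> y\<bar>)"
          by (rule Bochner_Integration.integrable_bound[OF 1]) (use le in \<open>auto intro: order_trans[OF _ abs_ge_self]\<close>)
      qed
      finally show "norm (\<integral>y. u (x + r n *\<^sub>R y) \<bullet> grad \<phi> y \<partial>lborel) \<le> r n * (N * (\<integral>y. \<bar>\<phi> y\<bar> \<partial>lborel))"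
        using r(2)[of n] by (simp add: scaled abs_mult)
    qed
    show "(\<lambda>n. r n * (N * (\<integral>y. \<bar>\<phi> y\<bar> \<partial>lborel))) \<longlonglongrightarrow> 0"
      using tendsto_mult_left_zero[OF r(1)] by simp
  qed
  ultimately show ?thesis by (rule LIMSEQ_unique)
qed

text \<open>For each \<open>i\<close> the field \<open>u x *\<^sub>R axis i 1\<close>, extended by
  zero, has weak divergence \<open>g x $ i\<close>. Magnifying all three shows that the cone
  function with values \<open>p T x\<close> has weak gradient zero.\<close>

lemma H01_boundary_value:
  assumes u: "u \<in> H01 \<Omega>" and p: "\<And>T. T \<in> \<T> \<Longrightarrow> real_polynomial_function (p T)"
    and up: "\<And>T. T \<in> \<T> \<Longrightarrow> AE x in lebesgue_on T. u x = p T x"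
    and x: "x \<in> frontier \<Omega>" and T: "T \<in> \<T>" "x \<in> T"
  shows "p T x = 0"
proof (rule cone_function_eq_0[OF x T])
  obtain g where g: "has_weak_grad \<Omega> u g"
    "\<And>\<phi> i. \<phi> \<in> test UNIV \<Longrightarrow>
      (\<integral>x. u x * pd i \<phi> x \<partial>lebesgue_on \<Omega>) = - (\<integral>x. g x $ i * \<phi> x \<partial>lebesgue_on \<Omega>)"
    using H01_extension[OF dom u] by blast
  have L: "u \<in> L2 \<Omega>" "g \<in> L2 \<Omega>" using g(1) by (auto simp: has_weak_grad_def)
  fix \<phi> :: "real^3 \<Rightarrow> real" and i assume \<phi>: "\<phi> \<in> test UNIV"
  have c: "component j (\<lambda>x. f x *\<^sub>R axis i 1) = (\<lambda>x. if j = i then f x else 0)" for j and f :: "real^3 \<Rightarrow> real"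
    by (auto simp: component_def axis_def)
  have "(\<integral>y. (\<Sum>T\<in>\<T>. indicator (cone_at x T) y *\<^sub>R (p T x *\<^sub>R axis i 1)) \<bullet> grad \<phi> y \<partial>lborel) = 0"
  proof (rule blow_up_divergence_free[where U = "\<lambda>x. u x *\<^sub>R axis i 1" and H = "\<lambda>x. - g x $ i" and P = "\<lambda>T x. p T x *\<^sub>R axis i 1"])
    show "smooth (component j (\<lambda>x. p T x *\<^sub>R axis i 1))" if "T \<in> \<T>" for T j
      using real_polynomial_function_smooth[OF p[OF that]] smooth_const[of 0] by (cases "j = i") (simp_all add: c)
    show "AE x in lebesgue_on (interior T). u x *\<^sub>R axis i 1 = p T x *\<^sub>R axis i 1" if "T \<in> \<T>" for T
      using AE_mesh_interior[OF that up[OF that]] by auto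
    show "(\<lambda>x. u x *\<^sub>R (axis i 1 :: real^3)) \<in> L2 \<Omega>"
      by (rule L2_bound[OF L(1)]) (use L2_measurable[OF L(1)] in \<open>auto intro!: borel_measurable_scaleR\<close>)
    show "(\<lambda>x. - g x $ i) \<in> L2 \<Omega>"
      using L2_cmult[OF L2_component[OF L(2), of i], of "-1"] by (simp add: component_def)
    show "(\<integral>x. u x *\<^sub>R axis i 1 \<bullet> grad \<psi> x \<partial>lebesgue_on \<Omega>) = (\<integral>x. - g x $ i * \<psi> x \<partial>lebesgue_on \<Omega>)"
      if "\<psi> \<in> test UNIV" for \<psi>
      using g(2)[OF that, of i] by (simp add: inner_axis')
  qed (rule \<phi>)
  then show "(\<integral>y. (\<Sum>T\<in>\<T>. indicator (cone_at x T) y *\<^sub>R p T x) * pd i \<phi> y \<partial>lborel) = 0"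
    by (simp add: inner_sum_left inner_axis' sum_distrib_right mult.assoc)
qed

text \<open>For small \<open>r\<close> the point \<open>x + (r * s) *\<^sub>R t\<close> is in
  \<open>T\<close> and \<open>x + r *\<^sub>R y\<close> in its interior; their midpoint is interior
  and lies on the ray in direction \<open>y + s *\<^sub>R t\<close>.\<close>

lemma cone_at_edge_invariant:
  assumes T: "T \<in> \<T>" and e: "\<And>s. \<bar>s\<bar> < \<delta> \<Longrightarrow> x + s *\<^sub>R t \<in> T" and "\<delta> > 0"
    and y: "y \<in> cone_at x T"
  shows "y + s *\<^sub>R t \<in> cone_at x T"
proof -
  have x: "x \<in> T" using e[of 0] \<open>\<delta> > 0\<close> by simp
  \<comment> \<open>A radius \<open>r\<close> below this bound satisfies |r s| < \<delta>; the added
    1 covers \<open>s = 0\<close>.\<close>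
  have b: "\<delta> / (2 * (\<bar>s\<bar> + 1)) > 0" using \<open>\<delta> > 0\<close> by (simp add: add_nonneg_pos)
  obtain r where r: "0 < r" "r < \<delta> / (2 * (\<bar>s\<bar> + 1))" "x + r *\<^sub>R y \<in> interior T"
    using cone_atE[OF y b] by blast
  have "\<bar>r * s\<bar> < \<delta>"
  proof -
    have "r * (2 * (\<bar>s\<bar> + 1)) < \<delta>" using r(2) by (simp add: field_simps)
    moreover have "\<bar>r * s\<bar> \<le> r * (2 * (\<bar>s\<bar> + 1))" using r(1) by (simp add: abs_mult)
    ultimately show ?thesis by linarith
  qed
  then have "x + (r * s) *\<^sub>R t \<in> T" by (rule e)
  then have "(x + (r * s) *\<^sub>R t) - (1/2) *\<^sub>R ((x + (r * s) *\<^sub>R t) - (x + r *\<^sub>R y)) \<in> interior T"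
    by (intro mem_interior_convex_shrink[OF mesh_convex[OF T] r(3)]) auto
  moreover have "(x + (r * s) *\<^sub>R t) - (1/2) *\<^sub>R ((x + (r * s) *\<^sub>R t) - (x + r *\<^sub>R y)) = x + (r / 2) *\<^sub>R (y + s *\<^sub>R t)"
    by (simp add: algebra_simps scaleR_2[symmetric] flip: scaleR_add_left)
  ultimately have "x + (r / 2) *\<^sub>R (y + s *\<^sub>R t) \<in> interior T" by (simp only:)
  then show ?thesis
    using r(1) by (intro cone_at_scaled[OF T x, of "r / 2"]) auto
qed

lemma curl_scaled_vector:
  assumes "smooth \<phi>"
  shows "curl (\<lambda>x. \<phi> x *\<^sub>R m) x = cross3 (grad \<phi> x) m"
proof -
  have "pd i (component j (\<lambda>x. \<phi> x *\<^sub>R m)) x = m $ j * pd i \<phi> x" for i j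
  proof -
    have "component j (\<lambda>x. \<phi> x *\<^sub>R m) = (\<lambda>x. m $ j * \<phi> x)" by (simp add: component_def fun_eq_iff)
    then show ?thesis using pd_cmult[OF smooth_differentiable[OF assms]] by simp
  qed
  then show ?thesis by (simp add: curl_def cross3_def mult.commute)
qed

text \<open>Only the component of the limit along the edge is controlled: with \<open>m = cross3 t c\<close>,
  the curl-free limit \<open>w\<close> satisfies \<open>cross3 m w = (t \<bullet> w) c - (c \<bullet> w) t\<close>, and the last term
  drops out since \<open>w\<close> is invariant along the edge.\<close>

lemma H0curl_boundary_edge:
  assumes v: "v \<in> H0curl \<Omega>" and P: "\<And>T i. T \<in> \<T> \<Longrightarrow> real_polynomial_function (component i (P T))"
    and vP: "\<And>T. T \<in> \<T> \<Longrightarrow> AE x in lebesgue_on T. v x = P T x"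
    and x: "x \<in> frontier \<Omega>" and T: "T \<in> \<T>" "x \<in> T"
    and \<delta>: "\<delta> > 0" and edge: "\<And>T s. T \<in> \<T> \<Longrightarrow> x \<in> T \<Longrightarrow> \<bar>s\<bar> < \<delta> \<Longrightarrow> x + s *\<^sub>R t \<in> T"
  shows "P T x \<bullet> t = 0"
proof -
  obtain w where w: "has_weak_curl \<Omega> v w"
    "\<And>\<psi>. \<psi> \<in> vtest UNIV \<Longrightarrow> (\<integral>x. v x \<bullet> curl \<psi> x \<partial>lebesgue_on \<Omega>) = (\<integral>x. w x \<bullet> \<psi> x \<partial>lebesgue_on \<Omega>)"
    using v unfolding H0curl_def by auto
  have L: "v \<in> L2 \<Omega>" "w \<in> L2 \<Omega>" using w(1) by (auto simp: has_weak_curl_def)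
  let ?K = "\<lambda>T y. indicat_real (cone_at x T) y"
  \<comment> \<open>Testing with the field \<open>\<psi> x *\<^sub>R m\<close> and permuting the
    triple product shows that \<open>cross3 m (v x)\<close>, extended by zero, has a
    square-integrable weak divergence, so it can be magnified.\<close>
  have curl0: "(\<integral>y. (\<Sum>T\<in>\<T>. ?K T y *\<^sub>R cross3 m (P T x)) \<bullet> grad \<phi> y \<partial>lborel) = 0"
    if \<phi>: "\<phi> \<in> test UNIV" for m \<phi>
  proof (rule blow_up_divergence_free[where U = "\<lambda>x. cross3 m (v x)" and H = "\<lambda>x. w x \<bullet> m" and P = "\<lambda>T x. cross3 m (P T x)"])
    show "smooth (component i (\<lambda>x. cross3 m (P T x)))" if "T \<in> \<T>" for T i
    proof -
      have s: "smooth (\<lambda>x. P T x $ j)" for j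
        using real_polynomial_function_smooth[OF P[OF that, of j]] by (simp add: component_def[abs_def])
      show ?thesis
        using exhaust_3[of i] by (auto simp: component_def[abs_def] cross3_def intro!: smooth_diff smooth_cmult s)
    qed
    show "AE x in lebesgue_on (interior T). cross3 m (v x) = cross3 m (P T x)" if "T \<in> \<T>" for T
      using AE_mesh_interior[OF that vP[OF that]] by auto
    show "(\<lambda>x. cross3 m (v x)) \<in> L2 \<Omega>"
    proof (rule L2_vec)
      fix i
      have s: "(\<lambda>x. c * v x $ j) \<in> L2 \<Omega>" for j c
        using L2_cmult[OF L2_component[OF L(1), of j], of c] by (simp add: component_def[abs_def])
      show "component i (\<lambda>x. cross3 m (v x)) \<in> L2 \<Omega>"
        using exhaust_3[of i] by (auto simp: component_def[abs_def] cross3_def intro!: L2_diff s)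
    qed
    show "(\<lambda>x. w x \<bullet> m) \<in> L2 \<Omega>"
    proof (rule L2_bound[OF L2_cmult[OF L(2), of "norm m"]])
      show "(\<lambda>x. w x \<bullet> m) \<in> borel_measurable (lebesgue_on \<Omega>)" using L2_measurable[OF L(2)] by measurable
      show "norm (w x \<bullet> m) \<le> norm (norm m *\<^sub>R w x)" for x
        using Cauchy_Schwarz_ineq2[of "w x" m] by (simp add: mult.commute)
    qed
    show "(\<integral>x. cross3 m (v x) \<bullet> grad \<psi> x \<partial>lebesgue_on \<Omega>) = (\<integral>x. w x \<bullet> m * \<psi> x \<partial>lebesgue_on \<Omega>)"
      if \<psi>: "\<psi> \<in> test UNIV" for \<psi>
    proof -
      have "(\<lambda>x. \<psi> x *\<^sub>R m) \<in> vtest UNIV"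
        using test_mult[OF \<psi> smooth_const] by (simp add: vtest_def component_def[abs_def])
      from w(2)[OF this] have "(\<integral>x. v x \<bullet> cross3 (grad \<psi> x) m \<partial>lebesgue_on \<Omega>) = (\<integral>x. w x \<bullet> m * \<psi> x \<partial>lebesgue_on \<Omega>)"
        by (simp add: curl_scaled_vector[OF test_smooth[OF \<psi>]] mult.commute)
      moreover have "v x \<bullet> cross3 (grad \<psi> x) m = cross3 m (v x) \<bullet> grad \<psi> x" for x
        by (simp add: inner_3 cross3_def algebra_simps)
      ultimately show ?thesis by simp
    qed
  qed (rule \<phi>)
  \<comment> \<open>The component along \<open>a\<close> of the magnified limit field.\<close>
  define w0 where "w0 a y = (\<Sum>T\<in>\<T>. ?K T y * (a \<bullet> P T x))" for a y
  have w0m: "w0 a \<in> borel_measurable borel" for a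
    unfolding w0_def[abs_def] using open_cone_at
    by (intro borel_measurable_sum borel_measurable_times borel_measurable_indicator) auto
  have w0b: "\<bar>w0 a y\<bar> \<le> (\<Sum>T\<in>\<T>. \<bar>a \<bullet> P T x\<bar>)" for a y
    unfolding w0_def by (rule order_trans[OF sum_abs]) (auto intro!: sum_mono simp: indicator_def)
  have inv: "w0 a (y + s *\<^sub>R t) = w0 a y" for a y s
    unfolding w0_def
  proof (rule sum.cong)
    fix T assume T: "T \<in> \<T>"
    have "y + s *\<^sub>R t \<in> cone_at x T \<longleftrightarrow> y \<in> cone_at x T"
    proof (cases "x \<in> T")
      case True
      note i = cone_at_edge_invariant[OF T edge[OF T True] \<delta>]
      show ?thesis using i[of y s] i[of "y + s *\<^sub>R t" "- s"] by auto
    qed (simp add: cone_at_outside[OF T])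
    then show "?K T (y + s *\<^sub>R t) * (a \<bullet> P T x) = ?K T y * (a \<bullet> P T x)" by (simp add: indicator_def)
  qed simp
  have "t \<bullet> P T x = 0"
  proof (rule cone_function_eq_0[OF x T])
    fix \<phi> :: "real^3 \<Rightarrow> real" and i assume \<phi>: "\<phi> \<in> test UNIV"
    obtain K R where b: "K \<ge> 0" "\<And>x. \<bar>\<phi> x\<bar> \<le> K" "\<And>x. norm (grad \<phi> x) \<le> K"
      "\<And>x. norm x \<ge> R \<Longrightarrow> \<phi> x = 0" "\<And>x. norm x \<ge> R \<Longrightarrow> grad \<phi> x = 0"
      "\<And>x y. \<bar>\<phi> x - \<phi> y\<bar> \<le> K * norm (x - y)"
      using \<phi> by (rule test_bounds) blast
    have sm: "smooth \<phi>" using \<phi> by (rule test_smooth)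
    let ?c = "axis i 1 :: real^3"
    have gm[measurable]: "grad \<phi> \<in> borel_measurable borel" by (intro grad_borel_measurable sm)
    have tm: "(\<lambda>y. t \<bullet> grad \<phi> y) \<in> borel_measurable borel" by measurable
    have A: "(\<integral>y. w0 ?c y * (t \<bullet> grad \<phi> y) \<partial>lborel) = 0"
    proof (rule integral_invariant_derivative_eq_0[OF w0m w0b inv b(2) b(6) b(4) tm])
      show "AE x in lborel. ((\<lambda>s. \<phi> (x + s *\<^sub>R t)) has_real_derivative t \<bullet> grad \<phi> x) (at 0)"
        using smooth_directional_derivative[OF sm, of _ t 0] by (simp add: inner_commute)
    qed
    have int: "integrable lborel (\<lambda>y. w0 a y * (z \<bullet> grad \<phi> y))" for a z
    proof (rule integrable_bounded_support)
      note [measurable] = w0m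
      show "(\<lambda>y. w0 a y * (z \<bullet> grad \<phi> y)) \<in> borel_measurable borel" by measurable
      show "\<bar>w0 a y * (z \<bullet> grad \<phi> y)\<bar> \<le> (\<Sum>T\<in>\<T>. \<bar>a \<bullet> P T x\<bar>) * (norm z * K)" for y
        unfolding abs_mult
        by (intro mult_mono w0b order_trans[OF Cauchy_Schwarz_ineq2] b) (auto intro: sum_nonneg)
      show "w0 a y * (z \<bullet> grad \<phi> y) = 0" if "R \<le> norm y" for y using b(5)[OF that] by simp
    qed
    have cr: "cross3 (cross3 t ?c) q = (t \<bullet> q) *\<^sub>R ?c - (?c \<bullet> q) *\<^sub>R t" for q
      using Lagrange[of q t ?c] cross_skew[of "cross3 t ?c" q] by (simp add: inner_commute)
    have "(\<Sum>T\<in>\<T>. ?K T y *\<^sub>R cross3 (cross3 t ?c) (P T x)) \<bullet> grad \<phi> y =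
        w0 t y * (?c \<bullet> grad \<phi> y) - w0 ?c y * (t \<bullet> grad \<phi> y)" for y
      by (simp add: cr w0_def inner_sum_left inner_diff_left right_diff_distrib sum_subtractf
          sum_distrib_right mult.assoc)
    with curl0[OF \<phi>, of "cross3 t ?c"] have
      "(\<integral>y. w0 t y * (?c \<bullet> grad \<phi> y) - w0 ?c y * (t \<bullet> grad \<phi> y) \<partial>lborel) = 0" by simp
    then have "(\<integral>y. w0 t y * (?c \<bullet> grad \<phi> y) \<partial>lborel) = 0"
      using A int by simp
    then show "(\<integral>y. (\<Sum>T\<in>\<T>. ?K T y *\<^sub>R (t \<bullet> P T x)) * pd i \<phi> y \<partial>lborel) = 0"
      by (simp add: w0_def inner_axis')
  qed
  then show ?thesis by (simp add: inner_commute)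
qed

end

section \<open>Edge and face integrals\<close>

lemma scale_measure_eq_density: "scale_measure r M = density M (\<lambda>_. r)"
  by (rule measure_eqI) (auto simp: emeasure_density_const)

text \<open>\<open>edge_measure\<close> takes its endpoints from \<open>SOME\<close>, so the formula
  can be stated only for an unknown pair that spans the edge.\<close>

lemma edge_integral:
  fixes e :: "(real^3) set"
  assumes "e = convex hull {a0, b0}"
  obtains a b where "e = convex hull {a, b}"
    "\<And>f::real^3\<Rightarrow>real. continuous_on UNIV f \<Longrightarrow> integrable (edge_measure e) f"
    "\<And>f::real^3\<Rightarrow>real. continuous_on UNIV f \<Longrightarrow>
      (\<integral>x. f x \<partial>edge_measure e) = dist a b * integral {0..1} (\<lambda>s. f (a + s *\<^sub>R (b - a)))"
proof -
  define ab where "ab = (SOME (a, b). e = convex hull {a, b})"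
  obtain a b where ab: "ab = (a, b)" by (cases ab)
  have e: "e = convex hull {a, b}"
    using someI[of "\<lambda>(a, b). e = convex hull {a, b}" "(a0, b0)"] assms ab by (simp add: ab_def)
  let ?M = "distr (restrict_space lborel {0..1::real}) borel (\<lambda>s. a + s *\<^sub>R (b - a))"
  have em: "edge_measure e = density ?M (\<lambda>_. ennreal (dist a b))"
    unfolding edge_measure_def ab_def[symmetric] ab by (simp add: scale_measure_eq_density)
  have meas: "(\<lambda>s. a + s *\<^sub>R (b - a)) \<in> measurable (restrict_space lborel {0..1::real}) borel"
    by (simp add: borel_measurable_continuous_onI measurable_restrict_space1 continuous_intros)
  have *: "integrable (edge_measure e) f \<and>
      (\<integral>x. f x \<partial>edge_measure e) = dist a b * integral {0..1} (\<lambda>s. f (a + s *\<^sub>R (b - a)))"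
    if f: "continuous_on UNIV f" for f :: "real^3 \<Rightarrow> real"
  proof -
    have fm[measurable]: "f \<in> borel_measurable borel" using f by (rule borel_measurable_continuous_onI)
    have c: "continuous_on {0..1} (\<lambda>s. f (a + s *\<^sub>R (b - a)))"
      by (intro continuous_on_compose2[OF f] continuous_intros) auto
    have i: "set_integrable lborel {0..1} (\<lambda>s. f (a + s *\<^sub>R (b - a)))"
      using c by (rule borel_integrable_atLeastAtMost')
    then have "integrable ?M f"
      using meas by (simp add: integrable_distr_eq integrable_restrict_space set_integrable_def)
    then have 1: "integrable (edge_measure e) f"
      unfolding em by (simp add: integrable_density)
    have "(\<integral>x. f x \<partial>edge_measure e) = dist a b * (\<integral>x. f x \<partial>?M)"
      unfolding em by (simp add: integral_density)
    also have "(\<integral>x. f x \<partial>?M) = (LINT s:{0..1}|lborel. f (a + s *\<^sub>R (b - a)))"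
      using meas by (simp add: integral_distr integral_restrict_space set_lebesgue_integral_def)
    also have "\<dots> = integral {0..1} (\<lambda>s. f (a + s *\<^sub>R (b - a)))"
      by (rule set_borel_integral_eq_integral(2)[OF i])
    finally show ?thesis using 1 by simp
  qed
  show thesis by (rule that[OF e]) (use * in auto)
qed

text \<open>A segment determines its endpoints up to order, so the hidden choice leaves only the
  direction of the parametrisation open.\<close>

lemma edge_integral_endpoints:
  fixes e :: "(real^3) set"
  assumes e: "e = convex hull {a, b}" and ab: "a \<noteq> b"
  obtains c d where "{c, d} = {a, b}"
    "\<And>f::real^3\<Rightarrow>real. continuous_on UNIV f \<Longrightarrow> integrable (edge_measure e) f"
    "\<And>f::real^3\<Rightarrow>real. continuous_on UNIV f \<Longrightarrow>
      (\<integral>x. f x \<partial>edge_measure e) = dist c d * integral {0..1} (\<lambda>s. f (c + s *\<^sub>R (d - c)))"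
proof (rule edge_integral[OF e])
  fix c d assume cd: "e = convex hull {c, d}"
    and 1: "\<And>f::real^3\<Rightarrow>real. continuous_on UNIV f \<Longrightarrow> integrable (edge_measure e) f"
    and 2: "\<And>f::real^3\<Rightarrow>real. continuous_on UNIV f \<Longrightarrow>
      (\<integral>x. f x \<partial>edge_measure e) = dist c d * integral {0..1} (\<lambda>s. f (c + s *\<^sub>R (d - c)))"
  have "closed_segment c d = closed_segment a b"
    using cd e by (simp add: segment_convex_hull)
  then have "{c, d} = {a, b}" by simp
  then show thesis using 1 2 by (rule that)
qed

lemma polys_continuous: "p \<in> polys k \<Longrightarrow> continuous_on S p"
  by (intro smooth_continuous_on real_polynomial_function_smooth polys_real_polynomial_function)

lemma lborel_integral_Icc:
  fixes f F :: "real \<Rightarrow> real"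
  assumes "a \<le> b" "\<And>x. (F has_real_derivative f x) (at x)" "continuous_on UNIV f"
  shows "(\<integral>x. indicator {a..b} x * f x \<partial>lborel) = F b - F a"
proof -
  have "(f has_integral (F b - F a)) {a..b}"
    using assms by (intro fundamental_theorem_of_calculus)
      (auto simp: has_real_derivative_iff_has_vector_derivative intro: has_vector_derivative_at_within)
  moreover have "set_integrable lborel {a..b} f"
    by (rule borel_integrable_atLeastAtMost'[OF continuous_on_subset[OF assms(3)]]) simp
  ultimately show ?thesis
    using set_borel_integral_eq_integral(2)[of "{a..b}" f]
    by (simp add: set_lebesgue_integral_def integral_unique)
qed

section \<open>Integration over the reference triangle\<close>

definition unit_triangle :: "(real \<times> real) set" where
  "unit_triangle = {(s, t). 0 \<le> s \<and> 0 \<le> t \<and> s + t \<le> 1}"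

lemma unit_triangle_borel [measurable]: "unit_triangle \<in> sets borel"
proof -
  have "closed ({z::real\<times>real. 0 \<le> fst z} \<inter> {z. 0 \<le> snd z} \<inter> {z. fst z + snd z \<le> 1})"
    by (intro closed_Int closed_Collect_le continuous_intros)
  moreover have "unit_triangle = {z. 0 \<le> fst z} \<inter> {z. 0 \<le> snd z} \<inter> {z. fst z + snd z \<le> 1}"
    by (auto simp: unit_triangle_def)
  ultimately show ?thesis by (metis borel_closed)
qed

lemma unit_triangle_integrable:
  fixes f :: "real \<times> real \<Rightarrow> real"
  assumes "continuous_on UNIV f"
  shows "integrable lborel (\<lambda>z. indicator unit_triangle z * f z)"
proof -
  have sub: "unit_triangle \<subseteq> cbox (0, 0) (1, 1)"
    by (auto simp: unit_triangle_def cbox_Pair_eq)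
  have "set_integrable lborel (cbox (0, 0) (1, 1)) f"
    unfolding set_integrable_def
    by (rule borel_integrable_compact[OF compact_cbox continuous_on_subset[OF assms]]) simp
  then have "set_integrable lborel unit_triangle f"
    by (rule set_integrable_subset) (use sub unit_triangle_borel in auto)
  then show ?thesis by (simp add: set_integrable_def)
qed

lemma face_integral:
  fixes F :: "(real^3) set"
  assumes "F = convex hull {a0, b0, c0}"
  obtains a b c where "F = convex hull {a, b, c}"
    "\<And>f::real^3\<Rightarrow>real. continuous_on UNIV f \<Longrightarrow> integrable (face_measure F) f"
    "\<And>f::real^3\<Rightarrow>real. continuous_on UNIV f \<Longrightarrow>
      (\<integral>x. f x \<partial>face_measure F) = norm (cross3 (b - a) (c - a)) *
        (\<integral>z. indicator unit_triangle z * f (a + fst z *\<^sub>R (b - a) + snd z *\<^sub>R (c - a)) \<partial>lborel)"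
proof -
  define abc where "abc = (SOME (a, b, c). F = convex hull {a, b, c})"
  obtain a b c where abc: "abc = (a, b, c)" by (cases abc)
  have F: "F = convex hull {a, b, c}"
    using someI[of "\<lambda>(a, b, c). F = convex hull {a, b, c}" "(a0, b0, c0)"] assms abc by (simp add: abc_def)
  let ?g = "\<lambda>z::real\<times>real. a + fst z *\<^sub>R (b - a) + snd z *\<^sub>R (c - a)"
  let ?M = "distr (restrict_space lborel unit_triangle) borel ?g"
  have em: "face_measure F = density ?M (\<lambda>_. ennreal (norm (cross3 (b - a) (c - a))))"
    unfolding face_measure_def abc_def[symmetric] abc
    by (simp add: scale_measure_eq_density unit_triangle_def case_prod_beta')
  have gc: "continuous_on UNIV ?g" by (intro continuous_intros)
  then have meas: "?g \<in> measurable (restrict_space lborel unit_triangle) borel"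
    by (simp add: borel_measurable_continuous_onI measurable_restrict_space1)
  have *: "integrable (face_measure F) f \<and>
      (\<integral>x. f x \<partial>face_measure F) = norm (cross3 (b - a) (c - a)) * (\<integral>z. indicator unit_triangle z * f (?g z) \<partial>lborel)"
    if f: "continuous_on UNIV f" for f :: "real^3 \<Rightarrow> real"
  proof -
    have fm[measurable]: "f \<in> borel_measurable borel" using f by (rule borel_measurable_continuous_onI)
    have i: "integrable lborel (\<lambda>z. indicator unit_triangle z * f (?g z))"
      by (intro unit_triangle_integrable continuous_on_compose2[OF f gc]) auto
    then have "integrable ?M f"
      using meas by (simp add: integrable_distr_eq integrable_restrict_space)
    then have 1: "integrable (face_measure F) f"
      unfolding em by (simp add: integrable_density)
    have "(\<integral>x. f x \<partial>face_measure F) = norm (cross3 (b - a) (c - a)) * (\<integral>x. f x \<partial>?M)"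
      unfolding em by (simp add: integral_density)
    also have "(\<integral>x. f x \<partial>?M) = (\<integral>z. indicator unit_triangle z * f (?g z) \<partial>lborel)"
      using meas by (simp add: integral_distr integral_restrict_space)
    finally show ?thesis using 1 by simp
  qed
  show thesis by (rule that[OF F]) (use * in auto)
qed

text \<open>The weight is the product of the three barycentric coordinates of the reference
  triangle; its integral is 1/120, and 1/360 with a further factor \<open>fst z\<close> or
  \<open>snd z\<close>. For an affine function with vertex values \<open>q a\<close>,
  \<open>q b\<close>, \<open>q c\<close> one has \<open>A = q a\<close>,
  \<open>B = q b - q a\<close>, \<open>C = q c - q a\<close>, and the result is (q a + q b + q c) /
  360.\<close>

lemma unit_triangle_bubble_integral:
  "(\<integral>z. indicator unit_triangle z * ((1 - fst z - snd z) * fst z * snd z * (A + B * fst z + C * snd z)) \<partial>lborel)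
    = (3 * A + B + C) / 360"
proof -
  let ?f = "\<lambda>z. indicator unit_triangle z * ((1 - fst z - snd z) * fst z * snd z * (A + B * fst z + C * snd z))"
  have int: "integrable (lborel \<Otimes>\<^sub>M lborel) ?f"
    unfolding lborel_prod by (rule unit_triangle_integrable) (intro continuous_intros)
  have inner: "(\<integral>t. ?f (s, t) \<partial>lborel) =
      indicator {0..1} s * (s * ((A + B * s) * (1 - s) ^ 3 / 6 + C * (1 - s) ^ 4 / 12))" for s
  proof (cases "s \<in> {0..1}")
    case True
    define G where "G t = s * ((A + B * s) * ((1 - s) * t\<^sup>2 / 2 - t ^ 3 / 3) + C * ((1 - s) * t ^ 3 / 3 - t ^ 4 / 4))" for t
    have "(\<integral>t. ?f (s, t) \<partial>lborel) =
        (\<integral>t. indicator {0..1 - s} t * ((1 - s - t) * s * t * (A + B * s + C * t)) \<partial>lborel)"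
      using True by (intro Bochner_Integration.integral_cong) (auto simp: unit_triangle_def indicator_def)
    also have "\<dots> = G (1 - s) - G 0"
    proof (rule lborel_integral_Icc)
      show "(G has_real_derivative ((1 - s - t) * s * t * (A + B * s + C * t))) (at t)" for t
        unfolding G_def[abs_def]
        by (auto intro!: derivative_eq_intros simp: field_simps power2_eq_square power3_eq_cube)
    qed (use True in \<open>auto intro!: continuous_intros\<close>)
    also have "\<dots> = s * ((A + B * s) * (1 - s) ^ 3 / 6 + C * (1 - s) ^ 4 / 12)"
      unfolding G_def by (simp add: field_simps power2_eq_square power3_eq_cube power4_eq_xxxx)
    finally show ?thesis using True by simp
  next
    case False
    then have "?f (s, t) = 0" for t by (auto simp: unit_triangle_def indicator_def)
    then have "(\<integral>t. ?f (s, t) \<partial>lborel) = 0" by (simp only: Bochner_Integration.integral_zero)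
    then show ?thesis using False by simp
  qed
  \<comment> \<open>Antiderivative of the expanded integrand; the three brackets integrate s (1 -
    s)^3, s^2 (1 - s)^3 and s (1 - s)^4.\<close>
  define G where "G s = A / 6 * (s\<^sup>2 / 2 - s ^ 3 + 3 * s ^ 4 / 4 - s ^ 5 / 5)
      + B / 6 * (s ^ 3 / 3 - 3 * s ^ 4 / 4 + 3 * s ^ 5 / 5 - s ^ 6 / 6)
      + C / 12 * (s\<^sup>2 / 2 - 4 * s ^ 3 / 3 + 6 * s ^ 4 / 4 - 4 * s ^ 5 / 5 + s ^ 6 / 6)" for s :: real
  have "(\<integral>z. ?f z \<partial>lborel) = (\<integral>s. (\<integral>t. ?f (s, t) \<partial>lborel) \<partial>lborel)"
    using lborel_pair.integral_fst'[OF int] by (simp add: lborel_prod)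
  also have "\<dots> = (\<integral>s. indicator {0..1} s * (s * ((A + B * s) * (1 - s) ^ 3 / 6 + C * (1 - s) ^ 4 / 12)) \<partial>lborel)"
    by (simp only: inner)
  also have "\<dots> = G 1 - G 0"
  proof (rule lborel_integral_Icc)
    show "(G has_real_derivative s * ((A + B * s) * (1 - s) ^ 3 / 6 + C * (1 - s) ^ 4 / 12)) (at s)" for s
      unfolding G_def[abs_def]
      by (auto intro!: derivative_eq_intros) algebra
  qed (auto intro!: continuous_intros)
  also have "\<dots> = (3 * A + B + C) / 360"
    by (simp add: G_def field_simps)
  finally show ?thesis .
qed

section \<open>Unisolvence on a tetrahedron\<close>

locale tetrahedron =
  fixes C :: "(real^3) set" and T :: "(real^3) set"
  assumes indep: "\<not> affine_dependent C" and card_C: "card C = 4" and T_def: "T = convex hull C"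
begin

lemma finite_C: "finite C"
  using indep by (rule aff_independent_finite)

lemma affine_hull_C: "affine hull C = UNIV"
proof -
  have "aff_dim C = DIM(real^3)"
    using aff_dim_affine_independent[OF indep] card_C by simp
  then show ?thesis using aff_dim_eq_full by blast
qed

text \<open>The set where two affine functions agree is affine, and four affinely independent points
  span the whole space.\<close>

lemma polys_1_eqI:
  assumes "p \<in> polys 1" "q \<in> polys 1" "\<And>a. a \<in> C \<Longrightarrow> p a = q a"
  shows "p x = q x"
proof -
  obtain c w where p: "p = (\<lambda>x. c + w \<bullet> x)" using assms(1) by (rule polys_1_cases)
  obtain d u where q: "q = (\<lambda>x. d + u \<bullet> x)" using assms(2) by (rule polys_1_cases)
  have "C \<subseteq> {x. (w - u) \<bullet> x = d - c}"
    using assms(3) unfolding p q by (auto simp: inner_diff_left algebra_simps)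
  then have "affine hull C \<subseteq> {x. (w - u) \<bullet> x = d - c}"
    by (intro hull_minimal affine_hyperplane)
  then have "(w - u) \<bullet> x = d - c" using affine_hull_C by auto
  then show ?thesis unfolding p q by (simp add: inner_diff_left algebra_simps)
qed

lemma extreme_points: "{a. a extreme_point_of T} = C"
  unfolding T_def using extreme_point_of_convex_hull_affine_independent[OF indep] by auto

text \<open>The vectors from \<open>a\<close> to the other three vertices are independent, so a
  linear functional may be prescribed as -1 on all of them; a constant then adjusts the value at
  \<open>a\<close> to 1.\<close>

lemma barycentric_exists:
  assumes a: "a \<in> C"
  shows "\<exists>l\<in>polys 1. l a = 1 \<and> (\<forall>b\<in>C. b \<noteq> a \<longrightarrow> l b = 0)"
proof -
  have "independent ((\<lambda>x. - a + x) ` (C - {a}))"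
    using affine_dependent_iff_dependent2[OF a] indep by simp
  then obtain g :: "real^3 \<Rightarrow> real" where g: "linear g" "\<And>x. x \<in> (\<lambda>x. - a + x) ` (C - {a}) \<Longrightarrow> g x = - 1"
    using linear_independent_extend[of _ "\<lambda>_. - 1"] by metis
  have gw: "g x = adjoint g 1 \<bullet> x" for x
    using adjoint_works[OF g(1), of x 1] by (simp add: inner_commute)
  define l where "l x = (1 - adjoint g 1 \<bullet> a) + adjoint g 1 \<bullet> x" for x
  have "l \<in> polys 1" unfolding l_def[abs_def] by (rule polys_affine)
  moreover have "l a = 1" by (simp add: l_def)
  moreover have "l b = 0" if "b \<in> C" "b \<noteq> a" for b
    using g(2)[of "- a + b"] that by (simp add: l_def gw inner_diff_right)
  ultimately show ?thesis by blast
qed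

text \<open>Existence together with uniqueness of affine functions with given vertex values makes
  the \<open>THE\<close> in \<open>bary\<close> well defined.\<close>

lemma bary_props:
  assumes a: "a \<in> C"
  shows bary_polys: "bary T a \<in> polys 1" and bary_vertex: "\<And>b. b \<in> C \<Longrightarrow> bary T a b = (if b = a then 1 else 0)"
proof -
  obtain l where l: "l \<in> polys 1" "l a = 1" "\<And>b. b \<in> C \<Longrightarrow> b \<noteq> a \<Longrightarrow> l b = 0"
    using barycentric_exists[OF a] by blast
  have ext: "b extreme_point_of T \<longleftrightarrow> b \<in> C" for b using extreme_points by blast
  have "bary T a = l"
    unfolding bary_def ext
  proof (rule the_equality)
    show "l \<in> polys 1 \<and> l a = 1 \<and> (\<forall>b. b \<in> C \<and> b \<noteq> a \<longrightarrow> l b = 0)" using l by blast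
    fix m assume m: "m \<in> polys 1 \<and> m a = 1 \<and> (\<forall>b. b \<in> C \<and> b \<noteq> a \<longrightarrow> m b = 0)"
    show "m = l"
    proof
      show "m x = l x" for x
      proof (rule polys_1_eqI)
        show "m b = l b" if "b \<in> C" for b using m l that by (cases "b = a") auto
      qed (use m l in auto)
    qed
  qed
  then show "bary T a \<in> polys 1" "\<And>b. b \<in> C \<Longrightarrow> bary T a b = (if b = a then 1 else 0)"
    using l by auto
qed

lemma polys_1_expansion:
  assumes "p \<in> polys 1"
  shows "p x = (\<Sum>a\<in>C. p a * bary T a x)"
proof (rule polys_1_eqI[OF assms])
  show "(\<lambda>x. \<Sum>a\<in>C. p a * bary T a x) \<in> polys 1"
    by (intro polys_sum polys_cmult bary_polys)
  show "p b = (\<Sum>a\<in>C. p a * bary T a b)" if "b \<in> C" for b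
    using that finite_C by (simp add: bary_vertex if_distrib[of "\<lambda>x. _ * x"] cong: if_cong)
qed

lemma bary_sum: "(\<Sum>a\<in>C. bary T a x) = 1"
  using polys_1_expansion[OF polys_const[of 1]] by simp

lemma bary_expansion: "(\<Sum>a\<in>C. bary T a x *\<^sub>R a) = x"
proof -
  have "x $ i = (\<Sum>a\<in>C. a $ i * bary T a x)" for i
    by (rule polys_1_expansion[OF polys_coord])
  then show ?thesis by (simp add: vec_eq_iff mult.commute)
qed

lemma bubble_eq: "bubble T x = (\<Prod>a\<in>C. bary T a x)"
  unfolding bubble_def extreme_points ..

lemma bubble_polynomial: "real_polynomial_function (bubble T)"
  unfolding bubble_eq[abs_def]
  by (intro real_polynomial_function_prod finite_C polys_real_polynomial_function[OF bary_polys])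

lemma polys_1_zero_on_hull:
  assumes "p \<in> polys 1" "\<And>a. a \<in> S \<Longrightarrow> p a = 0" "x \<in> affine hull S"
  shows "p x = 0"
proof -
  obtain c w where p: "p = (\<lambda>x. c + w \<bullet> x)" using assms(1) by (rule polys_1_cases)
  have "S \<subseteq> {x. w \<bullet> x = - c}"
    using assms(2) unfolding p by (auto simp: eq_neg_iff_add_eq_0 add.commute)
  then have "affine hull S \<subseteq> {x. w \<bullet> x = - c}"
    by (intro hull_minimal affine_hyperplane)
  then show ?thesis using assms(3) unfolding p by auto
qed

lemma bary_zero_on_face:
  assumes "a \<in> C" "S \<subseteq> C" "a \<notin> S" "x \<in> affine hull S"
  shows "bary T a x = 0"
proof (rule polys_1_zero_on_hull[OF bary_polys[OF assms(1)] _ assms(4)])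
  show "bary T a b = 0" if "b \<in> S" for b
    using that assms by (subst bary_vertex) auto
qed

lemma bubble_zero_on_face:
  assumes "S \<subseteq> C" "a \<in> C" "a \<notin> S" "x \<in> affine hull S"
  shows "bubble T x = 0"
  unfolding bubble_eq using bary_zero_on_face[OF assms(2,1,3,4)] assms(2) finite_C by (meson prod_zero)

text \<open>On \<open>T\<close> the barycentric coordinates are the coefficients of a convex
  combination, hence nonnegative. If their product were nonzero, all would be positive; the set
  where this holds is open and contained in \<open>T\<close>, so \<open>x\<close> would be an
  interior point.\<close>

lemma bubble_zero_on_frontier:
  assumes "x \<in> frontier T"
  shows "bubble T x = 0"
proof (rule ccontr)
  assume nz: "bubble T x \<noteq> 0"
  have cont: "continuous_on UNIV (bary T a)" if "a \<in> C" for a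
    by (intro smooth_continuous_on real_polynomial_function_smooth polys_real_polynomial_function[OF bary_polys] that)
  have "compact T" unfolding T_def using finite_C by (rule finite_imp_compact_convex_hull)
  then have "x \<in> T" using assms by (meson compact_imp_closed frontier_subset_closed subsetD)
  then obtain u where u: "\<And>a. a \<in> C \<Longrightarrow> 0 \<le> u a" "sum u C = 1" "(\<Sum>a\<in>C. u a *\<^sub>R a) = x"
    unfolding T_def convex_hull_finite[OF finite_C] by auto
  have "bary T a x = u a" if a: "a \<in> C" for a
  proof -
    obtain c w where cw: "bary T a = (\<lambda>x. c + w \<bullet> x)" using bary_polys[OF a] by (rule polys_1_cases)
    have "bary T a x = c * sum u C + w \<bullet> (\<Sum>b\<in>C. u b *\<^sub>R b)" using u by (simp add: cw)
    also have "\<dots> = (\<Sum>b\<in>C. u b * bary T a b)"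
      by (simp add: cw sum_distrib_left inner_sum_right sum.distrib algebra_simps)
    also have "\<dots> = u a"
      using a finite_C by (simp add: bary_vertex if_distrib[of "\<lambda>x. _ * x"] cong: if_cong)
    finally show ?thesis .
  qed
  then have pos: "bary T a x > 0" if "a \<in> C" for a
    using u(1)[OF that] that nz finite_C unfolding bubble_eq by (auto simp: prod_zero_iff less_le)
  let ?U = "\<Inter>a\<in>C. {y. 0 < bary T a y}"
  have "open ?U"
    by (intro open_INT finite_C ballI open_Collect_less continuous_on_const cont)
  moreover have "?U \<subseteq> T"
  proof
    fix y assume y: "y \<in> ?U"
    have "(\<Sum>a\<in>C. bary T a y *\<^sub>R a) \<in> convex hull C"
      using y by (intro convex_sum convex_convex_hull finite_C bary_sum) (auto intro: less_imp_le hull_inc)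
    then show "y \<in> T" unfolding bary_expansion by (simp add: T_def)
  qed
  ultimately have "x \<in> interior T" using pos by (intro interiorI[of ?U]) auto
  then show False using assms by (simp add: frontier_def)
qed

text \<open>For a fixed vertex \<open>a\<close> the affine function
  \<open>\<lambda>b. p a \<bullet> (b - a)\<close> vanishes at all vertices, hence everywhere; at
  \<open>b = p a + a\<close> its value is the squared length of \<open>p a\<close>.\<close>

lemma vpolys_1_zero:
  assumes p: "p \<in> vpolys 1" and tang: "\<And>a b. a \<in> C \<Longrightarrow> b \<in> C \<Longrightarrow> p a \<bullet> (b - a) = 0"
  shows "p x = 0"
proof -
  have "p a = 0" if a: "a \<in> C" for a
  proof -
    have "(- (p a \<bullet> a)) + p a \<bullet> (p a + a) = 0"
    proof (rule polys_1_eqI[OF polys_affine polys_const])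
      show "- (p a \<bullet> a) + p a \<bullet> b = 0" if "b \<in> C" for b
        using tang[OF a that] by (simp add: inner_diff_right)
    qed
    then show ?thesis by (simp add: inner_add_right)
  qed
  then have "component i p a = 0" if "a \<in> C" for i a using that by (simp add: component_def)
  moreover have "component i p \<in> polys 1" for i using p by (simp add: vpolys_def)
  ultimately have "component i p x = 0" for i by (metis polys_1_eqI polys_const)
  then show ?thesis by (simp add: vec_eq_iff component_def)
qed

text \<open>On each edge \<open>p\<close> is quadratic with zero end values and zero mean, hence
  zero. So the affine field \<open>grad p\<close> has no component along any edge at any vertex and
  vanishes by \<open>vpolys_1_zero\<close>; the remaining constant is a vertex value.\<close>

lemma polys_2_zero:
  assumes p: "p \<in> polys 2" and vertex: "\<And>a. a \<in> C \<Longrightarrow> p a = 0"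
    and edge: "\<And>a b. a \<in> C \<Longrightarrow> b \<in> C \<Longrightarrow> a \<noteq> b \<Longrightarrow> (\<integral>x. p x \<partial>edge_measure (convex hull {a, b})) = 0"
  shows "p x = 0"
proof -
  obtain c w A where A: "linear A" and p_eq: "p = (\<lambda>x. c + w \<bullet> x + x \<bullet> A x)"
    using p by (rule polys_2_cases)
  have sm: "smooth p" by (intro real_polynomial_function_smooth polys_real_polynomial_function[OF p])
  have grad_eq: "grad p x = w + A x + adjoint A x" for x
  proof (rule grad_eq)
    have "((\<lambda>x. c + w \<bullet> x + x \<bullet> A x) has_derivative (\<lambda>h. w \<bullet> h + (x \<bullet> A h + h \<bullet> A x))) (at x)"
      by (auto intro!: derivative_eq_intros linear_imp_has_derivative A)
    moreover have "w \<bullet> h + (x \<bullet> A h + h \<bullet> A x) = (w + A x + adjoint A x) \<bullet> h" for h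
      using adjoint_works[OF A, of h x] by (simp add: inner_add_left inner_commute[of h] inner_commute[of "A h"])
    ultimately show "(p has_derivative (\<lambda>h. (w + A x + adjoint A x) \<bullet> h)) (at x)" by (simp add: p_eq)
  qed
  have gp: "grad p \<in> vpolys 1"
    unfolding vpolys_def
  proof (clarify)
    fix i
    define g where "g x = (A x + adjoint A x) $ i" for x
    have g: "linear g"
      using linear_compose[OF linear_compose_add[OF A adjoint_linear[OF A]] bounded_linear.linear[OF bounded_linear_vec_nth], of i]
      by (simp add: o_def g_def[abs_def])
    define u where "u = adjoint g 1"
    have gu: "g x = u \<bullet> x" for x
      using adjoint_works[OF g, of x 1] by (simp add: u_def inner_commute)
    have "component i (grad p) x = w $ i + u \<bullet> x" for x
      unfolding gu[symmetric] by (simp add: component_def grad_eq g_def)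
    then have "component i (grad p) = (\<lambda>x. w $ i + u \<bullet> x)" by blast
    then show "component i (grad p) \<in> polys 1" using polys_affine by simp
  qed
  have "grad p a \<bullet> (b - a) = 0" if ab: "a \<in> C" "b \<in> C" for a b
  proof (cases "a = b")
    case False
    obtain c' d' where cd: "{c', d'} = {a, b}"
      and int: "(\<integral>x. p x \<partial>edge_measure (convex hull {a, b})) = dist c' d' * integral {0..1} (\<lambda>s. p (c' + s *\<^sub>R (d' - c')))"
      by (rule edge_integral_endpoints[OF refl False]) (use polys_continuous[OF p] in blast)
    have ne: "c' \<noteq> d'" using cd False by (auto simp: doubleton_eq_iff)
    have C: "c' \<in> C" "d' \<in> C" using cd ab by (auto simp: doubleton_eq_iff)
    define d where "d = d' - c'"
    define \<beta> \<gamma> where "\<beta> = w \<bullet> d + (c' \<bullet> A d + d \<bullet> A c')" and "\<gamma> = d \<bullet> A d"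
    have "p (c' + s *\<^sub>R d) = p c' + \<beta> * s + \<gamma> * s\<^sup>2" for s
      using A by (simp add: p_eq \<beta>_def \<gamma>_def linear_add linear_cmul inner_add_left inner_add_right power2_eq_square algebra_simps)
    then have line: "p (c' + s *\<^sub>R d) = \<beta> * s + \<gamma> * s\<^sup>2" for s using vertex[OF C(1)] by simp
    have 1: "\<beta> + \<gamma> = 0" using line[of 1] vertex[OF C(2)] by (simp add: d_def)
    have "((\<lambda>s. \<beta> * s + \<gamma> * s\<^sup>2) has_integral ((\<beta> * 1\<^sup>2 / 2 + \<gamma> * 1 ^ 3 / 3) - (\<beta> * 0\<^sup>2 / 2 + \<gamma> * 0 ^ 3 / 3))) {0..1}"
      by (intro fundamental_theorem_of_calculus)
        (auto intro!: derivative_eq_intros simp: has_real_derivative_iff_has_vector_derivative[symmetric])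
    \<comment> \<open>The mean over the edge; with the end value \<beta> + \<gamma> = 0 it forces
      both coefficients to vanish.\<close>
    then have "\<beta> / 2 + \<gamma> / 3 = 0"
      using edge[OF ab False] ne unfolding int by (simp add: line[symmetric] d_def integral_unique)
    then have "\<beta> = 0" "\<gamma> = 0" using 1 by linarith+
    then have "p (c' + s *\<^sub>R d) = 0" for s by (simp add: line)
    \<comment> \<open>The parametrisation behind \<open>edge_measure\<close> may run from
      \<open>b\<close> to \<open>a\<close>.\<close>
    moreover have "a + s *\<^sub>R (b - a) = c' + s *\<^sub>R d \<or> a + s *\<^sub>R (b - a) = c' + (1 - s) *\<^sub>R d" for s
      using cd unfolding d_def by (auto simp: doubleton_eq_iff algebra_simps)
    ultimately have "p (a + s *\<^sub>R (b - a)) = 0" for s by metis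
    then have "((\<lambda>s. p (a + s *\<^sub>R (b - a))) has_real_derivative 0) (at 0)" by simp
    then show ?thesis
      using smooth_directional_derivative[OF sm, of a "b - a" 0] DERIV_unique by fastforce
  qed simp
  then have "grad p x = 0" for x by (intro vpolys_1_zero[OF gp])
  then have "(p has_derivative (\<lambda>h. 0)) (at x)" for x
    using smooth_has_derivative[OF sm, of x] by simp
  moreover obtain a where a: "a \<in> C" using card_C by fastforce
  ultimately have "p x = p a"
    by (intro has_derivative_zero_unique[of UNIV p]) (auto intro: has_derivative_at_withinI)
  then show ?thesis using vertex[OF a] by simp
qed

end

lemma polys_1_affine_combination:
  assumes "p \<in> polys 1"
  shows "p (a + s *\<^sub>R (b - a) + t *\<^sub>R (c - a)) = p a + s * (p b - p a) + t * (p c - p a)"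
  using assms by (rule polys_1_cases) (simp add: inner_add_right inner_diff_right algebra_simps)

lemma polys_1_grad: "grad (\<lambda>x. c + w \<bullet> x) x = w"
  by (rule grad_eq) (auto intro!: derivative_eq_intros)

context tetrahedron
begin

lemma bary_smooth: "a \<in> C \<Longrightarrow> smooth (bary T a)"
  by (intro real_polynomial_function_smooth polys_real_polynomial_function[OF bary_polys])

text \<open>Some vertex lies outside \<open>{a, b}\<close>, and its barycentric coordinate vanishes
  along the whole line through \<open>a\<close> and \<open>b\<close>; so does the bubble, and with
  it the derivative along the line.\<close>

lemma bubble_edge_tangent:
  assumes ab: "a \<in> C" "b \<in> C" and q: "real_polynomial_function q"
  shows "grad (\<lambda>y. bubble T y * q y) (a + s *\<^sub>R (b - a)) \<bullet> (b - a) = 0"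
proof -
  have "card {a, b} < card C" using card_C by (simp add: card_insert_if)
  then have "\<not> C \<subseteq> {a, b}" by (meson card_mono finite.intros leD)
  then obtain c where c: "c \<in> C" "c \<notin> {a, b}" by blast
  have "bubble T (a + s *\<^sub>R (b - a)) = 0" for s
  proof (rule bubble_zero_on_face[of "{a, b}"])
    have "a + s *\<^sub>R (b - a) = (1 - s) *\<^sub>R a + s *\<^sub>R b" by (simp add: algebra_simps)
    then show "a + s *\<^sub>R (b - a) \<in> affine hull {a, b}"
      unfolding affine_hull_2 by (intro CollectI exI[of _ "1 - s"] exI[of _ s]) simp
  qed (use ab c in auto)
  then have "((\<lambda>s. bubble T (a + s *\<^sub>R (b - a)) * q (a + s *\<^sub>R (b - a))) has_real_derivative 0) (at s)" by simp
  moreover have "smooth (\<lambda>y. bubble T y * q y)"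
    by (intro smooth_mult real_polynomial_function_smooth bubble_polynomial q)
  ultimately show ?thesis
    using smooth_directional_derivative[of "\<lambda>y. bubble T y * q y" a "b - a" s] DERIV_unique by blast
qed

text \<open>The factor \<open>bary T z\<close> vanishes on the face opposite to \<open>z\<close>, so
  in the product rule only the term with its derivative survives. In particular the gradient is
  normal to the face.\<close>

lemma bubble_face_gradient:
  assumes z: "z \<in> C" and x: "x \<in> affine hull (C - {z})" and q: "real_polynomial_function q"
  shows "grad (\<lambda>y. bubble T y * q y) x = (q x * (\<Prod>a\<in>C - {z}. bary T a x)) *\<^sub>R grad (bary T z) x"
proof -
  let ?m = "\<lambda>x. (\<Prod>a\<in>C - {z}. bary T a x) * q x"
  have "(\<lambda>y. bubble T y * q y) = (\<lambda>y. bary T z y * ?m y)"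
    by (intro ext) (simp add: bubble_eq prod.remove[OF finite_C z] mult.assoc)
  then have "grad (\<lambda>y. bubble T y * q y) x = grad (\<lambda>y. bary T z y * ?m y) x" by simp
  also have "\<dots> = bary T z x *\<^sub>R grad ?m x + ?m x *\<^sub>R grad (bary T z) x"
    using q by (intro grad_mult smooth_differentiable smooth_mult smooth_prod bary_smooth z
        real_polynomial_function_smooth) auto
  also have "bary T z x = 0" by (rule bary_zero_on_face[OF z _ _ x]) auto
  finally show ?thesis by (simp add: mult.commute)
qed

text \<open>Otherwise \<open>a + n\<close> would still have coordinate 0 at \<open>z\<close>, so
  \<open>n\<close> would be a combination of the vectors from \<open>a\<close> to vertices of the
  face, all orthogonal to \<open>n\<close>.\<close>

lemma bary_normal_nonzero:
  assumes z: "z \<in> C" and a: "a \<in> C" "a \<noteq> z" and n: "n \<noteq> 0"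
    and orth: "\<And>b. b \<in> C - {z} \<Longrightarrow> (b - a) \<bullet> n = 0"
  shows "grad (bary T z) x \<bullet> n \<noteq> 0"
proof
  assume 0: "grad (bary T z) x \<bullet> n = 0"
  obtain c w where cw: "bary T z = (\<lambda>x. c + w \<bullet> x)" using bary_polys[OF z] by (rule polys_1_cases)
  have wn: "w \<bullet> n = 0" using 0 by (simp add: cw polys_1_grad)
  have "bary T z (a + n) = bary T z a" by (simp add: cw wn inner_add_right)
  also have "\<dots> = 0" using z a by (simp add: bary_vertex)
  finally have z0: "bary T z (a + n) = 0" .
  have "n = (\<Sum>b\<in>C. bary T b (a + n) *\<^sub>R b) - (\<Sum>b\<in>C. bary T b (a + n)) *\<^sub>R a"
    by (simp add: bary_expansion bary_sum)
  also have "\<dots> = (\<Sum>b\<in>C. bary T b (a + n) *\<^sub>R (b - a))"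
    by (simp add: scaleR_diff_right sum_subtractf scaleR_sum_left)
  finally have "n \<bullet> n = (\<Sum>b\<in>C. bary T b (a + n) *\<^sub>R (b - a)) \<bullet> n" by simp
  also have "\<dots> = (\<Sum>b\<in>C. bary T b (a + n) * ((b - a) \<bullet> n))"
    by (simp add: inner_sum_left)
  also have "\<dots> = 0"
    using orth z0 by (intro sum.neutral) auto
  finally show False using n by simp
qed

text \<open>On the face the normal derivative of the bubble function is a nonzero constant times the
  bubble of the triangle times \<open>q\<close>; the reference integral turns it into a multiple of
  the sum of the vertex values.\<close>

lemma face_bubble_moment:
  assumes z: "z \<in> C" and q: "q \<in> polys 1" and n: "norm n = 1"
    and orth: "\<And>x y. x \<in> convex hull (C - {z}) \<Longrightarrow> y \<in> convex hull (C - {z}) \<Longrightarrow> (x - y) \<bullet> n = 0"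
    and zero: "(\<integral>x. grad (\<lambda>y. bubble T y * q y) x \<bullet> n \<partial>face_measure (convex hull (C - {z}))) = 0"
  shows "(\<Sum>a\<in>C - {z}. q a) = 0"
proof -
  let ?F = "convex hull (C - {z})"
  have "card (C - {z}) = 3" using card_C z finite_C by simp
  then obtain a0 b0 c0 where abc0: "C - {z} = {a0, b0, c0}" "a0 \<noteq> b0" "b0 \<noteq> c0" "a0 \<noteq> c0"
    by (auto simp: card_3_iff)
  obtain a b c where F: "?F = convex hull {a, b, c}"
    and int: "\<And>f::real^3\<Rightarrow>real. continuous_on UNIV f \<Longrightarrow>
      (\<integral>x. f x \<partial>face_measure ?F) = norm (cross3 (b - a) (c - a)) *
        (\<integral>z. indicator unit_triangle z * f (a + fst z *\<^sub>R (b - a) + snd z *\<^sub>R (c - a)) \<partial>lborel)"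
    by (rule face_integral[of ?F a0 b0 c0]) (use abc0(1) in simp, rule that)
  have ind: "\<not> affine_dependent (C - {z})" using indep affine_dependent_subset by blast
  \<comment> \<open>The three points chosen by \<open>SOME\<close> in \<open>face_measure\<close>
    are identified with the vertices of the face through the extreme points of the hull.\<close>
  have "C - {z} \<subseteq> {a, b, c}"
    using extreme_point_of_convex_hull_affine_independent[OF ind] extreme_point_of_convex_hull unfolding F by blast
  moreover have "card {a, b, c} \<le> card (C - {z})" using \<open>card (C - {z}) = 3\<close> by (simp add: card_insert_if)
  ultimately have S: "C - {z} = {a, b, c}" by (intro card_seteq) auto
  then have dist: "a \<noteq> b" "b \<noteq> c" "a \<noteq> c"
    using \<open>card (C - {z}) = 3\<close> by (auto simp: card_insert_if split: if_splits)
  have abc: "a \<in> C" "b \<in> C" "c \<in> C" "a \<noteq> z" using S by auto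
  \<comment> \<open>These gradients are dual to the two edge vectors, so the inner product of the
    cross products is the determinant of the identity matrix, and the area factor cannot be
    zero.\<close>
  have "(b - a) \<bullet> grad (bary T b) 0 = 1" "(c - a) \<bullet> grad (bary T b) 0 = 0"
      "(b - a) \<bullet> grad (bary T c) 0 = 0" "(c - a) \<bullet> grad (bary T c) 0 = 1"
  proof -
    have d: "(y - x) \<bullet> grad (bary T v) 0 = bary T v y - bary T v x" if v: "v \<in> C" for x y v
    proof -
      obtain k w where kw: "bary T v = (\<lambda>x. k + w \<bullet> x)" using bary_polys[OF v] by (rule polys_1_cases)
      show ?thesis by (simp add: kw polys_1_grad inner_diff_right inner_commute[of _ w])
    qed
    show "(b - a) \<bullet> grad (bary T b) 0 = 1" "(c - a) \<bullet> grad (bary T b) 0 = 0"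
      "(b - a) \<bullet> grad (bary T c) 0 = 0" "(c - a) \<bullet> grad (bary T c) 0 = 1"
      using abc dist by (simp_all add: d bary_vertex)
  qed
  then have "cross3 (b - a) (c - a) \<bullet> cross3 (grad (bary T b) 0) (grad (bary T c) 0) = 1"
    by (simp add: dot_cross)
  then have cross: "norm (cross3 (b - a) (c - a)) \<noteq> 0" by auto
  define \<kappa> where "\<kappa> = grad (bary T z) 0 \<bullet> n"
  have \<kappa>: "\<kappa> \<noteq> 0"
    unfolding \<kappa>_def
  proof (rule bary_normal_nonzero[OF z abc(1,4)])
    show "(v - a) \<bullet> n = 0" if "v \<in> C - {z}" for v
      using that S by (intro orth hull_inc) auto
  qed (use n in auto)
  have gz: "grad (bary T z) x \<bullet> n = \<kappa>" for x
  proof -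
    obtain k w where kw: "bary T z = (\<lambda>x. k + w \<bullet> x)" using bary_polys[OF z] by (rule polys_1_cases)
    show ?thesis by (simp add: \<kappa>_def kw polys_1_grad)
  qed
  have qp: "real_polynomial_function q" using q by (rule polys_real_polynomial_function)
  have cont: "continuous_on UNIV (\<lambda>x. grad (\<lambda>y. bubble T y * q y) x \<bullet> n)"
    by (intro continuous_intros smooth_grad_continuous_on smooth_mult real_polynomial_function_smooth
        bubble_polynomial qp)
  have val: "grad (\<lambda>y. bubble T y * q y) (a + s *\<^sub>R (b - a) + t *\<^sub>R (c - a)) \<bullet> n =
      \<kappa> * ((1 - s - t) * s * t * (q a + (q b - q a) * s + (q c - q a) * t))" for s t
  proof -
    let ?x = "a + s *\<^sub>R (b - a) + t *\<^sub>R (c - a)"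
    have "?x = (1 - s - t) *\<^sub>R a + s *\<^sub>R b + t *\<^sub>R c" by (simp add: algebra_simps)
    then have "?x \<in> affine hull (C - {z})"
      unfolding S affine_hull_3 by (intro CollectI exI[of _ "1 - s - t"] exI[of _ s] exI[of _ t]) simp
    then have "grad (\<lambda>y. bubble T y * q y) ?x \<bullet> n = (q ?x * (\<Prod>v\<in>C - {z}. bary T v ?x)) * \<kappa>"
      by (simp add: bubble_face_gradient[OF z _ qp] gz)
    also have "(\<Prod>v\<in>C - {z}. bary T v ?x) = (1 - s - t) * s * t"
    proof -
      have "bary T a ?x = 1 - s - t" "bary T b ?x = s" "bary T c ?x = t"
        unfolding polys_1_affine_combination[OF bary_polys[OF abc(1)]] polys_1_affine_combination[OF bary_polys[OF abc(2)]]
          polys_1_affine_combination[OF bary_polys[OF abc(3)]]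
        using dist abc by (simp_all add: bary_vertex)
      then show ?thesis unfolding S using dist by (simp add: mult.assoc)
    qed
    also have "q ?x = q a + (q b - q a) * s + (q c - q a) * t"
      unfolding polys_1_affine_combination[OF q] by (simp add: algebra_simps)
    finally show ?thesis by (simp add: mult_ac)
  qed
  have "0 = (\<integral>p. indicator unit_triangle p *
      (\<kappa> * ((1 - fst p - snd p) * fst p * snd p * (q a + (q b - q a) * fst p + (q c - q a) * snd p))) \<partial>lborel)"
    using zero int[OF cont] cross by (simp add: val)
  also have "\<dots> = \<kappa> * ((3 * q a + (q b - q a) + (q c - q a)) / 360)"
    unfolding unit_triangle_bubble_integral[symmetric] by (simp add: mult.left_commute)
  finally have "q a + q b + q c = 0" using \<kappa> by simp
  then show ?thesis unfolding S using dist by simp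
qed

text \<open>Each hypothesis says that \<open>q z\<close> equals the sum S over all vertices; adding
  the four equations gives S = 4 S.\<close>

lemma bubble_unisolvent:
  assumes q: "q \<in> polys 1" and zero: "\<And>z. z \<in> C \<Longrightarrow> (\<Sum>a\<in>C - {z}. q a) = 0"
  shows "q x = 0"
proof -
  have eq: "q z = sum q C" if "z \<in> C" for z
    using zero[OF that] sum.remove[OF finite_C that, of q] by simp
  have "sum q C = (\<Sum>z\<in>C. sum q C)" by (rule sum.cong[OF refl]) (rule eq)
  then have "sum q C = 0" using card_C by simp
  then have "q z = 0" if "z \<in> C" for z using eq[OF that] by simp
  then show ?thesis by (rule polys_1_eqI[OF q polys_const])
qed

end

section \<open>Fields supported on single elements\<close>

context meshed_domain
begin

lemma mesh_tetrahedron: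
  assumes "T \<in> \<T>"
  obtains C where "tetrahedron C T"
proof -
  obtain C where C: "\<not> affine_dependent C" "int (card C) = 3 + 1" "T = convex hull C"
    using mesh_simplex[OF assms] unfolding simplex_def by blast
  have "card C = 4" using C(2) by linarith
  then have "tetrahedron C T" using C by unfold_locales auto
  then show thesis by (rule that)
qed

text \<open>The product of \<open>\<phi>\<close> and \<open>f\<close>, cut off outside
  \<open>T\<close>, is not smooth but Lipschitz, because it vanishes on the frontier. Its
  directional derivative exists off the frontier, a negligible set, so the translation argument
  applies with constant weight 1.\<close>

lemma integral_by_parts_on_element:
  assumes T: "T \<in> \<T>" and f: "smooth f" "\<And>x. x \<in> frontier T \<Longrightarrow> f x = 0" and \<phi>: "\<phi> \<in> test S"
  shows "(\<integral>x. indicator (interior T) x * (f x * pd i \<phi> x) \<partial>lborel) =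
    - (\<integral>x. indicator (interior T) x * (pd i f x * \<phi> x) \<partial>lborel)"
proof -
  define G where "G x = \<phi> x * f x" for x
  have Gt: "G \<in> test S" unfolding G_def[abs_def] by (rule test_mult[OF \<phi> f(1)])
  have Gs: "smooth G" using Gt by (rule test_smooth)
  obtain M R where b: "M \<ge> 0" "\<And>x. \<bar>G x\<bar> \<le> M" "\<And>x. norm x \<ge> R \<Longrightarrow> G x = 0"
      "\<And>x y. \<bar>G x - G y\<bar> \<le> M * norm (x - y)"
    using Gt by (rule test_bounds) blast
  define F where "F x = (if x \<in> T then G x else 0)" for x
  have closed: "closed T" using mesh_compact[OF T] by (rule compact_imp_closed)
  \<comment> \<open>A segment leaving \<open>T\<close> crosses the frontier, where \<open>G\<close>
    is zero; the Lipschitz bound of \<open>G\<close> up to the crossing point suffices.\<close>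
  have out: "\<bar>G x\<bar> \<le> M * norm (x - y)" if xy: "x \<in> T" "y \<notin> T" for x y
  proof -
    have "closed_segment x y \<inter> frontier T \<noteq> {}"
      using xy by (intro connected_Int_frontier) auto
    then obtain z where z: "z \<in> closed_segment x y" "z \<in> frontier T" by blast
    have "G z = 0" using f(2)[OF z(2)] by (simp add: G_def)
    then have "\<bar>G x\<bar> \<le> M * norm (x - z)" using b(4)[of x z] by simp
    also have "\<dots> \<le> M * norm (x - y)"
      using segment_bound1[OF z(1)] b(1) by (intro mult_left_mono) (simp_all add: norm_minus_commute)
    finally show ?thesis .
  qed
  have lip: "\<bar>F x - F y\<bar> \<le> M * norm (x - y)" for x y
    using b(4)[of x y] out[of x y] out[of y x] b(1) by (auto simp: F_def norm_minus_commute)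
  define D where "D x = indicator (interior T) x * pd i G x" for x
  have "(\<integral>x. 1 * D x \<partial>lborel) = 0"
  proof (rule integral_invariant_derivative_eq_0[of _ 1 "axis i 1" F M M R])
    show "D \<in> borel_measurable borel"
      unfolding D_def[abs_def]
      by (intro borel_measurable_times borel_measurable_indicator smooth_borel smooth_pd Gs) auto
    have "negligible (frontier T)" using mesh_convex[OF T] by (rule negligible_convex_frontier)
    then have "frontier T \<in> null_sets lborel"
      by (simp add: negligible_iff_null_sets null_sets_completion_iff)
    then show "AE x in lborel. ((\<lambda>s. F (x + s *\<^sub>R axis i 1)) has_real_derivative D x) (at 0)"
    proof (rule AE_I')
      have "((\<lambda>s. F (x + s *\<^sub>R axis i 1)) has_real_derivative D x) (at 0)" if nf: "x \<notin> frontier T" for x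
      proof (cases "x \<in> T")
        case True
        then have int: "x \<in> interior T" using nf closed by (simp add: frontier_def)
        have o: "open ((\<lambda>s::real. x + s *\<^sub>R axis i 1) -` interior T)"
          by (intro open_vimage continuous_intros) auto
        have d: "((\<lambda>s. G (x + s *\<^sub>R axis i 1)) has_real_derivative D x) (at 0)"
          using smooth_directional_derivative[OF Gs, of x "axis i 1" 0] int by (simp add: D_def inner_axis)
        show ?thesis
          by (rule has_field_derivative_transform_within_open[OF d o])
            (use int interior_subset[of T] in \<open>auto simp: F_def\<close>)
      next
        case False
        have o: "open ((\<lambda>s::real. x + s *\<^sub>R axis i 1) -` (- T))"
          using closed by (intro open_vimage continuous_intros) auto
        have d: "((\<lambda>s. 0) has_real_derivative D x) (at 0)"
          using False interior_subset[of T] by (auto simp: D_def indicator_def)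
        show ?thesis
          by (rule has_field_derivative_transform_within_open[OF d o]) (use False in \<open>auto simp: F_def\<close>)
      qed
      then show "{x \<in> space lborel. \<not> ((\<lambda>s. F (x + s *\<^sub>R axis i 1)) has_real_derivative D x) (at 0)} \<subseteq> frontier T"
        by blast
    qed
  qed (use b(1,2,3) lip in \<open>auto simp: F_def\<close>)
  then have D0: "(\<integral>x. D x \<partial>lborel) = 0" by simp
  have i: "integrable lborel (\<lambda>x. indicator (interior T) x * g x)" if "g \<in> test S" for g
    using integrable_mult_indicator[OF _ test_integrable[OF that], of "interior T"] by simp
  have i1: "integrable lborel (\<lambda>x. indicator (interior T) x * (f x * pd i \<phi> x))"
    using i[OF test_mult[OF test_pd[OF \<phi>] f(1)]] by (simp add: mult.commute[of "f _"])
  have i2: "integrable lborel (\<lambda>x. indicator (interior T) x * (pd i f x * \<phi> x))"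
    using i[OF test_mult[OF \<phi> smooth_pd[OF f(1)]]] by (simp add: mult.commute[of "\<phi> _"])
  have "D x = indicator (interior T) x * (f x * pd i \<phi> x) + indicator (interior T) x * (pd i f x * \<phi> x)" for x
    unfolding D_def G_def
    by (simp add: pd_mult[OF smooth_differentiable[OF test_smooth[OF \<phi>]] smooth_differentiable[OF f(1)]] algebra_simps)
  then show ?thesis using D0 i1 i2 by simp
qed

text \<open>Each piece vanishes on the frontier of its own element, so no jump terms arise across
  faces and the elementwise integrations by parts simply add up.\<close>

lemma glue_weak_grad:
  assumes f: "\<And>T. T \<in> \<T> \<Longrightarrow> smooth (f T)" "\<And>T x. T \<in> \<T> \<Longrightarrow> x \<in> frontier T \<Longrightarrow> f T x = 0"
  shows "has_weak_grad \<Omega> (glue f) (glue (\<lambda>T. grad (f T)))"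
  unfolding has_weak_grad_iff[OF dom]
proof (intro conjI ballI allI)
  have cf: "\<And>T. T \<in> \<T> \<Longrightarrow> continuous_on UNIV (f T)" and cg: "\<And>T. T \<in> \<T> \<Longrightarrow> continuous_on UNIV (grad (f T))"
    by (auto intro: smooth_continuous_on smooth_grad_continuous_on f)
  show "glue f \<in> L2 \<Omega>" "glue (\<lambda>T. grad (f T)) \<in> L2 \<Omega>" by (intro glue_L2 cf cg; assumption)+
  fix \<phi> i assume \<phi>: "\<phi> \<in> test \<Omega>"
  have \<phi>m: "\<phi> \<in> borel_measurable borel" "pd i \<phi> \<in> borel_measurable borel"
    by (intro smooth_borel smooth_pd test_smooth[OF \<phi>])+
  have ii: "integrable lborel (\<lambda>x. indicator (interior T) x * g x)" if "g \<in> test \<Omega>" for g T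
    using integrable_mult_indicator[OF _ test_integrable[OF that], of "interior T"] by simp
  have i1: "integrable lborel (\<lambda>x. indicator (interior T) x * (f T x * pd i \<phi> x))" if "T \<in> \<T>" for T
    using ii[OF test_mult[OF test_pd[OF \<phi>] f(1)[OF that]]] by (simp add: mult.commute[of "f T _"])
  have i2: "integrable lborel (\<lambda>x. indicator (interior T) x * (pd i (f T) x * \<phi> x))" if "T \<in> \<T>" for T
    using ii[OF test_mult[OF \<phi> smooth_pd[OF f(1)[OF that]]]] by (simp add: mult.commute[of "\<phi> _"])
  have gi: "glue (\<lambda>T. grad (f T)) x $ i = glue (\<lambda>T. pd i (f T)) x" for x
    by (simp add: glue_def)
  have gm: "glue f \<in> borel_measurable borel" "glue (\<lambda>T. pd i (f T)) \<in> borel_measurable borel"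
    by (intro glue_borel cf smooth_continuous_on smooth_pd f; assumption)+
  have "(\<integral>x. glue f x * pd i \<phi> x \<partial>lebesgue_on \<Omega>) = (\<integral>x. glue f x * pd i \<phi> x \<partial>lborel)"
    using gm \<phi>m open_domain by (intro integral_lebesgue_on_eq_lborel borel_measurable_times) (auto simp: glue_outside)
  also have "\<dots> = (\<integral>x. (\<Sum>T\<in>\<T>. indicator (interior T) x * (f T x * pd i \<phi> x)) \<partial>lborel)"
    by (simp add: glue_def sum_distrib_right mult.assoc)
  also have "\<dots> = (\<Sum>T\<in>\<T>. \<integral>x. indicator (interior T) x * (f T x * pd i \<phi> x) \<partial>lborel)"
    using i1 by (rule Bochner_Integration.integral_sum)
  also have "\<dots> = (\<Sum>T\<in>\<T>. - (\<integral>x. indicator (interior T) x * (pd i (f T) x * \<phi> x) \<partial>lborel))"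
    by (intro sum.cong refl integral_by_parts_on_element[OF _ _ _ \<phi>] f)
  also have "\<dots> = - (\<integral>x. (\<Sum>T\<in>\<T>. indicator (interior T) x * (pd i (f T) x * \<phi> x)) \<partial>lborel)"
    unfolding sum_negf using i2 by (subst Bochner_Integration.integral_sum) auto
  also have "\<dots> = - (\<integral>x. glue (\<lambda>T. pd i (f T)) x * \<phi> x \<partial>lborel)"
    by (simp add: glue_def sum_distrib_right mult.assoc)
  also have "(\<integral>x. glue (\<lambda>T. pd i (f T)) x * \<phi> x \<partial>lborel) = (\<integral>x. glue (\<lambda>T. pd i (f T)) x * \<phi> x \<partial>lebesgue_on \<Omega>)"
    using gm \<phi>m open_domain
    by (intro integral_lebesgue_on_eq_lborel[symmetric] borel_measurable_times) (auto simp: glue_outside)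
  finally show "(\<integral>x. glue f x * pd i \<phi> x \<partial>lebesgue_on \<Omega>) =
      - (\<integral>x. glue (\<lambda>T. grad (f T)) x $ i * \<phi> x \<partial>lebesgue_on \<Omega>)"
    by (simp add: gi)
qed

end

section \<open>Comparison of the degrees of freedom\<close>

lemma mem_edge: "0 \<le> s \<Longrightarrow> s \<le> 1 \<Longrightarrow> a + s *\<^sub>R (b - a) \<in> convex hull {a, b}" for a b :: "real^3"
  unfolding segment_convex_hull[symmetric] in_segment by (intro exI[of _ s]) (simp add: algebra_simps)

lemma edge_param:
  fixes a b :: "real^3"
  assumes "x \<in> convex hull {a, b}"
  obtains s where "0 \<le> s" "s \<le> 1" "x = a + s *\<^sub>R (b - a)"
  using assms unfolding segment_convex_hull[symmetric] in_segment by (auto simp: algebra_simps)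

lemma edge_integrable:
  fixes f :: "real^3 \<Rightarrow> real"
  assumes "e = convex hull {a, b}" "a \<noteq> b" "continuous_on UNIV f"
  shows "integrable (edge_measure e) f"
  by (rule edge_integral_endpoints[OF assms(1,2)]) (use assms(3) in blast)

lemma edge_integral_cong:
  fixes f g :: "real^3 \<Rightarrow> real"
  assumes e: "e = convex hull {a, b}" "a \<noteq> b" and f: "continuous_on UNIV f" and g: "continuous_on UNIV g"
    and eq: "\<And>x. x \<in> e \<Longrightarrow> f x = g x"
  shows "(\<integral>x. f x \<partial>edge_measure e) = (\<integral>x. g x \<partial>edge_measure e)"
proof (rule edge_integral_endpoints[OF e])
  fix c d assume cd: "{c, d} = {a, b}"
    and *: "\<And>f::real^3\<Rightarrow>real. continuous_on UNIV f \<Longrightarrow>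
      (\<integral>x. f x \<partial>edge_measure e) = dist c d * integral {0..1} (\<lambda>s. f (c + s *\<^sub>R (d - c)))"
  have "integral {0..1} (\<lambda>s. f (c + s *\<^sub>R (d - c))) = integral {0..1} (\<lambda>s. g (c + s *\<^sub>R (d - c)))"
    by (intro Henstock_Kurzweil_Integration.integral_cong eq) (use mem_edge[of _ c d] e(1) cd in auto)
  then show ?thesis by (simp add: *[OF f] *[OF g])
qed

text \<open>Along the edge \<open>q\<close> is \<alpha> + \<beta> s, and the mean of its square is
  (\<alpha> + \<beta>/2)^2 + \<beta>^2/12, which determines both end values.\<close>

lemma edge_square_zero:
  assumes e: "e = convex hull {a, b}" "a \<noteq> b" and q: "q \<in> polys 1"
    and zero: "(\<integral>x. q x * q x \<partial>edge_measure e) = 0"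
  shows "q a = 0" "q b = 0"
proof -
  have c: "continuous_on UNIV (\<lambda>x. q x * q x)"
    by (intro smooth_continuous_on smooth_mult real_polynomial_function_smooth polys_real_polynomial_function[OF q])
  have "q a = 0 \<and> q b = 0"
  proof (rule edge_integral_endpoints[OF e])
    fix c' d' assume cd: "{c', d'} = {a, b}"
      and *: "\<And>f::real^3\<Rightarrow>real. continuous_on UNIV f \<Longrightarrow>
        (\<integral>x. f x \<partial>edge_measure e) = dist c' d' * integral {0..1} (\<lambda>s. f (c' + s *\<^sub>R (d' - c')))"
    have ne: "c' \<noteq> d'" using cd e(2) by (auto simp: doubleton_eq_iff)
    define \<alpha> \<beta> where "\<alpha> = q c'" and "\<beta> = q d' - q c'"
    have line: "q (c' + s *\<^sub>R (d' - c')) = \<alpha> + \<beta> * s" for s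
      using polys_1_affine_combination[OF q, of c' s d' 0 c'] by (simp add: \<alpha>_def \<beta>_def mult.commute)
    have "((\<lambda>s. (\<alpha> + \<beta> * s) * (\<alpha> + \<beta> * s)) has_integral
        ((\<alpha>\<^sup>2 * 1 + \<alpha> * \<beta> * 1\<^sup>2 + \<beta>\<^sup>2 * 1 ^ 3 / 3) - (\<alpha>\<^sup>2 * 0 + \<alpha> * \<beta> * 0\<^sup>2 + \<beta>\<^sup>2 * 0 ^ 3 / 3))) {0..1}"
      by (intro fundamental_theorem_of_calculus)
        (auto intro!: derivative_eq_intros simp: has_real_derivative_iff_has_vector_derivative[symmetric] power2_eq_square algebra_simps)
    then have "integral {0..1} (\<lambda>s. (\<alpha> + \<beta> * s) * (\<alpha> + \<beta> * s)) = \<alpha>\<^sup>2 + \<alpha> * \<beta> + \<beta>\<^sup>2 / 3"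
      by (simp add: integral_unique)
    then have "\<alpha>\<^sup>2 + \<alpha> * \<beta> + \<beta>\<^sup>2 / 3 = 0"
      using zero ne unfolding *[OF c] line by simp
    then have "(\<alpha> + \<beta> / 2)\<^sup>2 + \<beta>\<^sup>2 / 12 = 0"
      by (simp add: power2_sum power_divide)
    then have "\<beta>\<^sup>2 / 12 = 0" "(\<alpha> + \<beta> / 2)\<^sup>2 = 0"
      using zero_le_power2[of \<beta>] zero_le_power2[of "\<alpha> + \<beta> / 2"] by linarith+
    then have "q c' = 0" "q d' = 0" by (simp_all add: \<alpha>_def \<beta>_def)
    then show ?thesis using cd by (auto simp: doubleton_eq_iff)
  qed
  then show "q a = 0" "q b = 0" by auto
qed

lemma vpolys_inner: "p \<in> vpolys 1 \<Longrightarrow> (\<lambda>x. p x \<bullet> t) \<in> polys 1"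
  unfolding inner_vec_def inner_real_def vpolys_def component_def[abs_def]
  by (intro polys_sum) (simp add: mult.commute[of _ "t $ _"] polys_cmult)

lemma vpolys_diff: "p \<in> vpolys 1 \<Longrightarrow> q \<in> vpolys 1 \<Longrightarrow> (\<lambda>x. p x - q x) \<in> vpolys 1"
  using polys_add[OF _ polys_cmult[of _ 1 "- 1"]] by (auto simp: vpolys_def component_def[abs_def])

lemma polys_diff: "p \<in> polys k \<Longrightarrow> q \<in> polys k \<Longrightarrow> (\<lambda>x. p x - q x) \<in> polys k"
  using polys_add[OF _ polys_cmult[of _ k "- 1"]] by simp

lemma vpolys_continuous: "p \<in> vpolys k \<Longrightarrow> continuous_on S p"
  by (subst continuous_on_componentwise)
    (auto simp: vpolys_def Basis_vec_def inner_axis component_def[abs_def] intro: polys_continuous)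

context tetrahedron
begin

lemma face_simplex:
  assumes "S \<subseteq> C" "int (card S) = k + 1"
  shows "convex hull S face_of T" "k simplex (convex hull S)"
proof -
  show "convex hull S face_of T"
    unfolding T_def face_of_convex_hull_affine_independent[OF indep] using assms(1) by blast
  have "\<not> affine_dependent S" using indep assms(1) affine_dependent_subset by blast
  then show "k simplex (convex hull S)" using assms(2) by (simp add: simplex_convex_hull)
qed

lemma bubble_grad_continuous:
  "q \<in> polys 1 \<Longrightarrow> continuous_on S (grad (\<lambda>y. bubble T y * q y))"
  by (intro smooth_grad_continuous_on smooth_mult real_polynomial_function_smooth bubble_polynomial
      polys_real_polynomial_function)

lemma bubble_grad_polynomial:
  "q \<in> polys 1 \<Longrightarrow> real_polynomial_function (pd i (\<lambda>y. bubble T y * q y))"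
  by (intro real_polynomial_function_pd real_polynomial_function.intros(4) bubble_polynomial
      polys_real_polynomial_function)

end

section \<open>Affine and quadratic parts of the interpolants\<close>

context meshed_domain
begin

lemma restr_piece:
  "T \<in> \<T> \<Longrightarrow> real_polynomial_function p \<Longrightarrow> AE x in lebesgue_on T. v x = p x \<Longrightarrow> restr T v = p"
  by (intro restr_eq mesh_lebesgue mesh_interior)

lemma vrestr_piece:
  assumes "T \<in> \<T>" "\<And>i. real_polynomial_function (component i P)" "AE x in lebesgue_on T. v x = P x"
  shows "vrestr T v = P"
proof -
  have "restr T (component i v) = component i P" for i
    using assms(3) by (intro restr_piece assms(1,2)) (auto simp: component_def)
  then show ?thesis by (simp add: vrestr_def fun_eq_iff vec_eq_iff component_def)
qed

lemma subsimplexI: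
  assumes "T \<in> \<T>" "tetrahedron C T" "S \<subseteq> C" "int (card S) = k + 1"
  shows "convex hull S \<in> subsimplices \<T> k"
  using tetrahedron.face_simplex[OF assms(2-4)] assms(1) by (auto simp: subsimplices_def)

lemma oriented_edge:
  assumes "oriented \<T> tng nrm" "convex hull {a, b} \<in> subsimplices \<T> 1" "a \<noteq> b"
  obtains \<kappa> where "\<kappa> \<noteq> 0" "b - a = \<kappa> *\<^sub>R tng (convex hull {a, b})"
proof -
  have "b \<in> convex hull {a, b}" "a \<in> convex hull {a, b}" by (auto intro: hull_inc)
  then have "b - a \<in> span {tng (convex hull {a, b})}"
    using assms(1,2) unfolding oriented_def by blast
  then obtain \<kappa> where k: "b - a = \<kappa> *\<^sub>R tng (convex hull {a, b})"
    unfolding span_singleton by auto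
  then have "\<kappa> \<noteq> 0" using assms(3) by auto
  then show thesis using k by (rule that)
qed

text \<open>The magnification point must lie inside the edge: there every element that contains the
  point contains the whole edge, as the invariance of its cone requires, whereas this fails at an
  endpoint. The value at \<open>a\<close> is recovered because the tangential component is affine
  along the edge.\<close>

lemma ND_boundary_edge:
  assumes v: "v \<in> H0curl \<Omega>" and r: "\<And>T. T \<in> \<T> \<Longrightarrow> r T \<in> vpolys 1"
    and vr: "\<And>T. T \<in> \<T> \<Longrightarrow> AE x in lebesgue_on T. v x = r T x"
    and T: "T \<in> \<T>" and face: "convex hull {a, b} face_of T" and ab: "a \<noteq> b"
    and bd: "convex hull {a, b} \<subseteq> frontier \<Omega>" and \<kappa>: "\<kappa> \<noteq> 0" "b - a = \<kappa> *\<^sub>R t"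
  shows "r T a \<bullet> t = 0"
proof -
  \<comment> \<open>A step \<open>s'\<close> along \<open>t\<close> changes the edge parameter by
    \<open>s' / \<kappa>\<close>, which has to stay below the distance of \<open>s\<close> to 0 and
    to 1; this gives the radius.\<close>
  have zero: "r T (a + s *\<^sub>R (b - a)) \<bullet> t = 0" if s: "0 < s" "s < 1" for s
  proof (rule H0curl_boundary_edge[OF v _ vr, where \<delta> = "\<bar>\<kappa>\<bar> * min s (1 - s)"])
    let ?x = "a + s *\<^sub>R (b - a)"
    have xe: "?x \<in> convex hull {a, b}" using s by (intro mem_edge) auto
    show "?x \<in> frontier \<Omega>" using xe bd by blast
    show "?x \<in> T" using xe face face_of_imp_subset by blast
    show "real_polynomial_function (component i (r T))" if "T \<in> \<T>" for T i
      using r[OF that] by (auto simp: vpolys_def intro: polys_real_polynomial_function)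
    show "0 < \<bar>\<kappa>\<bar> * min s (1 - s)" using \<kappa>(1) s by simp
    show "?x + s' *\<^sub>R t \<in> T'" if T': "T' \<in> \<T>" "?x \<in> T'" and s': "\<bar>s'\<bar> < \<bar>\<kappa>\<bar> * min s (1 - s)" for T' s'
    proof -
      \<comment> \<open>Conformity of the mesh: \<open>T \<inter> T'\<close> is a face of
        \<open>T\<close> that meets the relative interior of the edge, hence contains the
        edge.\<close>
      have "?x \<in> open_segment a b"
        using s ab by (auto simp: in_segment intro!: exI[of _ s] simp: algebra_simps)
      then have "?x \<in> rel_interior (convex hull {a, b})"
        using ab by (simp add: segment_convex_hull[symmetric] rel_interior_closed_segment)
      moreover have "?x \<in> T \<inter> T'" using xe face face_of_imp_subset T'(2) by blast
      ultimately have sub: "convex hull {a, b} \<subseteq> T \<inter> T'"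
        using face face_of_imp_subset
        by (intro subset_of_face_of[OF mesh_face_inter[OF T T'(1)]]) auto
      have eq: "?x + s' *\<^sub>R t = a + (s + s' / \<kappa>) *\<^sub>R (b - a)"
      proof -
        have "(s + s' / \<kappa>) * \<kappa> = s * \<kappa> + s'" using \<kappa>(1) by (simp add: distrib_right)
        then show ?thesis unfolding \<kappa>(2) by (simp add: scaleR_add_left)
      qed
      have "a + (s + s' / \<kappa>) *\<^sub>R (b - a) \<in> convex hull {a, b}"
      proof (rule mem_edge)
        have "0 < \<bar>\<kappa>\<bar>" using \<kappa>(1) by simp
        then have "\<bar>s'\<bar> / \<bar>\<kappa>\<bar> < min s (1 - s)"
          using s' by (simp only: pos_divide_less_eq mult.commute)
        then have "\<bar>s' / \<kappa>\<bar> < min s (1 - s)" by (simp only: abs_divide)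
        then show "0 \<le> s + s' / \<kappa>" "s + s' / \<kappa> \<le> 1" by linarith+
      qed
      then show ?thesis unfolding eq using sub by blast
    qed
  qed (use T in auto)
  \<comment> \<open>Two interior zeros, at one third and at two thirds of the edge, determine the
    affine function.\<close>
  have "(\<lambda>x. r T x \<bullet> t) \<in> polys 1" by (intro vpolys_inner r T)
  note line = polys_1_affine_combination[OF this, of a _ b 0 a]
  have "r T a \<bullet> t + (1/3) * (r T b \<bullet> t - r T a \<bullet> t) = 0" "r T a \<bullet> t + (2/3) * (r T b \<bullet> t - r T a \<bullet> t) = 0"
    using zero[of "1/3"] zero[of "2/3"] line[of "1/3"] line[of "2/3"] by simp_all
  then show ?thesis by linarith
qed

text \<open>It suffices that the difference \<open>d\<close> of the affine parts has no component
  along any edge at its vertices. This is obtained on each edge by using a tangential component as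
  its own weight in the moments, so that a square integrates to zero.\<close>

lemma Phi_h_decomposition:
  assumes orient: "oriented \<T> tng nrm"
    and \<Phi>: "\<Phi> \<in> Phi_h \<Omega> \<T> tng nrm" and \<Psi>: "\<Psi> \<in> Vh_ND \<Omega> \<T>"
    and agree: "\<And>q. q \<in> polys 1 \<Longrightarrow>
      agree_interior \<Omega> \<T> 1 (dof_tangential tng q \<Phi>) (dof_tangential tng q \<Psi>)"
    and T: "T \<in> \<T>"
  obtains q where "q \<in> polys 1" "vrestr T \<Psi> \<in> vpolys 1"
    "AE x in lebesgue_on T. \<Psi> x = vrestr T \<Psi> x"
    "vrestr T \<Phi> = (\<lambda>x. vrestr T \<Psi> x + grad (\<lambda>y. bubble T y * q y) x)"
    "AE x in lebesgue_on T. \<Phi> x = vrestr T \<Psi> x + grad (\<lambda>y. bubble T y * q y) x"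
proof -
  have \<Psi>0: "\<Psi> \<in> H0curl \<Omega>" using \<Psi> by (simp add: Vh_ND_def)
  have r: "vrestr T \<Psi> \<in> vpolys 1 \<and> (AE x in lebesgue_on T. \<Psi> x = vrestr T \<Psi> x)" if T: "T \<in> \<T>" for T
  proof -
    obtain p where p: "p \<in> vpolys 1" "AE x in lebesgue_on T. \<Psi> x = p x"
      using \<Psi> T unfolding Vh_ND_def piecewise_def by blast
    have "vrestr T \<Psi> = p"
      using p by (intro vrestr_piece T) (auto simp: vpolys_def intro: polys_real_polynomial_function)
    then show ?thesis using p by simp
  qed
  obtain C where "tetrahedron C T" using T by (rule mesh_tetrahedron)
  then interpret tetrahedron C T .
  obtain \<Phi>' where \<Phi>': "\<Phi>' \<in> Phi_loc T" "AE x in lebesgue_on T. \<Phi> x = \<Phi>' x"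
    using \<Phi> T unfolding Phi_h_def piecewise_def by blast
  then obtain p q where p: "p \<in> vpolys 1" and q: "q \<in> polys 1"
    and \<Phi>'_eq: "\<Phi>' = (\<lambda>x. p x + grad (\<lambda>y. bubble T y * q y) x)"
    unfolding Phi_loc_def by blast
  let ?g = "grad (\<lambda>y. bubble T y * q y)"
  have v\<Phi>: "vrestr T \<Phi> = \<Phi>'"
  proof (rule vrestr_piece[OF T _ \<Phi>'(2)])
    fix i
    have "component i \<Phi>' = (\<lambda>x. component i p x + pd i (\<lambda>y. bubble T y * q y) x)"
      by (simp add: \<Phi>'_eq component_def fun_eq_iff)
    moreover have "real_polynomial_function (component i p)"
      using p polys_real_polynomial_function unfolding vpolys_def by blast
    ultimately show "real_polynomial_function (component i \<Phi>')"
      using real_polynomial_function.intros(3) bubble_grad_polynomial[OF q, of i] by simp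
  qed
  define d where "d x = p x - vrestr T \<Psi> x" for x
  have rT: "vrestr T \<Psi> \<in> vpolys 1" using r[OF T] by simp
  have dp: "d \<in> vpolys 1" unfolding d_def[abs_def] by (intro vpolys_diff p rT)
  have "d a \<bullet> (b - a) = 0" if a: "a \<in> C" and b: "b \<in> C" for a b
  proof (cases "a = b")
    case False
    define e where "e = convex hull {a, b}"
    have card2: "int (card {a, b}) = 1 + 1" using False by simp
    have eS: "e \<in> subsimplices \<T> 1" and eT: "e face_of T"
      unfolding e_def using a b card2
      by (auto intro!: subsimplexI[OF T \<open>tetrahedron C T\<close>] face_simplex(1)[of _ 1])
    obtain \<kappa> where \<kappa>: "\<kappa> \<noteq> 0" "b - a = \<kappa> *\<^sub>R tng e"
      using oriented_edge[OF orient, of a b] eS False unfolding e_def by blast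
    let ?t = "tng e"
    have g0: "?g x \<bullet> ?t = 0" if xe: "x \<in> e" for x
    proof -
      obtain s where x: "x = a + s *\<^sub>R (b - a)" using xe unfolding e_def by (rule edge_param) blast
      have "?g x \<bullet> (b - a) = 0"
        unfolding x by (intro bubble_edge_tangent a b polys_real_polynomial_function[OF q])
      then show ?thesis using \<kappa> by simp
    qed
    have cg: "continuous_on UNIV ?g" by (rule bubble_grad_continuous[OF q])
    \<comment> \<open>The bubble gradient has no tangential component on the edge, so the moments
      see only the affine part \<open>p\<close>.\<close>
    have moment: "dof_tangential tng \<rho> \<Phi> T e = (\<integral>x. (p x \<bullet> ?t) * \<rho> x \<partial>edge_measure e)" if "\<rho> \<in> polys 1" for \<rho>
      unfolding dof_tangential_def v\<Phi> \<Phi>'_eq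
      using g0 by (intro edge_integral_cong[OF e_def False] continuous_intros cg vpolys_continuous[OF p]
          polys_continuous[OF that]) (simp add: inner_add_left)
    have "d a \<bullet> ?t = 0"
    proof (cases "e \<subseteq> frontier \<Omega>")
      case True
      \<comment> \<open>On a boundary edge the two parts vanish separately: \<open>p\<close> because
        its moments are zero against every affine weight, and the part from \<Psi> by
        magnification.\<close>
      have pt: "(\<lambda>x. p x \<bullet> ?t) \<in> polys 1" by (rule vpolys_inner[OF p])
      have "dof_tangential tng (\<lambda>x. p x \<bullet> ?t) \<Phi> T e = 0"
        using \<Phi> pt eS T eT True unfolding Phi_h_def vanishing_def by blast
      then have "p a \<bullet> ?t = 0"
        unfolding moment[OF pt] by (rule edge_square_zero(1)[OF e_def False pt])
      moreover have "vrestr T \<Psi> a \<bullet> ?t = 0"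
        by (rule ND_boundary_edge[OF \<Psi>0 _ _ T eT[unfolded e_def] False True[unfolded e_def] \<kappa>]) (use r in auto)
      ultimately show ?thesis by (simp add: d_def inner_diff_left)
    next
      case interior: False
      \<comment> \<open>The moments agree for every affine weight, so the tangential component of
        the difference is admissible as the weight.\<close>
      let ?q = "\<lambda>x. d x \<bullet> ?t"
      have dt: "?q \<in> polys 1" by (rule vpolys_inner[OF dp])
      have "dof_tangential tng ?q \<Phi> T e = dof_tangential tng ?q \<Psi> T e"
        using agree[OF dt] eS T eT interior unfolding agree_interior_def by blast
      then have "(\<integral>x. (p x \<bullet> ?t) * ?q x \<partial>edge_measure e) = (\<integral>x. (vrestr T \<Psi> x \<bullet> ?t) * ?q x \<partial>edge_measure e)"
        unfolding moment[OF dt] by (simp add: dof_tangential_def)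
      moreover have "integrable (edge_measure e) (\<lambda>x. (w x \<bullet> ?t) * ?q x)" if "w \<in> vpolys 1" for w
        by (intro edge_integrable[OF e_def False] continuous_intros vpolys_continuous[OF that] polys_continuous[OF dt])
      moreover have "(\<lambda>x. ?q x * ?q x) = (\<lambda>x. (p x \<bullet> ?t) * ?q x - (vrestr T \<Psi> x \<bullet> ?t) * ?q x)"
        by (simp add: d_def inner_diff_left left_diff_distrib)
      ultimately have "(\<integral>x. ?q x * ?q x \<partial>edge_measure e) = 0"
        using p rT by simp
      then show ?thesis by (rule edge_square_zero(1)[OF e_def False dt])
    qed
    then show ?thesis using \<kappa> by simp
  qed simp
  then have "d x = 0" for x by (rule vpolys_1_zero[OF dp])
  then have "p = vrestr T \<Psi>" by (simp add: d_def fun_eq_iff)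
  then show thesis
    using that[OF q rT] r[OF T] v\<Phi> \<Phi>' \<Phi>'_eq by simp
qed

text \<open>The bubble vanishes on vertices and edges, so the difference of the quadratic parts has
  zero vertex values and zero edge integrals, and \<open>polys_2_zero\<close> applies.\<close>

lemma W_h_decomposition:
  assumes W: "W \<in> W_h \<Omega> \<T> nrm" and G: "G \<in> Vh_grad \<Omega> \<T>"
    and agree0: "agree_interior \<Omega> \<T> 0 (dof_vertex W) (dof_vertex G)"
    and agree1: "agree_interior \<Omega> \<T> 1 (dof_edge W) (dof_edge G)"
    and T: "T \<in> \<T>"
  obtains q where "q \<in> polys 1" "restr T G \<in> polys 2"
    "AE x in lebesgue_on T. G x = restr T G x"
    "restr T W = (\<lambda>x. restr T G x + bubble T x * q x)"
    "AE x in lebesgue_on T. W x = restr T G x + bubble T x * q x"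
proof -
  have G0: "G \<in> H01 \<Omega>" using G by (simp add: Vh_grad_def)
  have r: "restr T G \<in> polys 2 \<and> (AE x in lebesgue_on T. G x = restr T G x)" if T: "T \<in> \<T>" for T
  proof -
    obtain p where p: "p \<in> polys 2" "AE x in lebesgue_on T. G x = p x"
      using G T unfolding Vh_grad_def piecewise_def by blast
    have "restr T G = p"
      using p by (intro restr_piece T polys_real_polynomial_function)
    then show ?thesis using p by simp
  qed
  \<comment> \<open>Holds at every boundary point of \<open>T\<close>, hence also for vertices and
    edges on the boundary that belong to no boundary face of \<open>T\<close>.\<close>
  have boundary: "restr T G x = 0" if "x \<in> frontier \<Omega>" "x \<in> T" for x
    by (rule H01_boundary_value[OF G0 _ _ that(1) T that(2)])
      (use r in \<open>auto intro: polys_real_polynomial_function\<close>)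
  obtain C where "tetrahedron C T" using T by (rule mesh_tetrahedron)
  then interpret tetrahedron C T .
  obtain W' where W': "W' \<in> W_loc T" "AE x in lebesgue_on T. W x = W' x"
    using W T unfolding W_h_def piecewise_def by blast
  then obtain p q where p: "p \<in> polys 2" and q: "q \<in> polys 1" and W'_eq: "W' = (\<lambda>x. p x + bubble T x * q x)"
    unfolding W_loc_def by blast
  have rW: "restr T W = W'"
    unfolding W'_eq
    by (rule restr_piece[OF T]) (use W' W'_eq in \<open>auto intro!: real_polynomial_function.intros(3,4)
      bubble_polynomial polys_real_polynomial_function[OF p] polys_real_polynomial_function[OF q]\<close>)
  define d where "d x = p x - restr T G x" for x
  have rT: "restr T G \<in> polys 2" using r[OF T] by simp
  have dp: "d \<in> polys 2" unfolding d_def[abs_def] by (intro polys_diff p rT)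
  have "d x = 0" for x
  proof (rule polys_2_zero[OF dp])
    fix a assume a: "a \<in> C"
    have S: "{a} \<in> subsimplices \<T> 0" and F: "{a} face_of T"
      using subsimplexI[OF T \<open>tetrahedron C T\<close>, of "{a}" 0] face_simplex(1)[of "{a}" 0] a by auto
    have "card C > card {a}" using card_C by simp
    then have "\<not> C \<subseteq> {a}" by (meson card_mono finite.intros leD)
    then obtain b where "b \<in> C" "b \<notin> {a}" by blast
    then have "bubble T a = 0" using a by (intro bubble_zero_on_face[of "{a}" b]) auto
    then have pa: "dof_vertex W T {a} = p a" by (simp add: dof_vertex_def rW W'_eq)
    show "d a = 0"
    proof (cases "{a} \<subseteq> frontier \<Omega>")
      case True
      then have "dof_vertex W T {a} = 0" using W S T F unfolding W_h_def vanishing_def by blast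
      moreover have "restr T G a = 0" using True F face_of_imp_subset by (intro boundary) blast+
      ultimately show ?thesis using pa by (simp add: d_def)
    next
      case False
      then have "dof_vertex W T {a} = dof_vertex G T {a}" using agree0 S T F unfolding agree_interior_def by blast
      then show ?thesis using pa by (simp add: d_def dof_vertex_def)
    qed
  next
    fix a b assume a: "a \<in> C" and b: "b \<in> C" and ab: "a \<noteq> b"
    define e where "e = convex hull {a, b}"
    have card2: "int (card {a, b}) = 1 + 1" using ab by simp
    have eS: "e \<in> subsimplices \<T> 1" and eT: "e face_of T"
      unfolding e_def using a b card2
      by (auto intro!: subsimplexI[OF T \<open>tetrahedron C T\<close>] face_simplex(1)[of _ 1])
    have "card C > card {a, b}" using card_C ab by simp
    then have "\<not> C \<subseteq> {a, b}" by (meson card_mono finite.intros leD)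
    then obtain c where c: "c \<in> C" "c \<notin> {a, b}" by blast
    have b0: "bubble T x = 0" if "x \<in> e" for x
      using that a b c convex_hull_subset_affine_hull unfolding e_def
      by (intro bubble_zero_on_face[of "{a, b}" c]) blast+
    have cW: "continuous_on UNIV (\<lambda>x. p x + bubble T x * q x)"
      by (intro continuous_intros polys_continuous[OF p] polys_continuous[OF q] smooth_continuous_on
          real_polynomial_function_smooth bubble_polynomial)
    have pe: "dof_edge W T e = (\<integral>x. p x \<partial>edge_measure e)"
      unfolding dof_edge_def rW W'_eq
      using b0 by (intro edge_integral_cong[OF e_def ab cW polys_continuous[OF p]]) simp
    have "(\<integral>x. p x \<partial>edge_measure e) = (\<integral>x. restr T G x \<partial>edge_measure e)"
    proof (cases "e \<subseteq> frontier \<Omega>")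
      case True
      then have "dof_edge W T e = 0" using W eS T eT unfolding W_h_def vanishing_def by blast
      moreover have "(\<integral>x. restr T G x \<partial>edge_measure e) = (\<integral>x. 0 \<partial>edge_measure e)"
        using True eT face_of_imp_subset
        by (intro edge_integral_cong[OF e_def ab polys_continuous[OF rT]] boundary) auto
      ultimately show ?thesis using pe by simp
    next
      case False
      then have "dof_edge W T e = dof_edge G T e" using agree1 eS T eT unfolding agree_interior_def by blast
      then show ?thesis using pe by (simp add: dof_edge_def)
    qed
    then show "(\<integral>x. d x \<partial>edge_measure (convex hull {a, b})) = 0"
      unfolding d_def e_def[symmetric]
      by (subst Bochner_Integration.integral_diff)
        (auto intro: edge_integrable[OF e_def ab] polys_continuous[OF p] polys_continuous[OF rT])
  qed
  then have "p = restr T G" by (simp add: d_def fun_eq_iff)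
  then show thesis using that[OF q rT] r[OF T] rW W' W'_eq by simp
qed

text \<open>Applying the local divergence lemma to \<open>u x *\<^sub>R axis i 1\<close> gives the
  classical relation almost everywhere in the interior of \<open>T\<close>; continuity and the
  identity principle for polynomials extend it to all points.\<close>

lemma weak_grad_on_element:
  assumes w: "has_weak_grad \<Omega> u g" and T: "T \<in> \<T>"
    and p: "real_polynomial_function p" "AE x in lebesgue_on T. u x = p x"
    and P: "P \<in> vpolys 1" "AE x in lebesgue_on T. g x = P x"
  shows "grad p x = P x"
proof -
  note w' = w[unfolded has_weak_grad_iff[OF dom]]
  have uL: "u \<in> L2 \<Omega>" using w' by simp
  let ?S = "interior T"
  have "pd i p x = component i P x" for i
  proof -
    have c: "component j (\<lambda>x. p x *\<^sub>R axis i 1) = (\<lambda>x. if j = i then p x else 0)" for j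
      by (auto simp: component_def axis_def)
    have "AE x in lebesgue_on ?S. - g x $ i = - (\<Sum>j\<in>UNIV. pd j (component j (\<lambda>x. p x *\<^sub>R axis i 1)) x)"
    proof (rule local_weak_divergence[OF dom open_interior interior_subset_domain[OF T]])
      show "(\<lambda>x. u x *\<^sub>R (axis i 1 :: real^3)) \<in> L2 \<Omega>"
        by (rule L2_bound[OF uL]) (use L2_measurable[OF uL] in \<open>auto intro!: borel_measurable_scaleR\<close>)
      show "(\<lambda>x. - g x $ i) \<in> L2 \<Omega>"
        using L2_cmult[OF L2_component[of g \<Omega> i], of "-1"] w' by (simp add: component_def)
      show "smooth (component j (\<lambda>x. p x *\<^sub>R axis i 1))" for j
        using real_polynomial_function_smooth[OF p(1)] smooth_const[of 0] by (cases "j = i") (simp_all add: c)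
      show "AE x in lebesgue_on ?S. u x *\<^sub>R axis i 1 = p x *\<^sub>R axis i 1"
        using AE_mesh_interior[OF T p(2)] by auto
      show "(\<integral>x. u x *\<^sub>R axis i 1 \<bullet> grad \<phi> x \<partial>lebesgue_on \<Omega>) = (\<integral>x. - g x $ i * \<phi> x \<partial>lebesgue_on \<Omega>)"
        if "\<phi> \<in> test ?S" for \<phi>
        using w' test_mono[OF that interior_subset_domain[OF T]] by (simp add: inner_axis')
    qed
    moreover have "(\<Sum>j\<in>UNIV. pd j (component j (\<lambda>x. p x *\<^sub>R axis i 1)) x) = pd i p x" for x
    proof -
      have "pd j (component j (\<lambda>x. p x *\<^sub>R axis i 1)) x = (if j = i then pd i p x else 0)" for j
        by (cases "j = i") (simp_all add: c pd_const)
      then show ?thesis by simp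
    qed
    ultimately have "AE x in lebesgue_on ?S. g x $ i = pd i p x" by simp
    with AE_mesh_interior[OF T P(2)] have "AE x in lebesgue_on ?S. pd i p x = component i P x"
      by eventually_elim (simp add: component_def)
    then have "AE x in lebesgue. x \<in> ?S \<longrightarrow> pd i p x = component i P x"
      by (simp add: AE_restrict_space_iff)
    moreover have rp: "real_polynomial_function (component i P)" "real_polynomial_function (pd i p)"
      using P(1) p(1) by (auto simp: vpolys_def intro: polys_real_polynomial_function real_polynomial_function_pd)
    ultimately have eq: "pd i p y = component i P y" if "y \<in> ?S" for y
      using that by (intro continuous_AE_eq_on_open[of ?S "pd i p" "component i P"] smooth_continuous_on
          real_polynomial_function_smooth) auto
    have "pd i p x - component i P x = 0"
      by (rule real_polynomial_function_zero_on_open[OF real_polynomial_function_diff[OF rp(2,1)] open_interior mesh_interior[OF T]])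
        (simp add: eq)
    then show ?thesis by simp
  qed
  then show ?thesis by (simp add: vec_eq_iff component_def)
qed

section \<open>Gluing and comparing the bubbles\<close>

lemma bubble_sum_weak_grad:
  assumes q: "\<And>T. T \<in> \<T> \<Longrightarrow> q T \<in> polys 1"
  shows "has_weak_grad \<Omega> (glue (\<lambda>T x. bubble T x * q T x)) (glue (\<lambda>T. grad (\<lambda>y. bubble T y * q T y)))"
proof (rule glue_weak_grad)
  fix T assume T: "T \<in> \<T>"
  obtain C where "tetrahedron C T" using T by (rule mesh_tetrahedron)
  then interpret tetrahedron C T .
  show "smooth (\<lambda>x. bubble T x * q T x)"
    by (intro smooth_mult real_polynomial_function_smooth bubble_polynomial polys_real_polynomial_function[OF q[OF T]])
  show "bubble T x * q T x = 0" if "x \<in> frontier T" for x using bubble_zero_on_frontier[OF that] by simp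
qed

text \<open>The common part \<open>G\<close> cancels, so the bubble with coefficient
  \<open>q - q'\<close> has zero normal moment on all four faces. Each face yields one vanishing sum
  over three vertices, and \<open>bubble_unisolvent\<close> concludes.\<close>

lemma face_dofs_determine_bubble:
  assumes orient: "oriented \<T> tng nrm" and T: "T \<in> \<T>" and q: "q \<in> polys 1" "q' \<in> polys 1"
    and G: "G \<in> vpolys 1"
    and dof: "\<And>F. F \<in> subsimplices \<T> 2 \<Longrightarrow> F face_of T \<Longrightarrow>
      (\<integral>x. (G x + grad (\<lambda>y. bubble T y * q y) x) \<bullet> nrm F \<partial>face_measure F) =
      (\<integral>x. (G x + grad (\<lambda>y. bubble T y * q' y) x) \<bullet> nrm F \<partial>face_measure F)"
  shows "q = q'"
proof -
  obtain C where "tetrahedron C T" using T by (rule mesh_tetrahedron)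
  then interpret tetrahedron C T .
  define d where "d x = q x - q' x" for x
  have dp: "d \<in> polys 1" unfolding d_def[abs_def] by (intro polys_diff q)
  have "d x = 0" for x
  proof (rule bubble_unisolvent[OF dp])
    fix z assume z: "z \<in> C"
    let ?F = "convex hull (C - {z})"
    have card3: "card (C - {z}) = 3" using z card_C finite_C by simp
    have FS: "?F \<in> subsimplices \<T> 2" and FT: "?F face_of T"
      using card3 by (auto intro!: subsimplexI[OF T \<open>tetrahedron C T\<close>] face_simplex(1)[of _ 2])
    show "(\<Sum>a\<in>C - {z}. d a) = 0"
    proof (rule face_bubble_moment[OF z dp])
      show "norm (nrm ?F) = 1" "\<And>x y. x \<in> ?F \<Longrightarrow> y \<in> ?F \<Longrightarrow> (x - y) \<bullet> nrm ?F = 0"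
        using orient FS unfolding oriented_def by blast+
      obtain a b c where "C - {z} = {a, b, c}" using card3 by (auto simp: card_3_iff)
      then have "?F = convex hull {a, b, c}" by simp
      then have int: "integrable (face_measure ?F) f" if "continuous_on UNIV f" for f :: "real^3 \<Rightarrow> real"
        by (rule face_integral) (use that in blast)
      have i: "integrable (face_measure ?F) (\<lambda>x. (G x + grad (\<lambda>y. bubble T y * r y) x) \<bullet> nrm ?F)" if "r \<in> polys 1" for r
        by (intro int continuous_intros vpolys_continuous[OF G] bubble_grad_continuous[OF that])
      have "grad (\<lambda>y. bubble T y * d y) x \<bullet> nrm ?F =
          (G x + grad (\<lambda>y. bubble T y * q y) x) \<bullet> nrm ?F - (G x + grad (\<lambda>y. bubble T y * q' y) x) \<bullet> nrm ?F" for x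
      proof -
        have df: "(\<lambda>y. bubble T y * r y) differentiable (at x)" if "r \<in> polys 1" for r
          by (intro smooth_differentiable smooth_mult real_polynomial_function_smooth bubble_polynomial
              polys_real_polynomial_function[OF that])
        have "(\<lambda>y. bubble T y * q y) = (\<lambda>y. bubble T y * d y + bubble T y * q' y)"
          by (simp add: d_def fun_eq_iff algebra_simps)
        then have "grad (\<lambda>y. bubble T y * q y) x = grad (\<lambda>y. bubble T y * d y) x + grad (\<lambda>y. bubble T y * q' y) x"
          using grad_add[OF df[OF dp] df[OF q(2)]] by simp
        then show ?thesis by (simp add: inner_add_left)
      qed
      then show "(\<integral>x. grad (\<lambda>y. bubble T y * d y) x \<bullet> nrm ?F \<partial>face_measure ?F) = 0"
        using dof[OF FS FT] i[OF q(1)] i[OF q(2)] by simp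
    qed
  qed
  then show ?thesis by (simp add: d_def fun_eq_iff)
qed

lemma AE_plus_glue:
  assumes "\<And>T. T \<in> \<T> \<Longrightarrow> AE x in lebesgue_on T. f x = r T x + g T x"
    and "\<And>T. T \<in> \<T> \<Longrightarrow> AE x in lebesgue_on T. h x = r T x"
  shows "AE x in lebesgue_on \<Omega>. h x + glue g x = f x"
proof (rule AE_domainI)
  fix T assume T: "T \<in> \<T>"
  have "AE x in lebesgue_on (interior T). x \<in> interior T" by (rule AE_I2) simp
  with AE_mesh_interior[OF T assms(1)[OF T]] AE_mesh_interior[OF T assms(2)[OF T]]
  show "AE x in lebesgue_on (interior T). h x + glue g x = f x"
    by eventually_elim (simp add: glue_eq[OF T])
qed

lemma has_weak_curl_add_curl_free:
  assumes v: "has_weak_curl \<Omega> v w" and g: "has_weak_curl \<Omega> g (\<lambda>x. 0)" and f: "f \<in> L2 \<Omega>"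
    and ae: "AE x in lebesgue_on \<Omega>. v x + g x = f x"
  shows "has_weak_curl \<Omega> f w"
  unfolding has_weak_curl_def
proof (intro conjI ballI f)
  show "w \<in> L2 \<Omega>" using v by (simp add: has_weak_curl_def)
  fix \<psi> assume \<psi>: "\<psi> \<in> vtest \<Omega>"
  have L: "v \<in> L2 \<Omega>" "g \<in> L2 \<Omega>" using v g by (auto simp: has_weak_curl_def)
  have t: "component i \<psi> \<in> test \<Omega>" for i using \<psi> by (simp add: vtest_def)
  have ct: "component i (curl \<psi>) \<in> test \<Omega>" for i
    using exhaust_3[of i] by (auto simp: component_def[of _ "curl \<psi>", abs_def] curl_def intro!: test_diff test_pd t)
  have int: "integrable (lebesgue_on \<Omega>) (\<lambda>x. u x \<bullet> curl \<psi> x)" if "u \<in> L2 \<Omega>" for u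
    unfolding inner_vec_def inner_real_def
    using L2_test_integrable_mult[OF dom L2_component[OF that] ct]
    by (intro Bochner_Integration.integrable_sum) (simp add: component_def)
  have "(\<integral>x. f x \<bullet> curl \<psi> x \<partial>lebesgue_on \<Omega>) = (\<integral>x. v x \<bullet> curl \<psi> x + g x \<bullet> curl \<psi> x \<partial>lebesgue_on \<Omega>)"
  proof (rule integral_cong_AE)
    show "(\<lambda>x. f x \<bullet> curl \<psi> x) \<in> borel_measurable (lebesgue_on \<Omega>)" using int[OF f] by auto
    show "(\<lambda>x. v x \<bullet> curl \<psi> x + g x \<bullet> curl \<psi> x) \<in> borel_measurable (lebesgue_on \<Omega>)"
      using int[OF L(1)] int[OF L(2)] by auto
    show "AE x in lebesgue_on \<Omega>. f x \<bullet> curl \<psi> x = v x \<bullet> curl \<psi> x + g x \<bullet> curl \<psi> x"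
      using ae by eventually_elim (auto simp: inner_add_left[symmetric])
  qed
  also have "\<dots> = (\<integral>x. w x \<bullet> \<psi> x \<partial>lebesgue_on \<Omega>)"
    using v g \<psi> int[OF L(1)] int[OF L(2)] by (simp add: has_weak_curl_def)
  finally show "(\<integral>x. f x \<bullet> curl \<psi> x \<partial>lebesgue_on \<Omega>) = (\<integral>x. w x \<bullet> \<psi> x \<partial>lebesgue_on \<Omega>)" .
qed

end

theorem lemma2p4:
  fixes \<Omega> :: "(real^3) set" and \<T> :: "(real^3) set set"
    and tng nrm :: "(real^3) set \<Rightarrow> real^3"
    and \<Pi>\<^sub>g :: "(real^3 \<Rightarrow> real) \<Rightarrow> real^3 \<Rightarrow> real"
    and \<Pi>\<^sub>N\<^sub>D :: "(real^3 \<Rightarrow> real^3) \<Rightarrow> real^3 \<Rightarrow> real^3"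
    and I\<^sub>R\<^sub>T :: "(real^3 \<Rightarrow> real^3) \<Rightarrow> real^3 \<Rightarrow> real^3"
    and Q\<^sub>h :: "(real^3 \<Rightarrow> real) \<Rightarrow> real^3 \<Rightarrow> real"
    and I\<^sub>\<Phi> :: "(real^3 \<Rightarrow> real^3) \<Rightarrow> real^3 \<Rightarrow> real^3"
    and I\<^sub>W :: "(real^3 \<Rightarrow> real) \<Rightarrow> real^3 \<Rightarrow> real"
  assumes "polyhedral_domain \<Omega>" and "bounded \<Omega>" and "contractible \<Omega>"
    and "tet_mesh \<Omega> \<T>" and "oriented \<T> tng nrm"
    and "l2_projection \<Omega> (H01 \<Omega>) (Vh_grad \<Omega> \<T>) \<Pi>\<^sub>g"
    and "l2_projection \<Omega> (H0curl \<Omega>) (Vh_ND \<Omega> \<T>) \<Pi>\<^sub>N\<^sub>D"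
    and "l2_projection \<Omega> (H0div \<Omega>) (Vh_div \<Omega> \<T>) I\<^sub>R\<^sub>T"
    and "l2_projection \<Omega> (L20 \<Omega>) (Q_space \<Omega> \<T>) Q\<^sub>h"
    and "\<And>v. v \<in> H01 \<Omega> \<Longrightarrow> has_weak_grad \<Omega> (\<Pi>\<^sub>g v) (\<Pi>\<^sub>N\<^sub>D (wgrad \<Omega> v))"
    and "\<And>v. v \<in> H0curl \<Omega> \<Longrightarrow> has_weak_curl \<Omega> (\<Pi>\<^sub>N\<^sub>D v) (I\<^sub>R\<^sub>T (wcurl \<Omega> v))"
    and "\<And>v. v \<in> H0div \<Omega> \<Longrightarrow> has_weak_div \<Omega> (I\<^sub>R\<^sub>T v) (Q\<^sub>h (wdiv \<Omega> v))"
    and "is_I_Phi \<Omega> \<T> tng nrm \<Pi>\<^sub>N\<^sub>D I\<^sub>\<Phi>"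
    and "is_I_W \<Omega> \<T> nrm \<Pi>\<^sub>g I\<^sub>W"
  shows "(\<forall>v\<in>H02 \<Omega>. has_weak_grad \<Omega> (I\<^sub>W v) (I\<^sub>\<Phi> (wgrad \<Omega> v))) \<and>
         (\<forall>v\<in>H01_vec \<Omega>. has_weak_curl \<Omega> (I\<^sub>\<Phi> v) (I\<^sub>R\<^sub>T (wcurl \<Omega> v))) \<and>
         (\<forall>v\<in>H0div \<Omega>. has_weak_div \<Omega> (I\<^sub>R\<^sub>T v) (Q\<^sub>h (wdiv \<Omega> v)))"
proof -
  interpret meshed_domain \<Omega> \<T> using assms(1,2,4) by unfold_locales
  \<comment> \<open>Packaged as a predicate so that a single choice over the mesh yields the bubble
    coefficients together with all their properties.\<close>
  define D where "D v T q \<longleftrightarrow> q \<in> polys 1 \<and> vrestr T (\<Pi>\<^sub>N\<^sub>D v) \<in> vpolys 1 \<and>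
      (AE x in lebesgue_on T. \<Pi>\<^sub>N\<^sub>D v x = vrestr T (\<Pi>\<^sub>N\<^sub>D v) x) \<and>
      vrestr T (I\<^sub>\<Phi> v) = (\<lambda>x. vrestr T (\<Pi>\<^sub>N\<^sub>D v) x + grad (\<lambda>y. bubble T y * q y) x) \<and>
      (AE x in lebesgue_on T. I\<^sub>\<Phi> v x = vrestr T (\<Pi>\<^sub>N\<^sub>D v) x + grad (\<lambda>y. bubble T y * q y) x)" for v T q
  have decomp: "\<exists>q. D v T q"
    if v: "v \<in> H01_vec \<Omega>" and T: "T \<in> \<T>" for v T
  proof -
    have "I\<^sub>\<Phi> v \<in> Phi_h \<Omega> \<T> tng nrm"
      and "\<And>q. q \<in> polys 1 \<Longrightarrow> agree_interior \<Omega> \<T> 1 (dof_tangential tng q (I\<^sub>\<Phi> v)) (dof_tangential tng q (\<Pi>\<^sub>N\<^sub>D v))"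
      using assms(13) v unfolding is_I_Phi_def by auto
    moreover have "\<Pi>\<^sub>N\<^sub>D v \<in> Vh_ND \<Omega> \<T>"
      using assms(7) H01_vec_H0curl[OF dom v] unfolding l2_projection_def by blast
    ultimately show ?thesis
      unfolding D_def by (rule_tac Phi_h_decomposition[OF assms(5) _ _ _ T]) blast+
  qed
  have curl: "has_weak_curl \<Omega> (I\<^sub>\<Phi> v) (I\<^sub>R\<^sub>T (wcurl \<Omega> v))" if v: "v \<in> H01_vec \<Omega>" for v
  proof -
    obtain q where "\<And>T. T \<in> \<T> \<Longrightarrow> D v T (q T)"
      using bchoice[of \<T> "D v"] decomp[OF v] by blast
    then have q: "\<And>T. T \<in> \<T> \<Longrightarrow> q T \<in> polys 1"
      "\<And>T. T \<in> \<T> \<Longrightarrow> AE x in lebesgue_on T. \<Pi>\<^sub>N\<^sub>D v x = vrestr T (\<Pi>\<^sub>N\<^sub>D v) x"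
      "\<And>T. T \<in> \<T> \<Longrightarrow> AE x in lebesgue_on T. I\<^sub>\<Phi> v x = vrestr T (\<Pi>\<^sub>N\<^sub>D v) x + grad (\<lambda>y. bubble T y * q T y) x"
      unfolding D_def by simp_all
    show ?thesis
    proof (rule has_weak_curl_add_curl_free)
      \<comment> \<open>The known commuting relation supplies the curl; the interpolant differs from
        \<open>\<Pi>\<^sub>N\<^sub>D v\<close> only by the gradient of glued bubbles.\<close>
      show "has_weak_curl \<Omega> (\<Pi>\<^sub>N\<^sub>D v) (I\<^sub>R\<^sub>T (wcurl \<Omega> v))" by (intro assms(11) H01_vec_H0curl[OF dom v])
      show "has_weak_curl \<Omega> (glue (\<lambda>T. grad (\<lambda>y. bubble T y * q T y))) (\<lambda>x. 0)"
        by (rule weak_curl_weak_grad[OF dom bubble_sum_weak_grad[OF q(1)]])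
      show "I\<^sub>\<Phi> v \<in> L2 \<Omega>" using assms(13) v unfolding is_I_Phi_def Phi_h_def by blast
      show "AE x in lebesgue_on \<Omega>. \<Pi>\<^sub>N\<^sub>D v x + glue (\<lambda>T. grad (\<lambda>y. bubble T y * q T y)) x = I\<^sub>\<Phi> v x"
        by (rule AE_plus_glue[OF q(3,2)])
    qed
  qed
  have "has_weak_grad \<Omega> (I\<^sub>W v) (I\<^sub>\<Phi> (wgrad \<Omega> v))" if v: "v \<in> H02 \<Omega>" for v
  proof -
    let ?g = "wgrad \<Omega> v"
    note v' = H02_facts(2,3)[OF dom v]
    have wg: "has_weak_grad \<Omega> (\<Pi>\<^sub>g v) (\<Pi>\<^sub>N\<^sub>D ?g)" by (rule assms(10)[OF v'(1)])
    have W: "I\<^sub>W v \<in> W_h \<Omega> \<T> nrm" and G: "\<Pi>\<^sub>g v \<in> Vh_grad \<Omega> \<T>"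
      and \<Phi>: "I\<^sub>\<Phi> ?g \<in> Phi_h \<Omega> \<T> tng nrm"
      using assms(6,13,14) v v' unfolding is_I_W_def is_I_Phi_def l2_projection_def by blast+
    \<comment> \<open>The same \<open>q\<close> occurs in the scalar and in the vector
      decomposition; hence the weak gradient of the glued scalar bubble is exactly the bubble part
      of the vector interpolant.\<close>
    define Q where "Q T q \<longleftrightarrow> q \<in> polys 1 \<and>
        (AE x in lebesgue_on T. \<Pi>\<^sub>g v x = restr T (\<Pi>\<^sub>g v) x) \<and>
        (AE x in lebesgue_on T. I\<^sub>W v x = restr T (\<Pi>\<^sub>g v) x + bubble T x * q x) \<and>
        (AE x in lebesgue_on T. \<Pi>\<^sub>N\<^sub>D ?g x = vrestr T (\<Pi>\<^sub>N\<^sub>D ?g) x) \<and>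
        (AE x in lebesgue_on T. I\<^sub>\<Phi> ?g x = vrestr T (\<Pi>\<^sub>N\<^sub>D ?g) x + grad (\<lambda>y. bubble T y * q y) x)" for T q
    have "\<exists>q. Q T q"
      if T: "T \<in> \<T>" for T
    proof -
      obtain q' where q': "q' \<in> polys 1" "vrestr T (\<Pi>\<^sub>N\<^sub>D ?g) \<in> vpolys 1"
        "AE x in lebesgue_on T. \<Pi>\<^sub>N\<^sub>D ?g x = vrestr T (\<Pi>\<^sub>N\<^sub>D ?g) x"
        "vrestr T (I\<^sub>\<Phi> ?g) = (\<lambda>x. vrestr T (\<Pi>\<^sub>N\<^sub>D ?g) x + grad (\<lambda>y. bubble T y * q' y) x)"
        "AE x in lebesgue_on T. I\<^sub>\<Phi> ?g x = vrestr T (\<Pi>\<^sub>N\<^sub>D ?g) x + grad (\<lambda>y. bubble T y * q' y) x"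
        using decomp[OF v'(2) T] unfolding D_def by blast
      have "agree_interior \<Omega> \<T> 0 (dof_vertex (I\<^sub>W v)) (dof_vertex (\<Pi>\<^sub>g v))"
        "agree_interior \<Omega> \<T> 1 (dof_edge (I\<^sub>W v)) (dof_edge (\<Pi>\<^sub>g v))"
        using assms(14) v unfolding is_I_W_def by blast+
      then obtain q where q: "q \<in> polys 1" "restr T (\<Pi>\<^sub>g v) \<in> polys 2"
        "AE x in lebesgue_on T. \<Pi>\<^sub>g v x = restr T (\<Pi>\<^sub>g v) x"
        "restr T (I\<^sub>W v) = (\<lambda>x. restr T (\<Pi>\<^sub>g v) x + bubble T x * q x)"
        "AE x in lebesgue_on T. I\<^sub>W v x = restr T (\<Pi>\<^sub>g v) x + bubble T x * q x"
        using W_h_decomposition[OF W G _ _ T] by blast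
      \<comment> \<open>The weak commuting relation becomes an identity of polynomials on
        \<open>T\<close>, so the two face moments have the same part without bubble and only the
        bubbles remain to be compared.\<close>
      have gr: "grad (restr T (\<Pi>\<^sub>g v)) x = vrestr T (\<Pi>\<^sub>N\<^sub>D ?g) x" for x
        by (rule weak_grad_on_element[OF wg T polys_real_polynomial_function[OF q(2)] q(3) q'(2,3)])
      have grW: "grad (restr T (I\<^sub>W v)) x = vrestr T (\<Pi>\<^sub>N\<^sub>D ?g) x + grad (\<lambda>y. bubble T y * q y) x" for x
      proof -
        obtain C where "tetrahedron C T" using T by (rule mesh_tetrahedron)
        then interpret tetrahedron C T .
        show ?thesis
          unfolding q(4) gr[symmetric]
          by (intro grad_add smooth_differentiable smooth_mult real_polynomial_function_smooth bubble_polynomial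
              polys_real_polynomial_function[OF q(1)] polys_real_polynomial_function[OF q(2)])
      qed
      have "q = q'"
      proof (rule face_dofs_determine_bubble[OF assms(5) T q(1) q'(1,2)])
        fix F assume F: "F \<in> subsimplices \<T> 2" "F face_of T"
        \<comment> \<open>On a boundary face both moments vanish; on an interior face both equal the
          same trace integral of \<open>wgrad \<Omega> v\<close>, whatever representative
          \<open>face_trace\<close> selects.\<close>
        have "dof_normal_deriv nrm (I\<^sub>W v) T F = dof_normal nrm (I\<^sub>\<Phi> ?g) T F"
        proof (cases "F \<subseteq> frontier \<Omega>")
          case True
          then have "dof_normal_deriv nrm (I\<^sub>W v) T F = 0" "dof_normal nrm (I\<^sub>\<Phi> ?g) T F = 0"
            using W \<Phi> F T unfolding W_h_def Phi_h_def vanishing_def by blast+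
          then show ?thesis by simp
        next
          case False
          have "agree_interior \<Omega> \<T> 2 (dof_normal_deriv nrm (I\<^sub>W v))
              (\<lambda>T F. \<integral>x. face_vtrace \<Omega> F ?g x \<bullet> nrm F \<partial>face_measure F)"
            "agree_interior \<Omega> \<T> 2 (dof_normal nrm (I\<^sub>\<Phi> ?g))
              (\<lambda>T F. \<integral>x. face_vtrace \<Omega> F ?g x \<bullet> nrm F \<partial>face_measure F)"
            using assms(13,14) v v' unfolding is_I_W_def is_I_Phi_def by blast+
          then show ?thesis using F T False unfolding agree_interior_def by simp
        qed
        then show "(\<integral>x. (vrestr T (\<Pi>\<^sub>N\<^sub>D ?g) x + grad (\<lambda>y. bubble T y * q y) x) \<bullet> nrm F \<partial>face_measure F) =
            (\<integral>x. (vrestr T (\<Pi>\<^sub>N\<^sub>D ?g) x + grad (\<lambda>y. bubble T y * q' y) x) \<bullet> nrm F \<partial>face_measure F)"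
          by (simp add: dof_normal_deriv_def dof_normal_def grW q'(4))
      qed
      then have "Q T q" unfolding Q_def using q(1,3,5) q'(3,5) by (intro conjI) simp_all
      then show ?thesis by blast
    qed
    then obtain q where "\<And>T. T \<in> \<T> \<Longrightarrow> Q T (q T)" using bchoice[of \<T> Q] by blast
    then have q: "\<And>T. T \<in> \<T> \<Longrightarrow> q T \<in> polys 1"
        "\<And>T. T \<in> \<T> \<Longrightarrow> AE x in lebesgue_on T. \<Pi>\<^sub>g v x = restr T (\<Pi>\<^sub>g v) x"
        "\<And>T. T \<in> \<T> \<Longrightarrow> AE x in lebesgue_on T. I\<^sub>W v x = restr T (\<Pi>\<^sub>g v) x + bubble T x * q T x"
        "\<And>T. T \<in> \<T> \<Longrightarrow> AE x in lebesgue_on T. \<Pi>\<^sub>N\<^sub>D ?g x = vrestr T (\<Pi>\<^sub>N\<^sub>D ?g) x"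
        "\<And>T. T \<in> \<T> \<Longrightarrow> AE x in lebesgue_on T. I\<^sub>\<Phi> ?g x = vrestr T (\<Pi>\<^sub>N\<^sub>D ?g) x + grad (\<lambda>y. bubble T y * q T y) x"
      unfolding Q_def by simp_all
    show ?thesis
    proof (rule has_weak_grad_cong[OF dom has_weak_grad_add[OF dom wg bubble_sum_weak_grad[OF q(1)]]])
      show "I\<^sub>W v \<in> L2 \<Omega>" "I\<^sub>\<Phi> ?g \<in> L2 \<Omega>" using W \<Phi> unfolding W_h_def Phi_h_def by blast+
      show "AE x in lebesgue_on \<Omega>. \<Pi>\<^sub>g v x + glue (\<lambda>T x. bubble T x * q T x) x = I\<^sub>W v x"
        by (rule AE_plus_glue[OF q(3,2)])
      show "AE x in lebesgue_on \<Omega>. \<Pi>\<^sub>N\<^sub>D ?g x + glue (\<lambda>T. grad (\<lambda>y. bubble T y * q T y)) x = I\<^sub>\<Phi> ?g x"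
        by (rule AE_plus_glue[OF q(5,4)])
    qed
  qed
  \<comment> \<open>The divergence identity is the known commuting relation of
    \<open>I\<^sub>R\<^sub>T\<close> and \<open>Q\<^sub>h\<close>.\<close>
  then show ?thesis using curl assms(12) by blast
qed

end
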